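(* Let $G$ be a profinite group. The commutator subgroup $G'$ is finite-by-procyclic if and only if the set of all commutators $\{[x,y] \mid x,y\in G\}$ of $G$ is contained in a union of countably many procyclic subgroups of $G$.
   Context: For elements $x,y$ of a group, $[x,y]=x^{-1}y^{-1}xy$. For a profinite group $G$, the commutator subgroup $G'$ is the closed subgroup of $G$ (topologically) generated by all commutators $[x,y]$, $x,y\in G$. A profinite group is procyclic if it is topologically generated by one element; procyclic subgroups are closed subgroups. A profinite group $H$ is finite-by-procyclic if it has a finite normal subgroup $N$ such that $H/N$ is procyclic. "Countably many" means finitely or countably infinitely many. *)

theory Defs
  imports "HOL-Analysis.Analysis" "HOL-Algebra.Algebra"
begin

locale topological_group = group G
  for G :: "('a, 'b) monoid_scheme" (structure) and T :: "'a topology" +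
  assumes topspace_eq_carrier: "topspace T = carrier G"
    and continuous_mult: "continuous_map (prod_topology T T) T (\<lambda>(x, y). x \<otimes> y)"
    and continuous_inv: "continuous_map T T (\<lambda>x. inv x)"

locale profinite_group = topological_group +
  assumes compact: "compact_space T"
    and Hausdorff: "Hausdorff_space T"
    and totally_disconnected: "\<And>S. connectedin T S \<Longrightarrow> \<exists>x. S \<subseteq> {x}"

text \<open>The finest topology on the image of the space that makes the map continuous.\<close>

definition quotient_topology :: "'a topology \<Rightarrow> ('a \<Rightarrow> 'b) \<Rightarrow> 'b topology" where
  "quotient_topology T f =
     topology (\<lambda>U. U \<subseteq> f ` topspace T \<and> openin T {x \<in> topspace T. f x \<in> U})"

lemma openin_quotient_topology:
  "openin (quotient_topology T f) U \<longleftrightarrow>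
     U \<subseteq> f ` topspace T \<and> openin T {x \<in> topspace T. f x \<in> U}"
proof -
  have "istopology (\<lambda>U. U \<subseteq> f ` topspace T \<and> openin T {x \<in> topspace T. f x \<in> U})"
    unfolding istopology_def
  proof (intro conjI allI impI)
    fix U V
    assume U: "U \<subseteq> f ` topspace T \<and> openin T {x \<in> topspace T. f x \<in> U}"
      and V: "V \<subseteq> f ` topspace T \<and> openin T {x \<in> topspace T. f x \<in> V}"
    show "U \<inter> V \<subseteq> f ` topspace T" using U by blast
    have "{x \<in> topspace T. f x \<in> U \<inter> V} =
        {x \<in> topspace T. f x \<in> U} \<inter> {x \<in> topspace T. f x \<in> V}" by blast
    then show "openin T {x \<in> topspace T. f x \<in> U \<inter> V}" using U V by auto
  next
    fix K
    assume K: "\<forall>U\<in>K. U \<subseteq> f ` topspace T \<and> openin T {x \<in> topspace T. f x \<in> U}"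
    show "\<Union>K \<subseteq> f ` topspace T" using K by blast
    have "{x \<in> topspace T. f x \<in> \<Union>K} = (\<Union>U\<in>K. {x \<in> topspace T. f x \<in> U})" by blast
    then show "openin T {x \<in> topspace T. f x \<in> \<Union>K}" using K by auto
  qed
  then show ?thesis by (simp add: quotient_topology_def topology_inverse')
qed

lemma topspace_quotient_topology: "topspace (quotient_topology T f) = f ` topspace T"
proof
  show "topspace (quotient_topology T f) \<subseteq> f ` topspace T"
    by (metis openin_quotient_topology openin_topspace)
  have "{x \<in> topspace T. f x \<in> f ` topspace T} = topspace T" by blast
  then have "openin (quotient_topology T f) (f ` topspace T)"
    by (simp add: openin_quotient_topology)
  then show "f ` topspace T \<subseteq> topspace (quotient_topology T f)"
    by (rule openin_subset)
qed

lemma quotient_map_quotient_topology: "quotient_map T (quotient_topology T f) f"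
  by (simp add: quotient_map_def topspace_quotient_topology openin_quotient_topology)

definition topologically_generated ::
    "('a, 'b) monoid_scheme \<Rightarrow> 'a topology \<Rightarrow> 'a set \<Rightarrow> 'a set" where
  "topologically_generated G T S = T closure_of generate G S"

definition procyclic :: "('a, 'b) monoid_scheme \<Rightarrow> 'a topology \<Rightarrow> bool" where
  "procyclic G T \<longleftrightarrow>
     profinite_group G T \<and> (\<exists>a\<in>carrier G. topologically_generated G T {a} = carrier G)"

definition procyclic_subgroup :: "'a set \<Rightarrow> ('a, 'b) monoid_scheme \<Rightarrow> 'a topology \<Rightarrow> bool" where
  "procyclic_subgroup P G T \<longleftrightarrow>
     subgroup P G \<and> closedin T P \<and> procyclic (G\<lparr>carrier := P\<rparr>) (subtopology T P)"

definition finite_by_procyclic :: "('a, 'b) monoid_scheme \<Rightarrow> 'a topology \<Rightarrow> bool" where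
  "finite_by_procyclic H T \<longleftrightarrow>
     profinite_group H T \<and>
     (\<exists>N. N \<lhd> H \<and> finite N \<and>
        procyclic (H Mod N) (quotient_topology T (\<lambda>x. N #>\<^bsub>H\<^esub> x)))"

text \<open>
  The library's \<^const>\<open>derived_set\<close> and \<^const>\<open>derived\<close> use the convention
  \<open>x y x\<^sup>-\<^sup>1 y\<^sup>-\<^sup>1\<close> for commutators, and \<^const>\<open>derived\<close> is the abstract
  (not the closed) commutator subgroup.
\<close>

definition commutator :: "('a, 'b) monoid_scheme \<Rightarrow> 'a \<Rightarrow> 'a \<Rightarrow> 'a" where
  "commutator G x y = inv\<^bsub>G\<^esub> x \<otimes>\<^bsub>G\<^esub> inv\<^bsub>G\<^esub> y \<otimes>\<^bsub>G\<^esub> x \<otimes>\<^bsub>G\<^esub> y"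

definition commutators :: "('a, 'b) monoid_scheme \<Rightarrow> 'a set" where
  "commutators G = {commutator G x y | x y. x \<in> carrier G \<and> y \<in> carrier G}"

definition commutator_subgroup :: "('a, 'b) monoid_scheme \<Rightarrow> 'a topology \<Rightarrow> 'a set" where
  "commutator_subgroup G T = topologically_generated G T (commutators G)"

end

theory Submission
  imports Defs
begin

text \<open>
  Write \<open>[x, y] = x\<^sup>-\<^sup>1 y\<^sup>-\<^sup>1 x y\<close>. Suppose that the commutators are covered by countably many
  procyclic subgroups. For closed normal subgroups \<open>X \<subseteq> Y\<close> and \<open>a, b \<in> G\<close>, Baire's theorem on
  \<open>a X \<times> b Y\<close> gives cosets \<open>g X' \<times> h Y'\<close> of relatively open subgroups all of whose commutators
  lie in one procyclic \<open>P\<close>, and commutator identities then put \<open>[g, X']\<close>, \<open>[h, X']\<close> and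
  \<open>[Y', X']\<close> into \<open>P\<close>. These local pieces are glued by the following observation: a set is
  contained in a procyclic subgroup as soon as any two of its elements are (in a finite abelian
  group this is checked modulo \<open>p\<close>-th powers for every prime \<open>p\<close>).

  Applied to \<open>X = Y = G\<close>, this yields an open normal \<open>H\<close> whose closed commutator subgroup \<open>C\<close> is
  procyclic. Modulo \<open>C\<close> one finds an open \<open>M \<le> H\<close> such that \<open>[G, M]\<close> is procyclic modulo
  \<open>C\<close>; since automorphisms of a procyclic group commute, \<open>C\<close> is centralized by commutators, so
  the closed subgroup \<open>A\<close> generated by \<open>[G, M]\<close> and \<open>C\<close> is abelian and generated by two
  elements. Gluing again, \<open>[G, A \<inter> K]\<close> and \<open>[H \<inter> K, H \<inter> K]\<close> lie in one procyclic \<open>P\<close> for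
  some open \<open>K\<close>, and bilinearity of commutators modulo these groups shows that \<open>A\<^sup>N \<subseteq> P\<close> for some
  \<open>N > 0\<close>. As \<open>A\<^sup>N\<close> is open in \<open>A\<close>, shrinking \<open>M\<close> makes \<open>[G, M]\<close> procyclic. Now Schur's
  theorem, used twice, shows that \<open>G'\<close> is finite modulo the closure \<open>E\<close> of \<open>\<langle>[G, M]\<rangle>\<close>, that
  \<open>E\<close> is central in \<open>G'\<close>, and that a suitable power map is a homomorphism from \<open>G'\<close> to \<open>E\<close>
  with finite kernel.

  Conversely, a finite-by-procyclic group is a finite union of cosets \<open>c Z\<close> of a central procyclic
  subgroup \<open>Z\<close>, where a power \<open>c\<^sup>r\<close> lies in \<open>Z\<close>. Splitting off the \<open>p\<close>-parts for the primes \<open>p\<close>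
  dividing \<open>r\<close> one at a time reduces the countable covering of \<open>c Z\<close> to pro-\<open>p\<close> groups \<open>Z\<close>,
  where all elements of infinite order generate open subgroups.
\<close>

section \<open>Groups\<close>

text \<open>Gluing needs a common procyclic subgroup for any two commutators, while Baire's theorem
  only controls a neighbourhood of a point that it chooses itself. Hence two base points
  \<open>a\<close> and \<open>b\<close> are prescribed at once, and there remains an uncontrolled
  shift: the result concerns \<open>[a x\<^sub>0, X']\<close>, not \<open>[a, X']\<close>. For
  shifts in \<open>H\<close> this is so only modulo \<open>C\<close>, which is why
  \<open>[G, M]\<close> is first procyclic only modulo \<open>C\<close>; for shifts in an abelian
  \<open>A\<close> it is exact, which is why a second pass is made through \<open>A\<close>. In the
  converse direction, a procyclic group can have uncountably many closed subgroups (already if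
  infinitely many primes are involved), so the subgroups generated by elements of \<open>c Z\<close>
  cannot simply be counted. Only primes dividing \<open>r\<close> matter: the part of
  \<open>c\<close> prime to \<open>r\<close> lies in \<open>Z\<close>, since taking
  \<open>r\<close>-th powers is invertible on it. Profinite exponents never occur. Statements about
  procyclic subgroups are checked with integer exponents modulo each open normal subgroup, and
  compactness assembles the solutions.\<close>

context group
begin

lemma inv_mult_cancel:
  assumes "x \<in> carrier G" "y \<in> carrier G"
  shows "inv x \<otimes> (x \<otimes> y) = y" "x \<otimes> (inv x \<otimes> y) = y"
  using assms by (simp_all flip: m_assoc)

lemmas group_word = m_assoc inv_mult_group inv_mult_cancel

lemma commutator_closed [simp]:
  "x \<in> carrier G \<Longrightarrow> y \<in> carrier G \<Longrightarrow> commutator G x y \<in> carrier G"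
  by (simp add: commutator_def)

lemma commutator_inv:
  "x \<in> carrier G \<Longrightarrow> y \<in> carrier G \<Longrightarrow> commutator G y x = inv (commutator G x y)"
  by (simp add: commutator_def group_word)

lemma commutator_mult_left:
  assumes "x \<in> carrier G" "y \<in> carrier G" "z \<in> carrier G"
  shows "commutator G (x \<otimes> y) z =
    commutator G x z \<otimes> commutator G (commutator G x z) y \<otimes> commutator G y z"
  using assms by (simp add: commutator_def group_word)

lemma commutator_mult_right:
  assumes "x \<in> carrier G" "y \<in> carrier G" "z \<in> carrier G"
  shows "commutator G x (y \<otimes> z) = commutator G x z \<otimes> (inv z \<otimes> commutator G x y \<otimes> z)"
  using assms by (simp add: commutator_def group_word)

text \<open>The conjugate of \<open>x\<close> by \<open>z\<close> is written as
  \<open>x [x, z]\<close>, so that conjugating \<open>[g x, h y]\<close> by an element of a normal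
  subgroup visibly keeps the two arguments in their cosets.\<close>

lemma commutator_conj:
  assumes "x \<in> carrier G" "y \<in> carrier G" "z \<in> carrier G"
  shows "inv z \<otimes> commutator G x y \<otimes> z =
    commutator G (x \<otimes> commutator G x z) (y \<otimes> commutator G y z)"
  using assms by (simp add: commutator_def group_word)

lemma conj_conv_commutator:
  assumes "x \<in> carrier G" "y \<in> carrier G"
  shows "inv y \<otimes> x \<otimes> y = x \<otimes> commutator G x y"
  using assms by (simp add: commutator_def group_word)

lemma commutator_conj':
  assumes "x \<in> carrier G" "y \<in> carrier G" "z \<in> carrier G"
  shows "z \<otimes> commutator G x y \<otimes> inv z =
    commutator G (z \<otimes> x \<otimes> inv z) (z \<otimes> y \<otimes> inv z)"
  using assms by (simp add: commutator_def group_word)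

lemma commutator_normal:
  assumes "N \<lhd> G" "x \<in> N" "y \<in> carrier G"
  shows "commutator G x y \<in> N" "commutator G y x \<in> N"
proof -
  interpret normal N G by fact
  have "x \<in> carrier G" using assms(2) by simp
  then have "commutator G x y = inv x \<otimes> (inv y \<otimes> x \<otimes> y)"
    using assms(3) by (simp add: commutator_def group_word)
  then show *: "commutator G x y \<in> N"
    using assms inv_op_closed1 by simp
  have "commutator G y x = inv (commutator G x y)"
    using \<open>x \<in> carrier G\<close> assms(3) by (rule commutator_inv)
  then show "commutator G y x \<in> N" using * by simp
qed

lemma commutator_eq_one_iff:
  assumes "x \<in> carrier G" "y \<in> carrier G"
  shows "commutator G x y = \<one> \<longleftrightarrow> x \<otimes> y = y \<otimes> x"
proof -
  have "y \<otimes> x \<otimes> commutator G x y = x \<otimes> y"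
    using assms by (simp add: commutator_def group_word)
  moreover have "y \<otimes> x \<otimes> c = y \<otimes> x \<longleftrightarrow> c = \<one>" if "c \<in> carrier G" for c
    using assms that by simp
  ultimately show ?thesis
    using assms by (metis commutator_closed m_closed r_one)
qed

lemma subgroup_mult_cancel:
  assumes "subgroup P G" "x \<in> carrier G" "p \<in> P"
  shows "x \<otimes> p \<in> P \<longleftrightarrow> x \<in> P" "p \<otimes> x \<in> P \<longleftrightarrow> x \<in> P"
proof -
  interpret subgroup P G by fact
  have "x = (x \<otimes> p) \<otimes> inv p" "x = inv p \<otimes> (p \<otimes> x)"
    using assms by (simp_all add: group_word)
  then show "x \<otimes> p \<in> P \<longleftrightarrow> x \<in> P" "p \<otimes> x \<in> P \<longleftrightarrow> x \<in> P"
    using assms(3) by (metis m_closed m_inv_closed)+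
qed

lemma subgroup_nat_pow:
  assumes "subgroup H G" "h \<in> H"
  shows "h [^] (k::nat) \<in> H"
  using subgroup_int_pow_closed[OF assms, of "int k"] by (simp add: int_pow_int)

lemma conj_int_pow:
  assumes "x \<in> carrier G" "y \<in> carrier G"
  shows "(inv y \<otimes> x \<otimes> y) [^] (i::int) = inv y \<otimes> x [^] i \<otimes> y"
proof -
  interpret h: group_hom G G "\<lambda>x. inv y \<otimes> x \<otimes> y"
    by unfold_locales (use assms in \<open>auto simp: hom_def group_word\<close>)
  show ?thesis using h.hom_int_pow[of x i] assms by simp
qed

lemma int_pow_commutes:
  assumes "x \<otimes> y = y \<otimes> x" "x \<in> carrier G" "y \<in> carrier G"
  shows "x [^] (i::int) \<otimes> y = y \<otimes> x [^] i"
proof -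
  have "inv y \<otimes> x \<otimes> y = x"
    using assms by (simp add: m_assoc inv_mult_cancel)
  then have *: "inv y \<otimes> x [^] i \<otimes> y = x [^] i"
    using conj_int_pow[of x y i] assms by simp
  have "y \<otimes> x [^] i = y \<otimes> (inv y \<otimes> x [^] i \<otimes> y)" by (simp only: *)
  also have "\<dots> = x [^] i \<otimes> y" using assms by (simp add: group_word)
  finally show ?thesis by simp
qed

lemma centralizer_subgroup:
  assumes "S \<subseteq> carrier G"
  shows "subgroup {x \<in> carrier G. \<forall>s\<in>S. x \<otimes> s = s \<otimes> x} G"
proof
  show "{x \<in> carrier G. \<forall>s\<in>S. x \<otimes> s = s \<otimes> x} \<subseteq> carrier G" by auto
  show "\<one> \<in> {x \<in> carrier G. \<forall>s\<in>S. x \<otimes> s = s \<otimes> x}" using assms by auto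
next
  fix x y assume x: "x \<in> {x \<in> carrier G. \<forall>s\<in>S. x \<otimes> s = s \<otimes> x}"
    and y: "y \<in> {x \<in> carrier G. \<forall>s\<in>S. x \<otimes> s = s \<otimes> x}"
  have "x \<otimes> y \<otimes> s = s \<otimes> (x \<otimes> y)" if "s \<in> S" for s
  proof -
    have s: "s \<in> carrier G" using that assms by auto
    have "x \<otimes> y \<otimes> s = x \<otimes> (s \<otimes> y)" using x y s that by (simp add: m_assoc)
    also have "\<dots> = s \<otimes> x \<otimes> y" using x y s that by (simp flip: m_assoc)
    finally show ?thesis using x y s by (simp add: m_assoc)
  qed
  then show "x \<otimes> y \<in> {x \<in> carrier G. \<forall>s\<in>S. x \<otimes> s = s \<otimes> x}" using x y by simp
next
  fix x assume x: "x \<in> {x \<in> carrier G. \<forall>s\<in>S. x \<otimes> s = s \<otimes> x}"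
  have "inv x \<otimes> s = s \<otimes> inv x" if "s \<in> S" for s
    using x that assms int_pow_commutes[of x s "-1"] by (auto simp: int_pow_neg)
  then show "inv x \<in> {x \<in> carrier G. \<forall>s\<in>S. x \<otimes> s = s \<otimes> x}" using x by simp
qed

text \<open>The centralizer is used twice: \<open>generate G S\<close> centralizes \<open>S\<close>,
  hence \<open>S\<close> lies in the centralizer of \<open>generate G S\<close>, and so does the
  group it generates.\<close>

lemma generate_commutes:
  assumes "S \<subseteq> carrier G" "\<And>s t. s \<in> S \<Longrightarrow> t \<in> S \<Longrightarrow> s \<otimes> t = t \<otimes> s"
    and "x \<in> generate G S" "y \<in> generate G S"
  shows "x \<otimes> y = y \<otimes> x"
proof -
  have 1: "generate G S \<subseteq> {x \<in> carrier G. \<forall>s\<in>S. x \<otimes> s = s \<otimes> x}"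
    using assms by (intro generate_subgroup_incl centralizer_subgroup) auto
  have 2: "generate G S \<subseteq> carrier G" using assms(1) by (rule generate_incl)
  have "generate G S \<subseteq> {y \<in> carrier G. \<forall>x\<in>generate G S. y \<otimes> x = x \<otimes> y}"
    using assms(1) 1 2 by (intro generate_subgroup_incl centralizer_subgroup[OF 2]) auto
  then show ?thesis using assms(3,4) by auto
qed

text \<open>A root \<open>w [^] j\<close> with \<open>j < ord w\<close> satisfies
  \<open>j * r = ord w * k\<close> with \<open>k < r\<close>, so \<open>k\<close> determines it. The
  bound \<open>r\<close> does not depend on the order of \<open>w\<close>; this uniformity carries
  the finiteness over to procyclic groups.\<close>

lemma card_roots_cyclic:
  assumes w: "w \<in> carrier G" and o: "0 < ord w" and r: "0 < r"
  shows "finite {x \<in> generate G {w}. x [^] (r::nat) = \<one>}" (is "finite ?R")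
    and "card {x \<in> generate G {w}. x [^] (r::nat) = \<one>} \<le> r"
proof -
  define o' where "o' = ord w"
  have R: "?R \<subseteq> (\<lambda>k. w [^] (k * o' div r)) ` {..<r}"
  proof
    fix x assume x: "x \<in> ?R"
    then obtain i :: int where i: "x = w [^] i" using generate_pow[OF w] by auto
    define j where "j = nat (i mod int o')"
    have ij: "int o' dvd i - int j"
      using o by (simp add: j_def o'_def flip: mod_eq_dvd_iff)
    have xj: "x = w [^] j"
      using ij int_pow_eq[OF w, of "int j" i] by (simp add: i int_pow_int o'_def)
    have jo: "j < o'" using o by (simp add: j_def o'_def nat_less_iff)
    have "w [^] (j * r) = \<one>" using x w by (simp add: xj nat_pow_pow)
    then have "o' dvd j * r" using w pow_eq_id by (simp add: o'_def)
    then obtain k where k: "j * r = o' * k" by (elim dvdE)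
    have "o' * k < o' * r" using k jo r by (metis mult_less_cancel2)
    then have "k < r" by simp
    moreover have "k * o' div r = j" using k r by (metis div_mult_self_is_m mult.commute)
    ultimately show "x \<in> (\<lambda>k. w [^] (k * o' div r)) ` {..<r}" using xj by auto
  qed
  then show fin: "finite ?R" using finite_surj by blast
  have "card ?R \<le> card ((\<lambda>k. w [^] (k * o' div r)) ` {..<r})"
    using R by (intro card_mono) auto
  also have "\<dots> \<le> r" using card_image_le[of "{..<r}"] by simp
  finally show "card ?R \<le> r" .
qed

end

section \<open>Computing modulo a normal subgroup\<close>

context normal
begin

lemma rcoset_eq_iff:
  assumes "x \<in> carrier G" "y \<in> carrier G"
  shows "H #> x = H #> y \<longleftrightarrow> x \<otimes> inv y \<in> H"
  using assms by (metis rcos_module rcos_self repr_independence is_group is_subgroup)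

lemma rcoset_mult_cong:
  assumes "H #> x = H #> x'" "H #> y = H #> y'"
    and "x \<in> carrier G" "x' \<in> carrier G" "y \<in> carrier G" "y' \<in> carrier G"
  shows "H #> (x \<otimes> y) = H #> (x' \<otimes> y')"
  using assms by (simp flip: rcos_sum)

lemma rcoset_inv_cong:
  assumes "H #> x = H #> x'" "x \<in> carrier G" "x' \<in> carrier G"
  shows "H #> inv x = H #> inv x'"
  using assms by (simp flip: rcos_inv)

lemma rcoset_int_pow_cong:
  assumes "H #> x = H #> x'" "x \<in> carrier G" "x' \<in> carrier G"
  shows "H #> x [^] (i::int) = H #> x' [^] i"
  using assms by (simp flip: FactGroup_int_pow)

lemma rcoset_nat_pow_cong:
  assumes "H #> x = H #> x'" "x \<in> carrier G" "x' \<in> carrier G"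
  shows "H #> x [^] (i::nat) = H #> x' [^] i"
  using assms by (simp flip: FactGroup_pow)

lemma rcoset_mem_iff:
  assumes "x \<in> carrier G"
  shows "H #> x = H #> \<one> \<longleftrightarrow> x \<in> H"
  using rcoset_eq_iff[of x \<one>] assms by simp

lemma rcoset_mono:
  assumes "H \<subseteq> H'" "H' \<lhd> G" "H #> x = H #> y" "x \<in> carrier G" "y \<in> carrier G"
  shows "H' #> x = H' #> y"
  using assms(1,3-5) rcoset_eq_iff[of x y] normal.rcoset_eq_iff[OF assms(2), of x y] by auto

end

subsection \<open>A finite group generated by elements that pairwise lie in cyclic subgroups\<close>

text \<open>If some \<open>s\<close> in \<open>S\<close> is not a \<open>p\<close>-th power, write
  \<open>s = w [^] i\<close> and \<open>t = w [^] j\<close>; then \<open>p\<close> does not divide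
  \<open>i\<close>, so \<open>w\<close>, and with it \<open>t\<close>, is a power of
  \<open>s\<close> up to a \<open>p\<close>-th power. Hence this one \<open>s\<close> generates
  \<open>G\<close> modulo \<open>p\<close>-th powers; if there is no such \<open>s\<close>, then
  \<open>\<one>\<close> does.\<close>

lemma (in comm_group) cyclic_mod_prime_powers:
  assumes S: "S \<subseteq> carrier G" and gen: "generate G S = carrier G"
    and pair: "\<And>s t. s \<in> S \<Longrightarrow> t \<in> S \<Longrightarrow>
      \<exists>w\<in>carrier G. s \<in> generate G {w} \<and> t \<in> generate G {w}"
    and p: "Factorial_Ring.prime (p::nat)"
  shows "\<exists>x\<in>carrier G. \<forall>y\<in>carrier G. \<exists>i::int. \<exists>b\<in>carrier G. y = x [^] i \<otimes> b [^] int p"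
proof -
  \<comment> \<open>\<open>R x\<close> is the product of the cyclic group of \<open>x\<close> and
    the group of \<open>p\<close>-th powers; \<open>R \<one>\<close> consists of the
    \<open>p\<close>-th powers alone.\<close>
  define R where "R x = {y. \<exists>i::int. \<exists>b\<in>carrier G. y = x [^] i \<otimes> b [^] int p}" for x
  have R: "subgroup (R x) G" if x: "x \<in> carrier G" for x
  proof
    show "R x \<subseteq> carrier G" using x by (auto simp: R_def)
    show "\<one> \<in> R x" unfolding R_def using x
      by (intro CollectI exI[of _ 0] bexI[of _ \<one>]) auto
  next
    fix u v assume "u \<in> R x" "v \<in> R x"
    then obtain i b j c where *: "b \<in> carrier G" "c \<in> carrier G"
      "u = x [^] (i::int) \<otimes> b [^] int p" "v = x [^] (j::int) \<otimes> c [^] int p"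
      unfolding R_def by blast
    have "u \<otimes> v = x [^] (i + j) \<otimes> (b \<otimes> c) [^] int p"
      using * x by (simp add: int_pow_mult int_pow_distrib m_ac)
    then show "u \<otimes> v \<in> R x" unfolding R_def using * by blast
  next
    fix u assume "u \<in> R x"
    then obtain i b where *: "b \<in> carrier G" "u = x [^] (i::int) \<otimes> b [^] int p"
      unfolding R_def by blast
    have "inv u = x [^] (-i) \<otimes> (inv b) [^] int p"
      using * x by (simp add: int_pow_neg int_pow_inv inv_mult)
    then show "inv u \<in> R x" unfolding R_def using * by blast
  qed
  have "\<exists>x\<in>carrier G. S \<subseteq> R x"
  proof (cases "S \<subseteq> R \<one>")
    case False
    then obtain s where s: "s \<in> S" "s \<notin> R \<one>" by auto
    have "t \<in> R s" if t: "t \<in> S" for t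
    proof -
      obtain w where w: "w \<in> carrier G" "s \<in> generate G {w}" "t \<in> generate G {w}"
        using pair[OF s(1) t] by auto
      then obtain i j :: int where ij: "s = w [^] i" "t = w [^] j"
        using generate_pow by auto
      have "\<not> int p dvd i"
      proof
        assume "int p dvd i"
        then obtain k where "i = int p * k" by (elim dvdE)
        then have "s = \<one> [^] (0::int) \<otimes> (w [^] k) [^] int p"
          using w ij by (simp add: int_pow_pow mult.commute)
        then show False using s w unfolding R_def by blast
      qed
      then have "coprime i (int p)"
        using p by (metis coprime_commute prime_imp_coprime prime_nat_int_transfer)
      then obtain u v where uv: "u * i + v * int p = 1"
        by (metis bezout_int coprime_iff_gcd_eq_1)
      have "j = i * (u * j) + (v * j) * int p"
        using uv by (metis (no_types, opaque_lifting) distrib_right mult.assoc mult.commute mult_1)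
      then have "t = w [^] (i * (u * j) + (v * j) * int p)" using ij by simp
      then have "t = s [^] (u * j) \<otimes> (w [^] (v * j)) [^] int p"
        using w ij(1) by (simp only: int_pow_mult int_pow_pow)
      then show ?thesis unfolding R_def using w by blast
    qed
    then show ?thesis using s S by blast
  qed auto
  then obtain x where x: "x \<in> carrier G" "S \<subseteq> R x" by auto
  then have "carrier G \<subseteq> R x"
    using generate_subgroup_incl[OF x(2) R[OF x(1)]] gen by simp
  then show ?thesis using x unfolding R_def by blast
qed

text \<open>In the proof, \<open>\<R> x n\<close> says that \<open>x\<close> generates
  \<open>G\<close> modulo \<open>n\<close>-th powers. The solutions for single primes are merged
  into one \<open>x\<close> as in the Chinese remainder theorem; then the property is extended from
  primes to all divisors of the order, and for \<open>n = order G\<close> the \<open>n\<close>-th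
  powers are trivial.\<close>

lemma (in comm_group) finite_pairwise_cyclic:
  assumes S: "S \<subseteq> carrier G" and gen: "generate G S = carrier G"
    and pair: "\<And>s t. s \<in> S \<Longrightarrow> t \<in> S \<Longrightarrow>
      \<exists>w\<in>carrier G. s \<in> generate G {w} \<and> t \<in> generate G {w}"
    and fin: "finite (carrier G)"
  shows "\<exists>x\<in>carrier G. generate G {x} = carrier G"
proof -
  define \<R> where "\<R> x n \<longleftrightarrow>
    (\<forall>y\<in>carrier G. \<exists>i::int. \<exists>b\<in>carrier G. y = x [^] i \<otimes> b [^] (n::int))" for x n
  have many: "\<exists>x\<in>carrier G. \<forall>p\<in>\<pi>. \<R> x (int p)"
    if "finite \<pi>" "\<forall>p\<in>\<pi>. Factorial_Ring.prime p" for \<pi> :: "nat set"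
    using that
  proof induction
    case (insert q \<pi>)
    then obtain x where x: "x \<in> carrier G" "\<forall>p\<in>\<pi>. \<R> x (int p)" by auto
    obtain z where z: "z \<in> carrier G" "\<R> z (int q)"
      using cyclic_mod_prime_powers[OF S gen pair, of q] insert.prems unfolding \<R>_def by auto
    define m where "m = int (\<Prod>\<pi>)"
    \<comment> \<open>modulo \<open>p\<close>-th powers only the first factor survives, modulo \<open>q\<close>-th powers only the second\<close>
    define x' where "x' = x [^] int q \<otimes> z [^] m"
    have x': "x' \<in> carrier G" using x z by (simp add: x'_def)
    \<comment> \<open>Since \<open>k\<close> is invertible modulo \<open>d\<close>, the element
      \<open>a\<close> is a power of \<open>x'\<close> up to a \<open>d\<close>-th power, so
      \<open>x'\<close> can replace \<open>a\<close> as a generator.\<close>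
    have *: "\<R> x' d" if d: "\<R> a d" "coprime k d" and a: "a \<in> carrier G" and c: "c \<in> carrier G"
      and x'_eq: "x' = a [^] k \<otimes> c [^] d" for a c :: 'a and k d :: int
      unfolding \<R>_def
    proof
      fix y assume "y \<in> carrier G"
      then obtain i b where ib: "b \<in> carrier G" "y = a [^] (i::int) \<otimes> b [^] d"
        using d(1) unfolding \<R>_def by blast
      obtain u v where uv: "u * k + v * d = 1"
        using d(2) by (metis bezout_int coprime_iff_gcd_eq_1)
      have "i = k * (u * i) + (v * i) * d"
        using uv by (metis (no_types, opaque_lifting) distrib_right mult.assoc mult.commute mult_1)
      then have ai: "a [^] i = (a [^] k) [^] (u * i) \<otimes> (a [^] (v * i)) [^] d"
        using a by (metis int_pow_mult int_pow_pow)
      have "a [^] k = x' \<otimes> (inv c) [^] d"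
        using a c by (simp add: x'_eq int_pow_inv group_word)
      then have "(a [^] k) [^] (u * i) = x' [^] (u * i) \<otimes> ((inv c) [^] (u * i)) [^] d"
        using x' c by (simp add: int_pow_distrib int_pow_pow mult.commute)
      then have "y = x' [^] (u * i) \<otimes> (inv c [^] (u * i) \<otimes> a [^] (v * i) \<otimes> b) [^] d"
        using ib ai x' a c by (simp add: int_pow_distrib m_ac)
      then show "\<exists>i::int. \<exists>b\<in>carrier G. y = x' [^] i \<otimes> b [^] d"
        using ib x' a c by blast
    qed
    have "\<R> x' (int p)" if p: "p \<in> \<pi>" for p
    proof (rule *[of x "int p" "int q" "z [^] (m div int p)"])
      have "p dvd \<Prod>\<pi>" using insert.hyps(1) p by (rule dvd_prodI[where f="\<lambda>x. x"])
      then have "int p dvd m" unfolding m_def by (simp only: of_nat_dvd_iff)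
      then show "x' = x [^] int q \<otimes> (z [^] (m div int p)) [^] int p"
        using z(1) by (simp add: x'_def int_pow_pow)
      have "p \<noteq> q" using p insert.hyps by auto
      then show "coprime (int q) (int p)"
        using p insert.prems by (simp add: primes_coprime)
    qed (use x z p in auto)
    moreover have "\<R> x' (int q)"
    proof (rule *[of z "int q" m x])
      show "x' = z [^] m \<otimes> x [^] int q" using x z by (simp add: x'_def m_comm)
      have "coprime (\<Prod>\<pi>) q"
        using insert.hyps insert.prems by (intro prod_coprime_left) (auto intro!: primes_coprime)
      then show "coprime m (int q)" by (simp only: m_def coprime_int_iff)
    qed (use x z in auto)
    ultimately show ?case using x' by auto
  qed auto
  have "0 < order G" using fin order_gt_0_iff_finite by blast
  then obtain x where x: "x \<in> carrier G" "\<forall>p\<in>prime_factors (order G). \<R> x (int p)"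
    using many[of "prime_factors (order G)"] by auto
  have *: "\<R> x (int n)" if "n dvd order G" for n
    using that
  proof (induction n rule: prime_divisors_induct)
    case zero then show ?case using \<open>0 < order G\<close> by simp
  next
    case (unit n)
    have "\<exists>i::int. \<exists>b\<in>carrier G. y = x [^] i \<otimes> b [^] (1::int)" if "y \<in> carrier G" for y
      using that x by (intro exI[of _ 0] bexI[of _ y]) auto
    moreover have "int n = 1" using unit by simp
    ultimately show ?case unfolding \<R>_def by auto
  next
    case (factor p n)
    have p: "\<R> x (int p)"
    proof -
      have "p \<in> prime_factors (order G)"
        using factor \<open>0 < order G\<close> by (auto simp: prime_factors_dvd dest: dvd_mult_left)
      then show ?thesis using x by blast
    qed
    have n: "\<R> x (int n)" using factor dvd_mult_right by blast
    show ?case unfolding \<R>_def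
    proof
      fix y assume "y \<in> carrier G"
      then obtain i b where ib: "b \<in> carrier G" "y = x [^] (i::int) \<otimes> b [^] int n"
        using n unfolding \<R>_def by blast
      obtain k c where kc: "c \<in> carrier G" "b = x [^] (k::int) \<otimes> c [^] int p"
        using p ib(1) unfolding \<R>_def by blast
      have "y = x [^] (i + k * int n) \<otimes> c [^] int (p * n)"
        using ib kc x by (simp add: int_pow_distrib int_pow_mult int_pow_pow m_ac)
      then show "\<exists>i::int. \<exists>b\<in>carrier G. y = x [^] i \<otimes> b [^] int (p * n)"
        using kc by blast
    qed
  qed
  have "y \<in> generate G {x}" if y: "y \<in> carrier G" for y
  proof -
    obtain i b where "b \<in> carrier G" "y = x [^] (i::int) \<otimes> b [^] int (order G)"
      using *[OF dvd_refl] y unfolding \<R>_def by blast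
    then have "y = x [^] i" using x by (simp add: int_pow_int pow_order_eq_1)
    then show ?thesis using generate_pow[OF x(1)] by blast
  qed
  then show ?thesis using x generate_incl[of "{x}"] by blast
qed


text \<open>The elements \<open>w\<close> of the hypothesis may lie outside
  \<open>generate G S\<close>. With \<open>s = w [^] i\<close> and \<open>t = w [^] j\<close> the
  power \<open>w [^] gcd i j\<close> is a product of powers of \<open>s\<close> and \<open>t\<close>
  and generates both, so the commutative case applies inside \<open>generate G S\<close>. That the
  final generator is found there allows gluing inside a given closed subgroup.\<close>

lemma (in group) pairwise_cyclic:
  assumes fin: "finite (carrier G)" and S: "S \<subseteq> carrier G"
    and pair: "\<And>s t. s \<in> S \<Longrightarrow> t \<in> S \<Longrightarrow>
      \<exists>w\<in>carrier G. s \<in> generate G {w} \<and> t \<in> generate G {w}"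
  shows "\<exists>x\<in>generate G S. S \<subseteq> generate G {x}"
proof -
  define B where "B = generate G S"
  have B: "subgroup B G" unfolding B_def using S by (rule generate_is_subgroup)
  have SB: "S \<subseteq> B" unfolding B_def by (auto intro: generate.incl)
  have Bsub: "B \<subseteq> carrier G" using B by (rule subgroup.subset)
  have pair': "\<exists>w\<in>B. s \<in> generate G {w} \<and> t \<in> generate G {w}" and comm: "s \<otimes> t = t \<otimes> s"
    if st: "s \<in> S" "t \<in> S" for s t
  proof -
    obtain w where w: "w \<in> carrier G" "s \<in> generate G {w}" "t \<in> generate G {w}"
      using pair[OF st] by auto
    then obtain i j :: int where ij: "s = w [^] i" "t = w [^] j"
      using generate_pow by auto
    show "s \<otimes> t = t \<otimes> s"
      unfolding ij using w(1) by (simp add: add.commute flip: int_pow_mult)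
    obtain u v where uv: "u * i + v * j = gcd i j" using bezout_int by blast
    define w' where "w' = s [^] u \<otimes> t [^] v"
    have "w' \<in> B" unfolding w'_def
      using st SB B by (meson subgroup.m_closed subgroup_int_pow_closed subsetD)
    have w': "w' = w [^] gcd i j"
      unfolding w'_def ij using w(1) uv
      by (simp add: int_pow_pow mult.commute flip: int_pow_mult)
    have "s = w' [^] (i div gcd i j)" "t = w' [^] (j div gcd i j)"
      unfolding w' ij using w(1) by (simp_all add: int_pow_pow)
    then show "\<exists>w\<in>B. s \<in> generate G {w} \<and> t \<in> generate G {w}"
      using \<open>w' \<in> B\<close> Bsub generate_pow[of w'] by blast
  qed
  interpret H: group "G\<lparr>carrier := B\<rparr>" using B by (rule subgroup_imp_group)
  interpret H: comm_group "G\<lparr>carrier := B\<rparr>"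
    by (rule H.group_comm_groupI) (use generate_commutes[OF S comm] in \<open>simp add: B_def\<close>)
  have "\<exists>x\<in>carrier (G\<lparr>carrier := B\<rparr>).
      generate (G\<lparr>carrier := B\<rparr>) {x} = carrier (G\<lparr>carrier := B\<rparr>)"
  proof (rule H.finite_pairwise_cyclic[of S])
    show "generate (G\<lparr>carrier := B\<rparr>) S = carrier (G\<lparr>carrier := B\<rparr>)"
      using generate_consistent[OF SB B] by (simp add: B_def)
    show "finite (carrier (G\<lparr>carrier := B\<rparr>))" using finite_subset[OF Bsub fin] by simp
    fix s t assume "s \<in> S" "t \<in> S"
    then obtain w where "w \<in> B" "s \<in> generate G {w}" "t \<in> generate G {w}"
      using pair' by blast
    then show "\<exists>w\<in>carrier (G\<lparr>carrier := B\<rparr>). s \<in> generate (G\<lparr>carrier := B\<rparr>) {w} \<and>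
        t \<in> generate (G\<lparr>carrier := B\<rparr>) {w}"
      by (intro bexI[of _ w]) (simp_all add: generate_consistent[OF _ B])
  qed (use SB in auto)
  then obtain x where "x \<in> B" "generate (G\<lparr>carrier := B\<rparr>) {x} = B" by auto
  then have "generate G {x} = B" using generate_consistent[of "{x}" B] B by simp
  then show ?thesis using SB B_def \<open>x \<in> B\<close> by blast
qed

section \<open>Profinite groups\<close>

definition (in topological_group) open_normal :: "'a set \<Rightarrow> bool" where
  "open_normal K \<longleftrightarrow> K \<lhd> G \<and> openin T K"

section \<open>Closures, generated subgroups and cosets in topological groups\<close>

context topological_group
begin

lemma continuous_map_mult:
  assumes "continuous_map E T f" "continuous_map E T g"
  shows "continuous_map E T (\<lambda>x. f x \<otimes> g x)"
  using continuous_map_compose[OF continuous_map_pairedI[OF assms] continuous_mult]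
  by (simp add: o_def)

lemma continuous_map_inv:
  assumes "continuous_map E T f"
  shows "continuous_map E T (\<lambda>x. inv f x)"
  using continuous_map_compose[OF assms continuous_inv] by (simp add: o_def)

lemma continuous_map_constant:
  "c \<in> carrier G \<Longrightarrow> continuous_map E T (\<lambda>x. c)"
  by (simp add: topspace_eq_carrier)

lemma continuous_map_self: "continuous_map T T (\<lambda>x. x)"
  by simp

lemma continuous_map_commutator:
  assumes "continuous_map E T f" "continuous_map E T g"
  shows "continuous_map E T (\<lambda>x. commutator G (f x) (g x))"
  unfolding commutator_def by (intro continuous_map_mult continuous_map_inv assms)

lemma continuous_map_nat_pow:
  assumes "continuous_map E T f"
  shows "continuous_map E T (\<lambda>x. f x [^] (n::nat))"
  by (induction n)
    (simp_all add: continuous_map_mult assms continuous_map_constant del: continuous_map_const)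

lemmas continuous_group_intros =
  continuous_map_mult continuous_map_inv continuous_map_constant continuous_map_self
  continuous_map_commutator continuous_map_nat_pow

lemma closedin_subset_carrier: "closedin T F \<Longrightarrow> F \<subseteq> carrier G"
  using closedin_subset[of T F] by (simp add: topspace_eq_carrier)

lemma openin_subset_carrier: "openin T F \<Longrightarrow> F \<subseteq> carrier G"
  using openin_subset[of T F] by (simp add: topspace_eq_carrier)

lemma openin_preimage:
  assumes "continuous_map T T f" "openin T U"
  shows "openin T {x \<in> carrier G. f x \<in> U}"
  using openin_continuous_map_preimage[OF assms] topspace_eq_carrier by simp

lemma closedin_preimage:
  assumes "continuous_map T T f" "closedin T U"
  shows "closedin T {x \<in> carrier G. f x \<in> U}"
  using closedin_continuous_map_preimage[OF assms] topspace_eq_carrier by simp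

text \<open>Closure under multiplication is obtained one variable at a time, first with the left
  factor in \<open>S\<close> and the right one in the closure: each time the condition on the free
  variable defines a closed set that contains \<open>S\<close>.\<close>

lemma closure_of_subgroup:
  assumes S: "subgroup S G"
  shows "subgroup (T closure_of S) G"
proof -
  have SG: "S \<subseteq> carrier G" using S by (rule subgroup.subset)
  have C: "(T closure_of S) \<subseteq> carrier G"
    using closure_of_subset_topspace[of T S] by (simp add: topspace_eq_carrier)
  have SC: "S \<subseteq> T closure_of S" using SG by (simp add: closure_of_subset topspace_eq_carrier)
  have left: "s \<otimes> x \<in> T closure_of S" if s: "s \<in> S" and x: "x \<in> T closure_of S" for s x
  proof -
    have "T closure_of S \<subseteq> {x \<in> carrier G. s \<otimes> x \<in> T closure_of S}"
    proof (rule closure_of_minimal)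
      show "S \<subseteq> {x \<in> carrier G. s \<otimes> x \<in> T closure_of S}"
        using s SG SC subgroup.m_closed[OF S] by blast
      show "closedin T {x \<in> carrier G. s \<otimes> x \<in> T closure_of S}"
        using s SG by (intro closedin_preimage continuous_group_intros) auto
    qed
    then show ?thesis using x by auto
  qed
  show ?thesis
  proof
    show "T closure_of S \<subseteq> carrier G" by (rule C)
    show "\<one> \<in> T closure_of S" using SC S subgroup.one_closed by blast
  next
    fix x y assume x: "x \<in> T closure_of S" and y: "y \<in> T closure_of S"
    have "T closure_of S \<subseteq> {x \<in> carrier G. x \<otimes> y \<in> T closure_of S}"
    proof (rule closure_of_minimal)
      show "S \<subseteq> {x \<in> carrier G. x \<otimes> y \<in> T closure_of S}" using left y SG by auto
      show "closedin T {x \<in> carrier G. x \<otimes> y \<in> T closure_of S}"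
        using y C by (intro closedin_preimage continuous_group_intros) auto
    qed
    then show "x \<otimes> y \<in> T closure_of S" using x by auto
  next
    fix x assume x: "x \<in> T closure_of S"
    have "T closure_of S \<subseteq> {x \<in> carrier G. inv x \<in> T closure_of S}"
    proof (rule closure_of_minimal)
      show "S \<subseteq> {x \<in> carrier G. inv x \<in> T closure_of S}"
        using SG SC subgroup.m_inv_closed[OF S] by blast
      show "closedin T {x \<in> carrier G. inv x \<in> T closure_of S}"
        by (intro closedin_preimage continuous_group_intros) auto
    qed
    then show "inv x \<in> T closure_of S" using x by auto
  qed
qed

lemma topologically_generated_subgroup:
  "S \<subseteq> carrier G \<Longrightarrow> subgroup (topologically_generated G T S) G"
  unfolding topologically_generated_def
  by (intro closure_of_subgroup generate_is_subgroup)

lemma closedin_topologically_generated: "closedin T (topologically_generated G T S)"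
  unfolding topologically_generated_def by simp

lemma topologically_generated_incl:
  assumes "S \<subseteq> carrier G"
  shows "S \<subseteq> topologically_generated G T S"
proof -
  have "generate G S \<subseteq> T closure_of generate G S"
    using generate_incl[OF assms] by (simp add: closure_of_subset topspace_eq_carrier)
  then show ?thesis
    unfolding topologically_generated_def by (auto intro: generate.incl)
qed

lemma topologically_generated_minimal:
  assumes "S \<subseteq> H" "subgroup H G" "closedin T H"
  shows "topologically_generated G T S \<subseteq> H"
  unfolding topologically_generated_def
  using generate_subgroup_incl[OF assms(1,2)] assms(3) by (rule closure_of_minimal)

lemma topologically_generated_normal:
  assumes "S \<subseteq> carrier G" "\<And>h g. h \<in> S \<Longrightarrow> g \<in> carrier G \<Longrightarrow> g \<otimes> h \<otimes> inv g \<in> S"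
  shows "topologically_generated G T S \<lhd> G"
proof (rule normal_invI)
  show sub: "subgroup (topologically_generated G T S) G"
    using assms(1) by (rule topologically_generated_subgroup)
  fix g h assume g: "g \<in> carrier G" and h: "h \<in> topologically_generated G T S"
  have N: "generate G S \<lhd> G" using assms by (rule normal_generateI)
  have "T closure_of generate G S
      \<subseteq> {h \<in> carrier G. g \<otimes> h \<otimes> inv g \<in> topologically_generated G T S}"
  proof (rule closure_of_minimal)
    have "generate G S \<subseteq> topologically_generated G T S"
      unfolding topologically_generated_def
      using generate_incl[OF assms(1)] by (simp add: closure_of_subset topspace_eq_carrier)
    then show "generate G S
        \<subseteq> {h \<in> carrier G. g \<otimes> h \<otimes> inv g \<in> topologically_generated G T S}"
      using normal.inv_op_closed2[OF N g] generate_incl[OF assms(1)] by blast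
    show "closedin T {h \<in> carrier G. g \<otimes> h \<otimes> inv g \<in> topologically_generated G T S}"
      using g closedin_topologically_generated
      by (intro closedin_preimage continuous_group_intros) auto
  qed
  then show "g \<otimes> h \<otimes> inv g \<in> topologically_generated G T S"
    using h unfolding topologically_generated_def by auto
qed

lemma open_normal_Int: "open_normal K \<Longrightarrow> open_normal L \<Longrightarrow> open_normal (K \<inter> L)"
  unfolding open_normal_def by (auto intro: normal_subgroup_intersect)

lemma open_normal_carrier: "open_normal (carrier G)"
  unfolding open_normal_def using openin_topspace[of T]
  by (auto simp: topspace_eq_carrier intro!: normal_invI subgroup_self)

lemma open_normal_INT:
  assumes "finite I" "\<And>i. i \<in> I \<Longrightarrow> open_normal (K i)"
  shows "open_normal (carrier G \<inter> (\<Inter>i\<in>I. K i))"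
  using assms
proof induction
  case empty then show ?case by (simp add: open_normal_carrier)
next
  case (insert i I)
  then have "open_normal (K i \<inter> (carrier G \<inter> (\<Inter>i\<in>I. K i)))"
    by (intro open_normal_Int insert.IH insert.prems) auto
  then show ?case by (simp add: Int_ac)
qed

lemma openin_rcoset:
  assumes "openin T K" "K \<lhd> G" "x \<in> carrier G"
  shows "openin T (K #> x)"
proof -
  interpret normal K G by fact
  have "K #> x = {y \<in> carrier G. y \<otimes> inv x \<in> K}"
    using assms(3) rcos_module[OF is_group assms(3)] r_coset_subset_G[OF subset assms(3)] by auto
  then show ?thesis
    using assms by (auto intro!: openin_preimage continuous_group_intros)
qed

text \<open>The set is a union of cosets of \<open>K\<close>. Together with the closed version this
  settles the topology of every condition that only sees a finite quotient, and most conditions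
  below are brought into that form.\<close>

lemma openin_saturated:
  assumes K: "open_normal K"
    and sat: "\<And>x y. x \<in> carrier G \<Longrightarrow> y \<in> carrier G \<Longrightarrow> K #> x = K #> y \<Longrightarrow> P x \<Longrightarrow> P y"
  shows "openin T {x \<in> carrier G. P x}"
proof (subst openin_subopen, intro ballI)
  interpret normal K G using K by (simp add: open_normal_def)
  fix x assume x: "x \<in> {x \<in> carrier G. P x}"
  then have "K #> x \<subseteq> {x \<in> carrier G. P x}"
    using sat[of x] r_coset_subset_G[OF subset, of x] repr_independence[OF _ _ is_subgroup, of _ x]
    by blast
  then show "\<exists>U. openin T U \<and> x \<in> U \<and> U \<subseteq> {x \<in> carrier G. P x}"
    using x K rcos_self[OF _ is_subgroup, of x] openin_rcoset[of K x]
    by (auto simp: open_normal_def)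
qed

lemma closedin_saturated:
  assumes K: "open_normal K"
    and sat: "\<And>x y. x \<in> carrier G \<Longrightarrow> y \<in> carrier G \<Longrightarrow> K #> x = K #> y \<Longrightarrow> P x \<Longrightarrow> P y"
  shows "closedin T {x \<in> carrier G. P x}"
proof -
  have "openin T {x \<in> carrier G. \<not> P x}"
    by (rule openin_saturated[OF K]) (metis sat)
  moreover have "carrier G - {x \<in> carrier G. P x} = {x \<in> carrier G. \<not> P x}" by auto
  ultimately show ?thesis
    by (auto simp: closedin_def topspace_eq_carrier)
qed

lemma closedin_open_normal:
  assumes "open_normal K"
  shows "closedin T K"
proof -
  interpret normal K G using assms by (simp add: open_normal_def)
  have "closedin T {x \<in> carrier G. x \<in> K}"
    by (rule closedin_saturated[OF assms]) (metis rcoset_mem_iff one_closed)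
  moreover have "{x \<in> carrier G. x \<in> K} = K" using subset by auto
  ultimately show ?thesis by simp
qed

lemma commute_closure_of:
  assumes "Hausdorff_space T" "S \<subseteq> carrier G" "y \<in> carrier G" "\<And>s. s \<in> S \<Longrightarrow> s \<otimes> y = y \<otimes> s"
    and "x \<in> topologically_generated G T S"
  shows "x \<otimes> y = y \<otimes> x"
proof -
  have "topologically_generated G T S \<subseteq> {x \<in> carrier G. \<forall>s\<in>{y}. x \<otimes> s = s \<otimes> x}"
  proof (rule topologically_generated_minimal)
    show "subgroup {x \<in> carrier G. \<forall>s\<in>{y}. x \<otimes> s = s \<otimes> x} G"
      using assms by (intro centralizer_subgroup) auto
    have "closedin T {x \<in> topspace T. x \<otimes> y = y \<otimes> x}"
      using assms(3)
      by (intro closedin_continuous_maps_eq[OF assms(1)] continuous_group_intros) auto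
    then show "closedin T {x \<in> carrier G. \<forall>s\<in>{y}. x \<otimes> s = s \<otimes> x}"
      by (simp add: topspace_eq_carrier)
  qed (use assms in auto)
  then show ?thesis using assms(5) by auto
qed

end

section \<open>Open normal subgroups and compactness\<close>

context profinite_group
begin

text \<open>The complement is the projection of a closed set along the compact space
  \<open>T\<close>, hence closed (the tube lemma).\<close>

lemma openin_all_compact:
  assumes C: "closedin T C" and F: "openin (prod_topology T T) F"
  shows "openin T {g \<in> carrier G. \<forall>x\<in>C. (x, g) \<in> F}"
proof -
  have "closedin (prod_topology T T) ((C \<times> topspace T) - F)"
    using C F by (intro closedin_diff) (auto simp: closedin_prod_Times_iff)
  then have "closedin T (snd ` ((C \<times> topspace T) - F))"
    using closed_map_snd[OF compact] unfolding closed_map_def by blast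
  then have "openin T (topspace T - snd ` ((C \<times> topspace T) - F))"
    by blast
  moreover have "topspace T - snd ` ((C \<times> topspace T) - F) = {g \<in> carrier G. \<forall>x\<in>C. (x, g) \<in> F}"
    by (force simp: topspace_eq_carrier)
  ultimately show ?thesis by simp
qed

lemma openin_pairs:
  assumes "continuous_map (prod_topology T T) T (\<lambda>p. f (fst p) (snd p))" "openin T U"
  shows "openin (prod_topology T T) {p \<in> carrier G \<times> carrier G. f (fst p) (snd p) \<in> U}"
  using openin_continuous_map_preimage[OF assms] by (simp add: topspace_eq_carrier)

text \<open>In a compact Hausdorff space quasi-components are components, here single points, and a
  quasi-component is separated by a clopen set from any compact set disjoint from it.\<close>

lemma clopen_neighbourhood:
  assumes U: "openin T U" "x \<in> U"
  shows "\<exists>V. openin T V \<and> closedin T V \<and> x \<in> V \<and> V \<subseteq> U"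
proof -
  have x: "x \<in> topspace T" using U openin_subset by blast
  let ?Q = "quasi_component_of_set T x"
  have Q: "?Q \<in> quasi_components_of T"
    using x by (simp add: quasi_components_of_def)
  then have "?Q \<in> connected_components_of T"
    using quasi_eq_connected_components_of[of T] compact Hausdorff by simp
  then have "connectedin T ?Q" by (rule connectedin_connected_components_of)
  then obtain y where "?Q \<subseteq> {y}" using totally_disconnected by blast
  moreover have "x \<in> ?Q" using x by simp
  ultimately have "?Q = {x}" by blast
  then have "disjnt ?Q (topspace T - U)" using U by auto
  moreover have "compactin T (topspace T - U)"
    using U compact by (intro closedin_compact_space) auto
  ultimately have "separated_between T ?Q (topspace T - U)"
    using separated_between_quasi_component_compact[OF Q] by blast
  then obtain V W where VW: "openin T V" "openin T W" "V \<union> W = topspace T" "disjnt V W"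
    "?Q \<subseteq> V" "topspace T - U \<subseteq> W"
    unfolding separated_between_def by auto
  have "V = topspace T - W"
    using VW by (auto simp: disjnt_iff)
  then have "closedin T V" using VW by auto
  moreover have "V \<subseteq> U" using VW openin_subset by (fastforce simp: disjnt_iff)
  ultimately show ?thesis using VW \<open>x \<in> ?Q\<close> by blast
qed

text \<open>For a clopen \<open>V\<close> around \<open>\<one>\<close> the right stabilizer
  \<open>R\<close> is open by compactness of \<open>V\<close>, so \<open>L\<close>, the part of
  \<open>R\<close> whose inverses are also in \<open>R\<close>, is an open subgroup inside
  \<open>V\<close>. Its normal core \<open>K\<close> is open by compactness of
  \<open>G\<close>.\<close>

lemma open_normal_base:
  assumes U: "openin T U" "\<one> \<in> U"
  shows "\<exists>K. open_normal K \<and> K \<subseteq> U"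
proof -
  obtain V where V: "openin T V" "closedin T V" "\<one> \<in> V" "V \<subseteq> U"
    using clopen_neighbourhood[OF U] by auto
  have VG: "V \<subseteq> carrier G" using V openin_subset_carrier by blast
  define R where "R = {g \<in> carrier G. \<forall>v\<in>V. v \<otimes> g \<in> V}"
  define L where "L = {g \<in> carrier G. g \<in> R \<and> inv g \<in> R}"
  have "R = {g \<in> carrier G. \<forall>v\<in>V. (v, g) \<in> {p \<in> carrier G \<times> carrier G. fst p \<otimes> snd p \<in> V}}"
    using VG by (auto simp: R_def)
  then have R: "openin T R"
    using openin_all_compact[OF V(2) openin_pairs[of "\<lambda>x y. x \<otimes> y", OF _ V(1)]]
      continuous_mult by (simp add: case_prod_unfold)
  have L: "openin T L"
  proof -
    have "L = R \<inter> {g \<in> carrier G. inv g \<in> R}" using R openin_subset_carrier by (auto simp: L_def)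
    then show ?thesis using R by (auto intro!: openin_preimage continuous_group_intros)
  qed
  have R_mult: "x \<otimes> y \<in> R" if "x \<in> R" "y \<in> R" for x y
    using that VG by (auto simp: R_def simp flip: m_assoc)
  have L_sub: "subgroup L G"
  proof
    show "L \<subseteq> carrier G" by (auto simp: L_def)
    show "\<one> \<in> L" using VG by (auto simp: L_def R_def)
    show "x \<otimes> y \<in> L" if "x \<in> L" "y \<in> L" for x y
      using that R_mult by (auto simp: L_def inv_mult_group)
    show "inv x \<in> L" if "x \<in> L" for x
      using that by (auto simp: L_def)
  qed
  have "L \<subseteq> V"
  proof
    fix g assume "g \<in> L"
    then have "g \<in> carrier G" "\<one> \<otimes> g \<in> V" using V(3) by (auto simp: L_def R_def)
    then show "g \<in> V" by simp
  qed
  define K where "K = {g \<in> carrier G. \<forall>x\<in>carrier G. x \<otimes> g \<otimes> inv x \<in> L}"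
  have "K = {g \<in> carrier G. \<forall>x\<in>carrier G.
      (x, g) \<in> {p \<in> carrier G \<times> carrier G. fst p \<otimes> snd p \<otimes> inv (fst p) \<in> L}}"
    by (auto simp: K_def)
  moreover have "closedin T (carrier G)" using closedin_topspace[of T] topspace_eq_carrier by simp
  ultimately have "openin T K"
    using openin_all_compact[OF _ openin_pairs[of "\<lambda>x y. x \<otimes> y \<otimes> inv x", OF _ L]]
    by (simp only: continuous_map_mult continuous_map_inv continuous_map_fst continuous_map_snd)
  moreover have "K \<lhd> G"
  proof (rule normal_invI)
    have conj: "x \<otimes> (g \<otimes> h) \<otimes> inv x = (x \<otimes> g \<otimes> inv x) \<otimes> (x \<otimes> h \<otimes> inv x)"
      "x \<otimes> inv g \<otimes> inv x = inv (x \<otimes> g \<otimes> inv x)"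
      "x \<otimes> (y \<otimes> g \<otimes> inv y) \<otimes> inv x = (x \<otimes> y) \<otimes> g \<otimes> inv (x \<otimes> y)"
      if "x \<in> carrier G" "y \<in> carrier G" "g \<in> carrier G" "h \<in> carrier G" for x y g h
      using that by (simp_all add: group_word)
    show "subgroup K G"
    proof
      show "K \<subseteq> carrier G" by (auto simp: K_def)
      show "\<one> \<in> K" using subgroup.one_closed[OF L_sub] by (auto simp: K_def)
      show "x \<otimes> y \<in> K" if "x \<in> K" "y \<in> K" for x y
        using that subgroup.m_closed[OF L_sub] conj(1) unfolding K_def by simp
      show "inv x \<in> K" if "x \<in> K" for x
        using that subgroup.m_inv_closed[OF L_sub] conj(2) unfolding K_def by simp
    qed
    show "y \<otimes> g \<otimes> inv y \<in> K" if "y \<in> carrier G" "g \<in> K" for y g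
      using that conj(3) unfolding K_def by simp
  qed
  moreover have "K \<subseteq> L"
  proof
    fix g assume "g \<in> K"
    then have "g \<in> carrier G" "\<one> \<otimes> g \<otimes> inv \<one> \<in> L" unfolding K_def by blast+
    then show "g \<in> L" by simp
  qed
  ultimately show ?thesis
    using \<open>L \<subseteq> V\<close> V unfolding open_normal_def by blast
qed

lemma open_normal_separates:
  assumes F: "closedin T F" and x: "x \<in> carrier G" "x \<notin> F"
  shows "\<exists>K. open_normal K \<and> (\<forall>y\<in>F. K #> y \<noteq> K #> x)"
proof -
  have "openin T {g \<in> carrier G. g \<otimes> x \<in> carrier G - F}"
    using F x by (intro openin_preimage continuous_group_intros) (auto simp flip: topspace_eq_carrier)
  then obtain K where K: "open_normal K" "K \<subseteq> {g \<in> carrier G. g \<otimes> x \<in> carrier G - F}"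
    using open_normal_base[of "{g \<in> carrier G. g \<otimes> x \<in> carrier G - F}"] x by auto
  have FG: "F \<subseteq> carrier G" using F by (rule closedin_subset_carrier)
  interpret normal K G using K by (simp add: open_normal_def)
  have "K #> y \<noteq> K #> x" if y: "y \<in> F" for y
  proof
    assume "K #> y = K #> x"
    then have "y \<otimes> inv x \<in> K" using rcoset_eq_iff x y FG by blast
    then have "y \<otimes> inv x \<otimes> x \<in> carrier G - F" using K(2) by auto
    then show False using x y FG by (auto simp: m_assoc)
  qed
  then show ?thesis using K(1) by auto
qed

text \<open>The principle behind the later arguments: a closed set is determined by its images in
  the finite quotients, so closures, procyclic subgroups and equalities are tested modulo each open
  normal subgroup.\<close>

lemma closedin_mem_iff:
  assumes F: "closedin T F" and x: "x \<in> carrier G"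
  shows "x \<in> F \<longleftrightarrow> (\<forall>K. open_normal K \<longrightarrow> (\<exists>y\<in>F. K #> x = K #> y))"
  using open_normal_separates[OF F x] by metis

lemma eq_iff_open_normal:
  assumes "x \<in> carrier G" "y \<in> carrier G"
  shows "x = y \<longleftrightarrow> (\<forall>K. open_normal K \<longrightarrow> K #> x = K #> y)"
proof -
  have "closedin T {y}"
    using assms Hausdorff by (simp add: closedin_Hausdorff_singleton topspace_eq_carrier)
  from closedin_mem_iff[OF this assms(1)] show ?thesis by simp
qed

lemma open_normal_finite_index:
  assumes K: "open_normal K"
  shows "finite (rcosets K)"
proof -
  interpret normal K G using K by (simp add: open_normal_def)
  have "\<Union> (rcosets K) = topspace T" by (simp add: rcosets_part_G is_subgroup topspace_eq_carrier)
  moreover have "openin T U" if "U \<in> rcosets K" for U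
    using that K openin_rcoset unfolding RCOSETS_def open_normal_def by auto
  ultimately obtain \<F> where \<F>: "finite \<F>" "\<F> \<subseteq> rcosets K" "topspace T \<subseteq> \<Union>\<F>"
    using compact[unfolded compact_space_alt, rule_format, of "rcosets K"] by auto
  have "U \<in> \<F>" if U: "U \<in> rcosets K" for U
  proof -
    obtain x where x: "x \<in> carrier G" "U = K #> x" using U unfolding RCOSETS_def by auto
    then obtain V where V: "V \<in> \<F>" "x \<in> V" using \<F>(3) topspace_eq_carrier by blast
    then obtain y where y: "y \<in> carrier G" "V = K #> y" using \<F>(2) unfolding RCOSETS_def by blast
    then have "V = U" using repr_independence[of x K y] V x is_subgroup by simp
    then show ?thesis using V by simp
  qed
  then have "rcosets K \<subseteq> \<F>" by auto
  then show ?thesis using \<F>(1) by (rule finite_subset)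
qed

lemma open_normal_Mod:
  assumes "open_normal K"
  shows "group (G Mod K)" "finite (carrier (G Mod K))"
proof -
  show "group (G Mod K)"
    using assms by (simp add: open_normal_def normal.factorgroup_is_group)
  show "finite (carrier (G Mod K))"
    using open_normal_finite_index[OF assms] by (simp add: FactGroup_def)
qed

lemma open_normal_exponent:
  assumes "open_normal K"
  obtains n where "0 < n" "\<And>x. x \<in> carrier G \<Longrightarrow> x [^] (n::nat) \<in> K"
proof
  interpret normal K G using assms by (simp add: open_normal_def)
  interpret Q: group "G Mod K" by (rule open_normal_Mod(1)[OF assms])
  show "0 < order (G Mod K)"
    using open_normal_Mod(2)[OF assms] Q.order_gt_0_iff_finite by blast
  fix x assume x: "x \<in> carrier G"
  then have "(K #> x) [^]\<^bsub>G Mod K\<^esub> order (G Mod K) = \<one>\<^bsub>G Mod K\<^esub>"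
    by (intro Q.pow_order_eq_1) (simp add: carrier_FactGroup)
  then have "K #> x [^] order (G Mod K) = K #> \<one>"
    using x by (simp add: FactGroup_pow subset)
  then show "x [^] order (G Mod K) \<in> K"
    using x by (simp add: rcoset_mem_iff)
qed

lemma open_normal_transversal:
  assumes K: "open_normal K"
  obtains F where "finite F" "F \<subseteq> carrier G" "\<And>x. x \<in> carrier G \<Longrightarrow> \<exists>f\<in>F. \<exists>k\<in>K. x = f \<otimes> k"
proof -
  interpret normal K G using K by (simp add: open_normal_def)
  have "finite ((\<lambda>x. K #> x) ` carrier G)"
    using open_normal_Mod(2)[OF K] by (simp add: carrier_FactGroup)
  then obtain F where F: "finite F" "F \<subseteq> carrier G" "(\<lambda>x. K #> x) ` carrier G = (\<lambda>x. K #> x) ` F"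
    by (metis finite_subset_image order_refl)
  show ?thesis
  proof (rule that[OF F(1,2)])
    fix x assume x: "x \<in> carrier G"
    then obtain f where f: "f \<in> F" "K #> x = K #> f" using F(3) by blast
    then have "x \<otimes> inv f \<in> K" using x F(2) rcoset_eq_iff by blast
    then have "inv f \<otimes> (x \<otimes> inv f) \<otimes> f \<in> K" using f F(2) inv_op_closed1 by blast
    then have "inv f \<otimes> x \<in> K" using x f F(2) by (auto simp: subsetD group_word)
    moreover have "x = f \<otimes> (inv f \<otimes> x)" using x f F(2) by (auto simp: inv_mult_cancel subsetD)
    ultimately show "\<exists>f\<in>F. \<exists>k\<in>K. x = f \<otimes> k" using f by blast
  qed
qed

text \<open>Passage to the inverse limit: finitely many of the sets \<open>E K\<close> all contain
  \<open>E L\<close> for the intersection \<open>L\<close>, so they have the finite intersection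
  property. Restricting to subgroups that contain \<open>C\<close> lets the same argument work
  modulo \<open>C\<close>; \<open>C = {}\<close> gives no restriction.\<close>

lemma compact_open_normal:
  assumes clo: "\<And>K. open_normal K \<Longrightarrow> C \<subseteq> K \<Longrightarrow> closedin T (E K)"
    and ne: "\<And>K. open_normal K \<Longrightarrow> C \<subseteq> K \<Longrightarrow> E K \<noteq> {}"
    and mono: "\<And>K L. open_normal K \<Longrightarrow> open_normal L \<Longrightarrow> C \<subseteq> K \<Longrightarrow> K \<subseteq> L \<Longrightarrow> E K \<subseteq> E L"
    and C: "C \<subseteq> carrier G"
  shows "\<exists>x\<in>carrier G. \<forall>K. open_normal K \<longrightarrow> C \<subseteq> K \<longrightarrow> x \<in> E K"
proof -
  define \<K> where "\<K> = {K. open_normal K \<and> C \<subseteq> K}"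
  have "\<Inter>\<F> \<noteq> {}" if fin: "finite \<F>" "\<F> \<subseteq> E ` \<K>" for \<F>
  proof -
    obtain \<L> where \<L>: "\<L> \<subseteq> \<K>" "finite \<L>" "\<F> = E ` \<L>"
      using fin finite_subset_image by metis
    define L where "L = carrier G \<inter> (\<Inter>K\<in>\<L>. K)"
    have L: "open_normal L" unfolding L_def
      using \<L> by (intro open_normal_INT) (auto simp: \<K>_def)
    have CL: "C \<subseteq> L" using C \<L>(1) by (auto simp: L_def \<K>_def)
    have "E L \<subseteq> E K" if "K \<in> \<L>" for K
      using that \<L>(1) by (intro mono[OF L _ CL]) (auto simp: \<K>_def L_def)
    then show ?thesis using ne[OF L CL] \<L>(3) by blast
  qed
  moreover have "\<forall>C\<in>E ` \<K>. closedin T C" using clo by (auto simp: \<K>_def)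
  ultimately have "\<Inter>(E ` \<K>) \<noteq> {}"
    using compact[unfolded compact_space_fip, rule_format, of "E ` \<K>"] by simp
  then obtain x where "x \<in> \<Inter>(E ` \<K>)" by blast
  then have x: "x \<in> E K" if "open_normal K" "C \<subseteq> K" for K
    using that unfolding \<K>_def by blast
  moreover have "x \<in> carrier G"
    using x[OF open_normal_carrier C] closedin_subset_carrier[OF clo[OF open_normal_carrier C]]
    by (rule rev_subsetD)
  ultimately show ?thesis by auto
qed

end

section \<open>Monothetic subgroups\<close>

abbreviation (in topological_group) monothetic :: "'a \<Rightarrow> 'a set" where
  "monothetic w \<equiv> topologically_generated G T {w}"

text \<open>For a closed normal subgroup \<open>C\<close> this is the product of \<open>C\<close> and \<open>monothetic w\<close>.\<close>

definition (in topological_group) monothetic_mod :: "'a set \<Rightarrow> 'a \<Rightarrow> 'a set" where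
  "monothetic_mod C w = {y \<in> carrier G. \<forall>K. open_normal K \<longrightarrow> C \<subseteq> K \<longrightarrow>
     (\<exists>j::int. K #> y = K #> w [^] j)}"

context profinite_group
begin

lemma closure_of_mem_iff:
  assumes S: "S \<subseteq> carrier G" and x: "x \<in> carrier G"
  shows "x \<in> T closure_of S \<longleftrightarrow> (\<forall>K. open_normal K \<longrightarrow> (\<exists>y\<in>S. K #> x = K #> y))"
proof
  assume l: "x \<in> T closure_of S"
  show "\<forall>K. open_normal K \<longrightarrow> (\<exists>y\<in>S. K #> x = K #> y)"
  proof (intro allI impI)
    fix K assume K: "open_normal K"
    have "T closure_of S \<subseteq> {x \<in> carrier G. \<exists>y\<in>S. K #> x = K #> y}"
    proof (rule closure_of_minimal)
      show "S \<subseteq> {x \<in> carrier G. \<exists>y\<in>S. K #> x = K #> y}" using S by auto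
      show "closedin T {x \<in> carrier G. \<exists>y\<in>S. K #> x = K #> y}"
        by (rule closedin_saturated[OF K]) auto
    qed
    then show "\<exists>y\<in>S. K #> x = K #> y" using l by auto
  qed
next
  assume r: "\<forall>K. open_normal K \<longrightarrow> (\<exists>y\<in>S. K #> x = K #> y)"
  have "S \<subseteq> T closure_of S" using S by (simp add: closure_of_subset topspace_eq_carrier)
  then have "\<forall>K. open_normal K \<longrightarrow> (\<exists>y\<in>T closure_of S. K #> x = K #> y)"
    using r by blast
  then show "x \<in> T closure_of S" using closedin_mem_iff[OF _ x] by simp
qed

text \<open>The exponent \<open>j\<close> may depend on \<open>K\<close>: the family of these
  integers stands in for a profinite exponent.\<close>

lemma monothetic_mem_iff:
  assumes w: "w \<in> carrier G" and x: "x \<in> carrier G"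
  shows "x \<in> monothetic w \<longleftrightarrow> (\<forall>K. open_normal K \<longrightarrow> (\<exists>j::int. K #> x = K #> w [^] j))"
proof -
  have "generate G {w} \<subseteq> carrier G" using w by (intro generate_incl) auto
  from closure_of_mem_iff[OF this x] show ?thesis
    unfolding topologically_generated_def generate_pow[OF w] by blast
qed

lemma monothetic_subgroup: "w \<in> carrier G \<Longrightarrow> subgroup (monothetic w) G"
  by (intro topologically_generated_subgroup) auto

lemma monothetic_carrier: "w \<in> carrier G \<Longrightarrow> x \<in> monothetic w \<Longrightarrow> x \<in> carrier G"
  by (rule subgroup.mem_carrier[OF monothetic_subgroup])

lemma monothetic_self: "w \<in> carrier G \<Longrightarrow> w \<in> monothetic w"
  using topologically_generated_incl[of "{w}"] by auto

lemma monothetic_minimal: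
  "w \<in> H \<Longrightarrow> subgroup H G \<Longrightarrow> closedin T H \<Longrightarrow> monothetic w \<subseteq> H"
  by (intro topologically_generated_minimal) auto

lemma monothetic_mono: "w \<in> carrier G \<Longrightarrow> x \<in> monothetic w \<Longrightarrow> monothetic x \<subseteq> monothetic w"
  by (intro monothetic_minimal monothetic_subgroup closedin_topologically_generated)

lemma monothetic_commute:
  assumes w: "w \<in> carrier G" and x: "x \<in> monothetic w" and y: "y \<in> carrier G" "w \<otimes> y = y \<otimes> w"
  shows "x \<otimes> y = y \<otimes> x"
  using commute_closure_of[OF Hausdorff, of "{w}" y x] assms by auto

lemma monothetic_abelian:
  assumes w: "w \<in> carrier G" and x: "x \<in> monothetic w" and y: "y \<in> monothetic w"
  shows "x \<otimes> y = y \<otimes> x"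
proof -
  have "y \<otimes> w = w \<otimes> y" by (rule monothetic_commute[OF w y w refl])
  then show ?thesis using monothetic_commute[OF w x] monothetic_carrier[OF w y] by simp
qed

lemma monothetic_mod_one:
  assumes w: "w \<in> carrier G"
  shows "monothetic_mod {\<one>} w = monothetic w"
proof -
  have "{\<one>} \<subseteq> K" if "open_normal K" for K
    using that unfolding open_normal_def
    by (auto dest: normal_imp_subgroup intro: subgroup.one_closed)
  then have "x \<in> monothetic_mod {\<one>} w \<longleftrightarrow> x \<in> monothetic w" if "x \<in> carrier G" for x
    unfolding monothetic_mod_def using monothetic_mem_iff[OF w that] that by simp
  then show ?thesis
    using monothetic_carrier[OF w] by (auto simp: monothetic_mod_def)
qed

lemma monothetic_mod_subgroup:
  assumes w: "w \<in> carrier G"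
  shows "subgroup (monothetic_mod C w) G"
proof
  show "monothetic_mod C w \<subseteq> carrier G" by (auto simp: monothetic_mod_def)
  show "\<one> \<in> monothetic_mod C w"
    by (auto simp: monothetic_mod_def intro!: exI[of _ 0])
next
  fix x y assume xy: "x \<in> monothetic_mod C w" "y \<in> monothetic_mod C w"
  have "\<exists>j::int. K #> (x \<otimes> y) = K #> w [^] j" if K: "open_normal K" "C \<subseteq> K" for K
  proof -
    interpret normal K G using K by (simp add: open_normal_def)
    obtain i j :: int where "K #> x = K #> w [^] i" "K #> y = K #> w [^] j"
      using xy K unfolding monothetic_mod_def by blast
    then have "K #> (x \<otimes> y) = K #> (w [^] i \<otimes> w [^] j)"
      using xy w by (intro rcoset_mult_cong) (auto simp: monothetic_mod_def)
    then show ?thesis using w by (metis int_pow_mult)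
  qed
  then show "x \<otimes> y \<in> monothetic_mod C w" using xy unfolding monothetic_mod_def by simp
next
  fix x assume x: "x \<in> monothetic_mod C w"
  have "\<exists>j::int. K #> inv x = K #> w [^] j" if K: "open_normal K" "C \<subseteq> K" for K
  proof -
    interpret normal K G using K by (simp add: open_normal_def)
    obtain i :: int where "K #> x = K #> w [^] i"
      using x K unfolding monothetic_mod_def by blast
    then have "K #> inv x = K #> inv (w [^] i)"
      using x w by (intro rcoset_inv_cong) (auto simp: monothetic_mod_def)
    then show ?thesis using w by (metis int_pow_neg)
  qed
  then show "inv x \<in> monothetic_mod C w" using x unfolding monothetic_mod_def by simp
qed

lemma closedin_monothetic_mod: "closedin T (monothetic_mod C w)"
proof -
  define E where "E K = {y \<in> carrier G. \<exists>j::int. K #> y = K #> w [^] j}" for K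
  have "closedin T (E K)" if "open_normal K" for K
    unfolding E_def by (rule closedin_saturated[OF that]) auto
  moreover have "closedin T (carrier G)"
    using closedin_topspace[of T] by (simp add: topspace_eq_carrier)
  ultimately have "closedin T (\<Inter>(insert (carrier G) (E ` {K. open_normal K \<and> C \<subseteq> K})))"
    by (intro closedin_Inter) auto
  moreover have "monothetic_mod C w = \<Inter>(insert (carrier G) (E ` {K. open_normal K \<and> C \<subseteq> K}))"
    by (auto simp: monothetic_mod_def E_def)
  ultimately show ?thesis by simp
qed

lemma monothetic_mod_kernel: "C \<subseteq> carrier G \<Longrightarrow> w \<in> carrier G \<Longrightarrow> C \<subseteq> monothetic_mod C w"
proof
  fix c assume *: "C \<subseteq> carrier G" "w \<in> carrier G" "c \<in> C"
  have "K #> c = K #> w [^] (0::int)" if "open_normal K" "C \<subseteq> K" for K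
    using that * normal.rcoset_mem_iff[of K G c] by (auto simp: open_normal_def)
  then show "c \<in> monothetic_mod C w" using * unfolding monothetic_mod_def by blast
qed

lemma monothetic_le_mod:
  assumes w: "w \<in> carrier G"
  shows "monothetic w \<subseteq> monothetic_mod C w"
proof
  fix x assume x: "x \<in> monothetic w"
  then have "x \<in> carrier G" by (rule monothetic_carrier[OF w])
  then show "x \<in> monothetic_mod C w"
    using x monothetic_mem_iff[OF w] unfolding monothetic_mod_def by simp
qed

text \<open>The gluing step. In each finite quotient the images of \<open>S\<close> lie in one
  cyclic subgroup by \<open>pairwise_cyclic\<close>; the possible generators, taken in
  \<open>B\<close>, form the closed sets \<open>E K\<close>, and compactness yields a generator
  valid for all \<open>K\<close>.\<close>

lemma pairwise_monothetic_mod: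
  assumes B: "S \<subseteq> B" "subgroup B G" "closedin T B" and C: "C \<subseteq> carrier G"
    and pair: "\<And>s t. s \<in> S \<Longrightarrow> t \<in> S \<Longrightarrow>
      \<exists>w\<in>carrier G. s \<in> monothetic_mod C w \<and> t \<in> monothetic_mod C w"
  shows "\<exists>x\<in>B. S \<subseteq> monothetic_mod C x"
proof -
  have BG: "B \<subseteq> carrier G" using B(2) by (rule subgroup.subset)
  define E where "E K = {x \<in> B. \<forall>s\<in>S. \<exists>j::int. K #> s = K #> x [^] j}" for K
  have "\<exists>x\<in>carrier G. \<forall>K. open_normal K \<longrightarrow> C \<subseteq> K \<longrightarrow> x \<in> E K"
  proof (rule compact_open_normal[OF _ _ _ C])
    fix K assume K: "open_normal K" "C \<subseteq> K"
    interpret normal K G using K by (simp add: open_normal_def)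
    have "E K = B \<inter> {x \<in> carrier G. \<forall>s\<in>S. \<exists>j::int. K #> s = K #> x [^] j}"
      using BG by (auto simp: E_def)
    moreover have "closedin T {x \<in> carrier G. \<forall>s\<in>S. \<exists>j::int. K #> s = K #> x [^] j}"
      by (rule closedin_saturated[OF K(1)]) (metis rcoset_int_pow_cong)
    ultimately show "closedin T (E K)" using B(3) by auto
    interpret Q: group "G Mod K" by (rule open_normal_Mod(1)[OF K(1)])
    interpret \<pi>: group_hom G "G Mod K" "\<lambda>x. K #> x"
      by unfold_locales (rule r_coset_hom_Mod)
    have gen: "K #> s \<in> generate (G Mod K) {K #> w} \<longleftrightarrow> (\<exists>j::int. K #> s = K #> w [^] j)"
      if "s \<in> carrier G" "w \<in> carrier G" for s w
      using that Q.generate_pow[of "K #> w"] \<pi>.hom_closed[of w]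
      by (auto simp: FactGroup_int_pow)
    have "\<exists>y\<in>generate (G Mod K) ((\<lambda>x. K #> x) ` S).
        (\<lambda>x. K #> x) ` S \<subseteq> generate (G Mod K) {y}"
    proof (rule Q.pairwise_cyclic[OF open_normal_Mod(2)[OF K(1)]])
      show "(\<lambda>x. K #> x) ` S \<subseteq> carrier (G Mod K)" using B(1) BG \<pi>.hom_closed by blast
    next
      fix u v assume "u \<in> (\<lambda>x. K #> x) ` S" "v \<in> (\<lambda>x. K #> x) ` S"
      then obtain s t where st: "s \<in> S" "t \<in> S" "u = K #> s" "v = K #> t" by auto
      then obtain w where w: "w \<in> carrier G" "s \<in> monothetic_mod C w" "t \<in> monothetic_mod C w"
        using pair by blast
      then have "u \<in> generate (G Mod K) {K #> w} \<and> v \<in> generate (G Mod K) {K #> w}"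
        using K st gen[of s w] gen[of t w] unfolding monothetic_mod_def by simp
      then show "\<exists>w\<in>carrier (G Mod K). u \<in> generate (G Mod K) {w} \<and> v \<in> generate (G Mod K) {w}"
        using w(1) \<pi>.hom_closed by blast
    qed
    then obtain y where y: "y \<in> generate (G Mod K) ((\<lambda>x. K #> x) ` S)"
      "(\<lambda>x. K #> x) ` S \<subseteq> generate (G Mod K) {y}" by auto
    have "S \<subseteq> carrier G" using B(1) BG by auto
    \<comment> \<open>The generator lies in the group generated by the images of \<open>S\<close>,
      so it lifts to an element of \<open>generate G S\<close>, hence of \<open>B\<close>.\<close>
    then obtain x where x: "x \<in> generate G S" "y = K #> x"
      using y(1) \<pi>.generate_img by auto
    have "x \<in> B" using x(1) generate_subgroup_incl[OF B(1,2)] by auto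
    moreover have "\<exists>j::int. K #> s = K #> x [^] j" if "s \<in> S" for s
      using y(2) that x(2) gen[of s x] \<open>x \<in> B\<close> BG B(1) by auto
    ultimately show "E K \<noteq> {}" by (auto simp: E_def)
  next
    fix K L assume K: "open_normal K" and L: "open_normal L" and KL: "K \<subseteq> L"
    show "E K \<subseteq> E L"
    proof
      fix x assume x: "x \<in> E K"
      have "\<exists>j::int. L #> s = L #> x [^] j" if s: "s \<in> S" for s
      proof -
        obtain j :: int where "K #> s = K #> x [^] j" using x s unfolding E_def by auto
        then have "L #> s = L #> x [^] j"
          using K L KL x s B(1) BG
          by (intro normal.rcoset_mono[of K G L]) (auto simp: open_normal_def E_def)
        then show ?thesis ..
      qed
      then show "x \<in> E L" using x unfolding E_def by blast
    qed
  qed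
  then obtain x where x: "x \<in> carrier G" "\<And>K. open_normal K \<Longrightarrow> C \<subseteq> K \<Longrightarrow> x \<in> E K" by blast
  then have "x \<in> B" using open_normal_carrier C unfolding E_def by blast
  moreover have "s \<in> monothetic_mod C x" if "s \<in> S" for s
  proof -
    have "s \<in> carrier G" using that B(1) BG by auto
    then show ?thesis using that x(2) unfolding monothetic_mod_def E_def by simp
  qed
  ultimately show ?thesis by blast
qed

lemma pairwise_monothetic:
  assumes B: "S \<subseteq> B" "subgroup B G" "closedin T B"
    and pair: "\<And>s t. s \<in> S \<Longrightarrow> t \<in> S \<Longrightarrow>
      \<exists>w\<in>carrier G. s \<in> monothetic w \<and> t \<in> monothetic w"
  shows "\<exists>x\<in>B. S \<subseteq> monothetic x"
proof -
  have "\<exists>x\<in>B. S \<subseteq> monothetic_mod {\<one>} x"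
    by (rule pairwise_monothetic_mod[OF B]) (use pair monothetic_mod_one in auto)
  then show ?thesis using monothetic_mod_one subgroup.mem_carrier[OF B(2)] by auto
qed

text \<open>Any two elements of \<open>B\<close> lie in \<open>monothetic w\<close>, so gluing
  inside \<open>B\<close> produces a generator that belongs to \<open>B\<close>.\<close>

lemma closed_subgroup_monothetic:
  assumes B: "subgroup B G" "closedin T B" and w: "w \<in> carrier G" "B \<subseteq> monothetic w"
  shows "\<exists>x\<in>B. B = monothetic x"
proof -
  have "\<exists>x\<in>B. B \<subseteq> monothetic x"
    using w by (intro pairwise_monothetic B) auto
  then obtain x where x: "x \<in> B" "B \<subseteq> monothetic x" by auto
  then have "B = monothetic x" using monothetic_minimal[OF x(1) B] by auto
  then show ?thesis using x(1) by auto
qed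

text \<open>The automorphisms of a procyclic group commute, being given by powers modulo every
  open subgroup.\<close>

lemma commutator_centralizes_procyclic:
  assumes B: "B \<lhd> G" "closedin T B" "w \<in> carrier G" "B \<subseteq> monothetic w"
    and x: "x \<in> carrier G" and y: "y \<in> carrier G" and b: "b \<in> B"
  shows "commutator G x y \<otimes> b = b \<otimes> commutator G x y"
proof -
  interpret B: normal B G by fact
  obtain v where v: "v \<in> B" "B = monothetic v"
    using closed_subgroup_monothetic[OF B.is_subgroup B(2-4)] by auto
  have vG: "v \<in> carrier G" and bG: "b \<in> carrier G" using v b by auto
  \<comment> \<open>If conjugation by \<open>z\<close> sends \<open>v\<close> to
    \<open>v [^] i\<close> modulo \<open>K\<close>, it multiplies every exponent by
    \<open>i\<close>; two such operations commute because integer multiplication does.\<close>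
  have step: "K #> (inv z \<otimes> c \<otimes> z) = K #> v [^] (i * l)"
    if K: "open_normal K" and z: "z \<in> carrier G" "K #> (inv z \<otimes> v \<otimes> z) = K #> v [^] i"
      and c: "c \<in> carrier G" "K #> c = K #> v [^] l" for K z c and i l :: int
  proof -
    interpret normal K G using K by (simp add: open_normal_def)
    have "K #> (inv z \<otimes> c \<otimes> z) = K #> (inv z \<otimes> v [^] l \<otimes> z)"
      using z c vG by (intro rcoset_mult_cong) auto
    also have "inv z \<otimes> v [^] l \<otimes> z = (inv z \<otimes> v \<otimes> z) [^] l"
      using z vG by (simp add: conj_int_pow)
    also have "K #> \<dots> = K #> (v [^] i) [^] l"
      using z vG by (intro rcoset_int_pow_cong) auto
    finally show ?thesis using vG by (simp add: int_pow_pow)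
  qed
  have *: "inv y \<otimes> (inv x \<otimes> b \<otimes> x) \<otimes> y = inv x \<otimes> (inv y \<otimes> b \<otimes> y) \<otimes> x"
    if x: "x \<in> carrier G" and y: "y \<in> carrier G" for x y
  proof (subst eq_iff_open_normal)
    show "\<forall>K. open_normal K \<longrightarrow> K #> (inv y \<otimes> (inv x \<otimes> b \<otimes> x) \<otimes> y) =
        K #> (inv x \<otimes> (inv y \<otimes> b \<otimes> y) \<otimes> x)"
    proof (intro allI impI)
      fix K assume K: "open_normal K"
      have B': "\<exists>i::int. K #> z = K #> v [^] i" if "z \<in> B" for z
        using monothetic_mem_iff[OF vG, of z] that K monothetic_carrier[OF vG] unfolding v(2)
        by blast
      have "inv x \<otimes> v \<otimes> x \<in> B" "inv y \<otimes> v \<otimes> y \<in> B"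
        using x y v B.inv_op_closed1 by auto
      then obtain i j l :: int where ij: "K #> (inv x \<otimes> v \<otimes> x) = K #> v [^] i"
        "K #> (inv y \<otimes> v \<otimes> y) = K #> v [^] j" "K #> b = K #> v [^] l"
        using B'[OF b] B'[of "inv x \<otimes> v \<otimes> x"] B'[of "inv y \<otimes> v \<otimes> y"] by blast
      have "K #> (inv y \<otimes> (inv x \<otimes> b \<otimes> x) \<otimes> y) = K #> v [^] (j * (i * l))"
        using x bG by (intro step[OF K y ij(2) _ step[OF K x ij(1) bG ij(3)]]) simp
      also have "\<dots> = K #> v [^] (i * (j * l))" by (simp add: mult.left_commute)
      also have "\<dots> = K #> (inv x \<otimes> (inv y \<otimes> b \<otimes> y) \<otimes> x)"
        using y bG by (intro step[OF K x ij(1) _ step[OF K y ij(2) bG ij(3)], symmetric]) simp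
      finally show "K #> (inv y \<otimes> (inv x \<otimes> b \<otimes> x) \<otimes> y) =
        K #> (inv x \<otimes> (inv y \<otimes> b \<otimes> y) \<otimes> x)" .
    qed
  qed (use x y bG in auto)
  have "y \<otimes> (x \<otimes> b \<otimes> inv x) \<otimes> inv y = x \<otimes> (y \<otimes> b \<otimes> inv y) \<otimes> inv x"
    using *[of "inv x" "inv y"] x y by simp
  then have "inv x \<otimes> inv y \<otimes> (y \<otimes> (x \<otimes> b \<otimes> inv x) \<otimes> inv y) \<otimes> x \<otimes> y =
    inv x \<otimes> inv y \<otimes> (x \<otimes> (y \<otimes> b \<otimes> inv y) \<otimes> inv x) \<otimes> x \<otimes> y" by simp
  then show ?thesis using x y bG by (simp add: commutator_def group_word)
qed

end

section \<open>Consequences of the covering\<close>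

text \<open>The covering subgroups are recorded by their generators: closedness and the subgroup
  property then come with \<open>monothetic\<close>, and countability is that of a set of
  elements.\<close>

locale covered_profinite_group = profinite_group +
  fixes W :: "'a set"
  assumes countable_cover: "countable W"
    and cover_carrier: "W \<subseteq> carrier G"
    and cover: "x \<in> carrier G \<Longrightarrow> y \<in> carrier G \<Longrightarrow> \<exists>w\<in>W. commutator G x y \<in> monothetic w"
begin

text \<open>The sets \<open>F w\<close> are closed and, \<open>W\<close> being countable, cannot all
  have empty interior in the compact Hausdorff space \<open>A \<times> Y\<close>. An interior point
  \<open>(x\<^sub>0, y\<^sub>0)\<close> has a neighbourhood that contains a box, and shrinking both
  sides of it to cosets of a common open normal subgroup gives \<open>K\<close>.\<close>

lemma Baire_box:
  assumes a: "a \<in> carrier G" and b: "b \<in> carrier G"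
    and A: "subgroup A G" "closedin T A" and Y: "subgroup Y G" "closedin T Y"
  shows "\<exists>x\<^sub>0\<in>A. \<exists>y\<^sub>0\<in>Y. \<exists>K. \<exists>w\<in>carrier G. open_normal K \<and>
    (\<forall>x\<in>A \<inter> K. \<forall>y\<in>Y \<inter> K. commutator G (a \<otimes> x\<^sub>0 \<otimes> x) (b \<otimes> y\<^sub>0 \<otimes> y) \<in> monothetic w)"
proof -
  have XG: "A \<subseteq> carrier G" and YG: "Y \<subseteq> carrier G" using A Y closedin_subset_carrier by auto
  define Z where "Z = prod_topology (subtopology T A) (subtopology T Y)"
  have Z: "topspace Z = A \<times> Y" using XG YG by (auto simp: Z_def topspace_eq_carrier)
  have "compact_space (subtopology T A)" "compact_space (subtopology T Y)"
    using A Y compact closedin_compact_space compact_space_subtopology by blast+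
  then have comp: "compact_space Z" by (simp add: Z_def compact_space_prod_topology)
  have "Hausdorff_space Z"
    unfolding Z_def using Hausdorff by (simp add: Hausdorff_space_prod_topology Hausdorff_space_subtopology)
  then have reg: "locally_compact_space Z \<and> regular_space Z"
    using comp compact_Hausdorff_imp_regular_space compact_imp_locally_compact_space by blast
  define F where "F w = {p \<in> topspace Z. commutator G (a \<otimes> fst p) (b \<otimes> snd p) \<in> monothetic w}" for w
  have F: "closedin Z (F w)" for w
  proof -
    have "continuous_map Z T fst" "continuous_map Z T snd" unfolding Z_def
      by (meson continuous_map_fst continuous_map_snd continuous_map_in_subtopology)+
    then have "continuous_map Z T (\<lambda>p. commutator G (a \<otimes> fst p) (b \<otimes> snd p))"
      using a b by (intro continuous_group_intros) auto
    then show ?thesis unfolding F_def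
      by (rule closedin_continuous_map_preimage) (rule closedin_topologically_generated)
  qed
  have "\<exists>w\<in>W. Z interior_of F w \<noteq> {}"
  proof (rule ccontr)
    assume "\<not> ?thesis"
    then have "Z interior_of \<Union>(F ` W) = {}"
      using F countable_cover reg by (intro Baire_category_alt) auto
    moreover have "\<Union>(F ` W) = topspace Z"
    proof
      show "topspace Z \<subseteq> \<Union>(F ` W)"
      proof
        fix p assume p: "p \<in> topspace Z"
        then have "a \<otimes> fst p \<in> carrier G" "b \<otimes> snd p \<in> carrier G"
          using a b XG YG by (auto simp: Z)
        then show "p \<in> \<Union>(F ` W)" using cover p unfolding F_def by blast
      qed
    qed (auto simp: F_def)
    ultimately have "A \<times> Y = {}" using Z interior_of_topspace[of Z] by simp
    then show False using subgroup.one_closed[OF A(1)] subgroup.one_closed[OF Y(1)] by auto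
  qed
  then obtain w x\<^sub>0 y\<^sub>0 where w: "w \<in> W" "(x\<^sub>0, y\<^sub>0) \<in> Z interior_of F w" by force
  obtain U V where UV: "openin (subtopology T A) U" "openin (subtopology T Y) V"
    "x\<^sub>0 \<in> U" "y\<^sub>0 \<in> V" "U \<times> V \<subseteq> F w"
  proof -
    have "openin Z (Z interior_of F w)" by simp
    then show ?thesis
      using w(2) that interior_of_subset[of Z "F w"]
      unfolding Z_def openin_prod_topology_alt by (meson order_trans)
  qed
  obtain U' V' where UV': "openin T U'" "U = U' \<inter> A" "openin T V'" "V = V' \<inter> Y"
    using UV unfolding openin_subtopology by auto
  have x0: "x\<^sub>0 \<in> A" "x\<^sub>0 \<in> carrier G" and y0: "y\<^sub>0 \<in> Y" "y\<^sub>0 \<in> carrier G"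
    using UV UV' XG YG by auto
  have "openin T {k \<in> carrier G. x\<^sub>0 \<otimes> k \<in> U'}"
    using UV' x0 by (intro openin_preimage continuous_group_intros) auto
  then obtain K where K: "open_normal K" "K \<subseteq> {k \<in> carrier G. x\<^sub>0 \<otimes> k \<in> U'}"
    using open_normal_base[of "{k \<in> carrier G. x\<^sub>0 \<otimes> k \<in> U'}"] UV UV' x0 by auto
  have "openin T {k \<in> carrier G. y\<^sub>0 \<otimes> k \<in> V'}"
    using UV' y0 by (intro openin_preimage continuous_group_intros) auto
  then obtain L where L: "open_normal L" "L \<subseteq> {k \<in> carrier G. y\<^sub>0 \<otimes> k \<in> V'}"
    using open_normal_base[of "{k \<in> carrier G. y\<^sub>0 \<otimes> k \<in> V'}"] UV UV' y0 by auto
  have "commutator G (a \<otimes> x\<^sub>0 \<otimes> x) (b \<otimes> y\<^sub>0 \<otimes> y) \<in> monothetic w"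
    if "x \<in> A \<inter> (K \<inter> L)" "y \<in> Y \<inter> (K \<inter> L)" for x y
  proof -
    have xy: "x \<in> carrier G" "y \<in> carrier G" using that XG YG by auto
    have "x\<^sub>0 \<otimes> x \<in> U" "y\<^sub>0 \<otimes> y \<in> V"
      using that K L UV' x0 y0 subgroup.m_closed[OF A(1)] subgroup.m_closed[OF Y(1)] by auto
    then have "(x\<^sub>0 \<otimes> x, y\<^sub>0 \<otimes> y) \<in> F w" using UV(5) by auto
    then show ?thesis using a b x0 y0 xy by (simp add: F_def m_assoc)
  qed
  then show ?thesis
    using w(1) cover_carrier x0 y0 open_normal_Int[OF K(1) L(1)] by blast
qed

end

text \<open>In \<open>[g, h x] = [g, x] [g [g, x], h [h, x]]\<close> the left side and the last
  factor are in \<open>P\<close>, because \<open>[g, x]\<close> is in \<open>A\<close> and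
  \<open>x\<close>, \<open>[h, x]\<close> are in \<open>Y\<close>; so \<open>[g, x]\<close> is in
  \<open>P\<close>. Expanding \<open>[h y, g x]\<close> in the same way gives
  \<open>[h y, x]\<close>, including the case \<open>y = \<one>\<close>, and then
  \<open>[h y, x] = [h [h, y], x [x, y]] [y, x]\<close> isolates \<open>[y, x]\<close>.\<close>

lemma (in group) commutators_of_box:
  assumes P: "subgroup P G" and A: "A \<lhd> G" and Y: "Y \<lhd> G" and XY: "A \<subseteq> Y"
    and g: "g \<in> carrier G" and h: "h \<in> carrier G"
    and box: "\<And>x y. x \<in> A \<Longrightarrow> y \<in> Y \<Longrightarrow> commutator G (g \<otimes> x) (h \<otimes> y) \<in> P"
    and x: "x \<in> A"
  shows "commutator G g x \<in> P" "commutator G h x \<in> P" "y \<in> Y \<Longrightarrow> commutator G y x \<in> P"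
proof -
  interpret P: subgroup P G by fact
  interpret A: normal A G by fact
  interpret Y: normal Y G by fact
  have xG: "x \<in> carrier G" and xY: "x \<in> Y" using x XY by auto
  have "commutator G g (h \<otimes> x) =
    commutator G g x \<otimes> commutator G (g \<otimes> commutator G g x) (h \<otimes> commutator G h x)"
    using g h xG commutator_mult_right[of g h x] commutator_conj[of g h x] by simp
  moreover have "commutator G g (h \<otimes> x) \<in> P"
    using box[OF A.one_closed xY] g by simp
  moreover have "commutator G (g \<otimes> commutator G g x) (h \<otimes> commutator G h x) \<in> P"
    using commutator_normal(2)[OF A x] commutator_normal(2)[OF Y xY] g h by (intro box) auto
  ultimately show "commutator G g x \<in> P"
    using subgroup_mult_cancel(1)[OF P, of "commutator G g x"] g xG by simp
  have hy: "commutator G (h \<otimes> y) x \<in> P" if "x \<in> A" "y \<in> Y" for x y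
  proof -
    have xG: "x \<in> carrier G" and yG: "y \<in> carrier G" using that by auto
    have swap: "commutator G (h \<otimes> y) (g \<otimes> x) \<in> P" if "x \<in> A" "y \<in> Y" for x y
      using box[OF that] that g h commutator_inv[of "g \<otimes> x" "h \<otimes> y"] by simp
    have *: "commutator G (h \<otimes> y) x \<in> A"
      using that h yG by (intro commutator_normal A) auto
    have "commutator G (h \<otimes> y) (g \<otimes> x) = commutator G (h \<otimes> y) x \<otimes>
        commutator G (h \<otimes> (y \<otimes> commutator G (h \<otimes> y) x)) (g \<otimes> commutator G g x)"
      using g h xG yG commutator_mult_right[of "h \<otimes> y" g x] commutator_conj[of "h \<otimes> y" g x]
      by (simp add: m_assoc)
    moreover have "commutator G (h \<otimes> y) (g \<otimes> x) \<in> P" using that by (rule swap)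
    moreover have "commutator G (h \<otimes> (y \<otimes> commutator G (h \<otimes> y) x)) (g \<otimes> commutator G g x) \<in> P"
      using commutator_normal(2)[OF A that(1) g] * XY that by (intro swap) auto
    ultimately show ?thesis
      using subgroup_mult_cancel(1)[OF P, of "commutator G (h \<otimes> y) x"] h yG xG by simp
  qed
  show hx: "commutator G h x \<in> P" using hy[OF x Y.one_closed] h by simp
  show "commutator G y x \<in> P" if y: "y \<in> Y"
  proof -
    have yG: "y \<in> carrier G" using y by simp
    have c: "commutator G h y \<in> Y" "commutator G x y \<in> A"
      using x y h yG commutator_normal A Y by blast+
    have "commutator G (h \<otimes> y) x =
        commutator G (h \<otimes> commutator G h y) (x \<otimes> commutator G x y) \<otimes> commutator G y x"
      using h yG xG commutator_mult_left[of h y x] commutator_conj[of h x y]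
        conj_conv_commutator[of "commutator G h x" y] by simp
    moreover have "commutator G (h \<otimes> commutator G h y) (x \<otimes> commutator G x y) \<in> P"
      using c x by (intro hy) auto
    ultimately show ?thesis
      using hy[OF x y] subgroup_mult_cancel(2)[OF P, of "commutator G y x"] yG xG by simp
  qed
qed

text \<open>The point is that the three families share one \<open>w\<close>: gluing needs elements
  of different families in a common procyclic subgroup. The shifts \<open>x\<^sub>0\<close> and
  \<open>y\<^sub>0\<close> are those of the Baire box and are left to be dealt with at each
  use.\<close>

lemma (in covered_profinite_group) commutators_with_open:
  assumes a: "a \<in> carrier G" and b: "b \<in> carrier G"
    and A: "A \<lhd> G" "closedin T A" and Y: "Y \<lhd> G" "closedin T Y" and XY: "A \<subseteq> Y"
  obtains x\<^sub>0 y\<^sub>0 K w where "x\<^sub>0 \<in> A" "y\<^sub>0 \<in> Y" "open_normal K" "w \<in> carrier G"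
    "\<And>x. x \<in> A \<inter> K \<Longrightarrow> commutator G (a \<otimes> x\<^sub>0) x \<in> monothetic w"
    "\<And>x. x \<in> A \<inter> K \<Longrightarrow> commutator G (b \<otimes> y\<^sub>0) x \<in> monothetic w"
    "\<And>x y. x \<in> A \<inter> K \<Longrightarrow> y \<in> Y \<inter> K \<Longrightarrow> commutator G y x \<in> monothetic w"
proof -
  obtain x\<^sub>0 y\<^sub>0 K w where *: "x\<^sub>0 \<in> A" "y\<^sub>0 \<in> Y" "open_normal K" "w \<in> carrier G"
    "\<forall>x\<in>A \<inter> K. \<forall>y\<in>Y \<inter> K. commutator G (a \<otimes> x\<^sub>0 \<otimes> x) (b \<otimes> y\<^sub>0 \<otimes> y) \<in> monothetic w"
    using Baire_box[OF a b] A Y normal_imp_subgroup by metis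
  have "x\<^sub>0 \<in> carrier G" "y\<^sub>0 \<in> carrier G"
    using *(1,2) A Y closedin_subset_carrier by blast+
  then have g: "a \<otimes> x\<^sub>0 \<in> carrier G" "b \<otimes> y\<^sub>0 \<in> carrier G" using a b by auto
  have n: "A \<inter> K \<lhd> G" "Y \<inter> K \<lhd> G" and sub: "A \<inter> K \<subseteq> Y \<inter> K"
    using A Y XY *(3) normal_subgroup_intersect by (auto simp: open_normal_def)
  have box: "commutator G (a \<otimes> x\<^sub>0 \<otimes> x) (b \<otimes> y\<^sub>0 \<otimes> y) \<in> monothetic w"
    if "x \<in> A \<inter> K" "y \<in> Y \<inter> K" for x y
    using that *(5) by simp
  show ?thesis
    using that[OF *(1-4)] commutators_of_box[OF monothetic_subgroup[OF *(4)] n sub g box] by simp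
qed

text \<open>Expand \<open>[b h, x] = [b, x] [[b, x], h] [h, x]\<close>. This is how Baire shifts and
  parts of coset decompositions are discarded once the commutators with \<open>h\<close> are known
  to lie in \<open>P\<close>.\<close>

lemma (in group) commutator_coset:
  assumes P: "subgroup P G" and b: "b \<in> carrier G" and h: "h \<in> carrier G" and x: "x \<in> carrier G"
    and 1: "commutator G h (commutator G b x) \<in> P" and 2: "commutator G h x \<in> P"
  shows "commutator G (b \<otimes> h) x \<in> P \<longleftrightarrow> commutator G b x \<in> P"
proof -
  have "commutator G (commutator G b x) h \<in> P"
    using 1 b h x commutator_inv[of h "commutator G b x"] subgroup.m_inv_closed[OF P] by simp
  then show ?thesis
    using commutator_mult_left[OF b h x] subgroup_mult_cancel[OF P] 2 b h x by simp
qed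

text \<open>On an abelian normal subgroup \<open>a \<mapsto> [g, a]\<close> is an endomorphism,
  since conjugation by \<open>a\<close> fixes \<open>A\<close> pointwise.\<close>

lemma (in group) commutator_pow_right:
  assumes A: "A \<lhd> G" and comm: "\<And>x y. x \<in> A \<Longrightarrow> y \<in> A \<Longrightarrow> x \<otimes> y = y \<otimes> x"
    and g: "g \<in> carrier G" and a: "a \<in> A"
  shows "commutator G g (a [^] (n::nat)) = commutator G g a [^] n"
proof -
  interpret A: normal A G by fact
  have aG: "a \<in> carrier G" using a by simp
  have pow: "a [^] (k::nat) \<in> A" for k using a A.is_subgroup by (intro subgroup_nat_pow)
  show ?thesis
  proof (induction n)
    case 0 then show ?case using g by (simp add: commutator_def)
  next
    case (Suc n)
    have c: "commutator G g (a [^] n) \<in> A"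
      using commutator_normal(2)[OF A pow g] .
    have "commutator G g (a [^] Suc n) = commutator G g a \<otimes> (inv a \<otimes> commutator G g (a [^] n) \<otimes> a)"
      using commutator_mult_right[of g "a [^] n" a] g aG by simp
    also have "inv a \<otimes> commutator G g (a [^] n) \<otimes> a = commutator G g (a [^] n)"
      using comm[OF c a] c aG by (simp add: m_assoc inv_mult_cancel)
    also have "commutator G g a \<otimes> commutator G g (a [^] n) = commutator G g (a [^] n) \<otimes> commutator G g a"
      using comm[OF c commutator_normal(2)[OF A a g]] by simp
    finally show ?case using Suc g aG by simp
  qed
qed

lemma (in group) power_preimage_subgroup:
  assumes A: "subgroup A G" and comm: "\<And>x y. x \<in> A \<Longrightarrow> y \<in> A \<Longrightarrow> x \<otimes> y = y \<otimes> x"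
    and P: "subgroup P G"
  shows "subgroup {a \<in> A. a [^] (n::nat) \<in> P} G"
proof -
  interpret A: subgroup A G by fact
  interpret P: subgroup P G by fact
  show ?thesis
  proof
    show "{a \<in> A. a [^] n \<in> P} \<subseteq> carrier G" by auto
    show "\<one> \<in> {a \<in> A. a [^] n \<in> P}" by simp
    show "x \<otimes> y \<in> {a \<in> A. a [^] n \<in> P}"
      if "x \<in> {a \<in> A. a [^] n \<in> P}" "y \<in> {a \<in> A. a [^] n \<in> P}" for x y
      using that comm[of x y] pow_mult_distrib[of x y n] by simp
    show "inv x \<in> {a \<in> A. a [^] n \<in> P}" if "x \<in> {a \<in> A. a [^] n \<in> P}" for x
      using that nat_pow_inv[of x n] by simp
  qed
qed

context profinite_group
begin

lemma closedin_image:
  assumes "continuous_map T T f" "closedin T S"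
  shows "closedin T (f ` S)"
  using continuous_imp_closed_map[OF assms(1) compact Hausdorff] assms(2)
  by (simp add: closed_map_def)

lemma closedin_power_preimage:
  assumes "closedin T A" "closedin T P"
  shows "closedin T {a \<in> A. a [^] (n::nat) \<in> P}"
proof -
  have "closedin T {a \<in> carrier G. a [^] n \<in> P}"
    by (intro closedin_preimage continuous_group_intros assms)
  then have "closedin T (A \<inter> {a \<in> carrier G. a [^] n \<in> P})" using assms by blast
  moreover have "A \<inter> {a \<in> carrier G. a [^] n \<in> P} = {a \<in> A. a [^] n \<in> P}"
    using closedin_subset_carrier[OF assms(1)] by auto
  ultimately show ?thesis by simp
qed

text \<open>The definition of \<open>monothetic_mod\<close> speaks only of open normal subgroups
  containing \<open>C\<close>. Applied to \<open>L = C K\<close> it yields \<open>y\<close> up to a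
  factor from \<open>C\<close>, modulo \<open>K\<close>.\<close>

lemma monothetic_mod_decompose:
  assumes C: "C \<lhd> G" and w: "w \<in> carrier G" and y: "y \<in> monothetic_mod C w"
    and K: "open_normal K"
  shows "\<exists>c\<in>C. \<exists>j::int. K #> y = K #> (c \<otimes> w [^] j)"
proof -
  interpret C: normal C G by fact
  interpret K: normal K G using K by (simp add: open_normal_def)
  define L where "L = {x \<in> carrier G. \<exists>c\<in>C. K #> x = K #> c}"
  have "openin T L" unfolding L_def by (rule openin_saturated[OF K]) auto
  moreover have "L \<lhd> G"
  proof (rule normal_invI)
    show "subgroup L G"
    proof
      show "L \<subseteq> carrier G" "\<one> \<in> L" by (auto simp: L_def)
    next
      fix x y assume "x \<in> L" "y \<in> L"
      then obtain c d where *: "c \<in> C" "d \<in> C" "K #> x = K #> c" "K #> y = K #> d"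
        "x \<in> carrier G" "y \<in> carrier G" unfolding L_def by auto
      have "K #> (x \<otimes> y) = K #> (c \<otimes> d)"
        using * by (intro K.rcoset_mult_cong) auto
      then show "x \<otimes> y \<in> L" using * unfolding L_def by blast
    next
      fix x assume "x \<in> L"
      then obtain c where *: "c \<in> C" "K #> x = K #> c" "x \<in> carrier G" unfolding L_def by auto
      have "K #> inv x = K #> inv c" using * by (intro K.rcoset_inv_cong) auto
      then show "inv x \<in> L" using * unfolding L_def by blast
    qed
    fix g x assume g: "g \<in> carrier G" and "x \<in> L"
    then obtain c where *: "c \<in> C" "K #> x = K #> c" "x \<in> carrier G" unfolding L_def by auto
    have "K #> (g \<otimes> x \<otimes> inv g) = K #> (g \<otimes> c \<otimes> inv g)"
      using * g by (intro K.rcoset_mult_cong) auto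
    then show "g \<otimes> x \<otimes> inv g \<in> L" using * g C.inv_op_closed2 unfolding L_def by auto
  qed
  ultimately have L: "open_normal L" by (simp add: open_normal_def)
  have "C \<subseteq> L" unfolding L_def using C.subset by auto
  then obtain j :: int where j: "L #> y = L #> w [^] j"
    using y L unfolding monothetic_mod_def by blast
  have yG: "y \<in> carrier G" using y by (simp add: monothetic_mod_def)
  have "y \<otimes> inv (w [^] j) \<in> L"
    using normal.rcoset_eq_iff[of L G y "w [^] j"] j L yG w unfolding open_normal_def by blast
  then obtain c where c: "c \<in> C" "K #> (y \<otimes> inv (w [^] j)) = K #> c" unfolding L_def by auto
  have "K #> (y \<otimes> inv (w [^] j) \<otimes> w [^] j) = K #> (c \<otimes> w [^] j)"
    using c yG w by (intro K.rcoset_mult_cong) auto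
  then have "K #> y = K #> (c \<otimes> w [^] j)" using yG w by (simp add: m_assoc)
  then show ?thesis using c(1) by blast
qed

end

section \<open>Open normal subgroups with procyclic commutators\<close>

context covered_profinite_group
begin

lemma open_commutators_monothetic:
  "\<exists>H. open_normal H \<and> (\<exists>w\<in>carrier G. \<forall>x\<in>H. \<forall>y\<in>H. commutator G x y \<in> monothetic w)"
proof -
  have n: "carrier G \<lhd> G" and c: "closedin T (carrier G)"
    using open_normal_carrier closedin_open_normal by (auto simp: open_normal_def)
  from commutators_with_open[OF one_closed one_closed n c n c order_refl]
  obtain K w where *: "open_normal K" "w \<in> carrier G"
    "\<And>x y. x \<in> carrier G \<inter> K \<Longrightarrow> y \<in> carrier G \<inter> K \<Longrightarrow> commutator G y x \<in> monothetic w"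
    by metis
  have "K \<subseteq> carrier G" using closedin_subset_carrier[OF closedin_open_normal[OF *(1)]] .
  then have "\<forall>x\<in>K. \<forall>y\<in>K. commutator G x y \<in> monothetic w" using *(3) by auto
  then show ?thesis using *(1,2) by auto
qed

text \<open>Modulo \<open>C\<close> the commutator \<open>[b h, x]\<close> with \<open>h\<close>,
  \<open>x\<close> in \<open>H\<close> does not depend on \<open>h\<close>, since
  \<open>[h, x]\<close> and \<open>[h, [b, x]]\<close> lie in \<open>C\<close>. So the Baire shifts
  in \<open>H\<close> disappear and only finitely many pairs of coset representatives remain;
  \<open>M\<close> is the intersection of \<open>H\<close> with the subgroups found for these pairs.
  The conclusion is pairwise, ready for gluing.\<close>

lemma commutators_monothetic_mod:
  assumes H: "open_normal H" and C: "C \<lhd> G" "closedin T C"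
    and HC: "\<And>x y. x \<in> H \<Longrightarrow> y \<in> H \<Longrightarrow> commutator G x y \<in> C"
  shows "\<exists>M. open_normal M \<and> M \<subseteq> H \<and> (\<forall>g\<in>carrier G. \<forall>h\<in>carrier G. \<forall>x\<in>M. \<forall>y\<in>M.
    \<exists>w\<in>carrier G. commutator G g x \<in> monothetic_mod C w \<and> commutator G h y \<in> monothetic_mod C w)"
proof -
  have Hn: "H \<lhd> G" using H by (simp add: open_normal_def)
  note Hc = closedin_open_normal[OF H]
  interpret H: normal H G by fact
  interpret C: normal C G by fact
  obtain F where F: "finite F" "F \<subseteq> carrier G" "\<And>x. x \<in> carrier G \<Longrightarrow> \<exists>f\<in>F. \<exists>h\<in>H. x = f \<otimes> h"
    using open_normal_transversal[OF H] by blast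
  have coset: "commutator G (b \<otimes> h) x \<in> monothetic_mod C w \<longleftrightarrow> commutator G b x \<in> monothetic_mod C w"
    if "b \<in> carrier G" "h \<in> H" "x \<in> H" "w \<in> carrier G" for b h x w
  proof (rule commutator_coset)
    have "C \<subseteq> monothetic_mod C w" using that C.subset by (intro monothetic_mod_kernel)
    then show "commutator G h (commutator G b x) \<in> monothetic_mod C w"
      "commutator G h x \<in> monothetic_mod C w"
      using HC that commutator_normal(2)[OF Hn] by auto
  qed (use that monothetic_mod_subgroup in auto)
  have "\<exists>K. open_normal K \<and> (\<exists>w\<in>carrier G. \<forall>x\<in>H \<inter> K.
      commutator G (fst p) x \<in> monothetic_mod C w \<and> commutator G (snd p) x \<in> monothetic_mod C w)"
    if p: "p \<in> F \<times> F" for p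
  proof -
    have bc: "fst p \<in> carrier G" "snd p \<in> carrier G" using p F(2) by auto
    from commutators_with_open[OF bc Hn Hc Hn Hc order_refl]
    obtain x\<^sub>0 y\<^sub>0 K w where *: "x\<^sub>0 \<in> H" "y\<^sub>0 \<in> H" "open_normal K" "w \<in> carrier G"
      "\<And>x. x \<in> H \<inter> K \<Longrightarrow> commutator G (fst p \<otimes> x\<^sub>0) x \<in> monothetic w"
      "\<And>x. x \<in> H \<inter> K \<Longrightarrow> commutator G (snd p \<otimes> y\<^sub>0) x \<in> monothetic w"
      by metis
    have "commutator G (fst p) x \<in> monothetic_mod C w \<and> commutator G (snd p) x \<in> monothetic_mod C w"
      if x: "x \<in> H \<inter> K" for x
      using *(5)[OF x] *(6)[OF x] coset[OF bc(1) *(1), of x w] coset[OF bc(2) *(2), of x w]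
        x *(4) monothetic_le_mod[OF *(4), of C] by auto
    then show ?thesis using *(3,4) by auto
  qed
  then obtain K where K: "\<And>p. p \<in> F \<times> F \<Longrightarrow> open_normal (K p)"
    "\<And>p. p \<in> F \<times> F \<Longrightarrow> \<exists>w\<in>carrier G. \<forall>x\<in>H \<inter> K p.
      commutator G (fst p) x \<in> monothetic_mod C w \<and> commutator G (snd p) x \<in> monothetic_mod C w"
    by metis
  define M where "M = H \<inter> (carrier G \<inter> (\<Inter>p\<in>F \<times> F. K p))"
  have M: "open_normal M" unfolding M_def
    using F(1) K(1) by (intro open_normal_Int open_normal_INT H) auto
  moreover have "M \<subseteq> H" by (auto simp: M_def)
  moreover have "\<exists>w\<in>carrier G. commutator G g x \<in> monothetic_mod C w \<and>
      commutator G h y \<in> monothetic_mod C w"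
    if gh: "g \<in> carrier G" "h \<in> carrier G" and xy: "x \<in> M" "y \<in> M" for g h x y
  proof -
    obtain f g' where f: "f \<in> F" "g' \<in> H" "g = f \<otimes> g'" using F(3) gh(1) by blast
    obtain f2 h' where f2: "f2 \<in> F" "h' \<in> H" "h = f2 \<otimes> h'" using F(3) gh(2) by blast
    obtain w where w: "w \<in> carrier G" "\<forall>x\<in>H \<inter> K (f, f2).
      commutator G f x \<in> monothetic_mod C w \<and> commutator G f2 x \<in> monothetic_mod C w"
      using K(2)[of "(f, f2)"] f f2 by auto
    have "x \<in> H \<inter> K (f, f2)" "y \<in> H \<inter> K (f, f2)" using xy f f2 by (auto simp: M_def)
    then show ?thesis
      using w coset[of f g' x w] coset[of f2 h' y w] f f2 F(2) by auto
  qed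
  ultimately show ?thesis by blast
qed

text \<open>Every element of \<open>G\<close> is a representative of a coset of \<open>H\<close>
  times an element of \<open>H\<close>, and the latter is again split by a transversal of an open
  subgroup \<open>L\<close>. So the required commutators are controlled by four families, three of
  which lie in the procyclic \<open>C\<close>; only pairs that involve the remaining one,
  \<open>S\<^sub>1\<close>, need Baire's theorem, and three kinds of boxes supply them.\<close>

lemma commutators_monothetic_abelian:
  assumes H: "open_normal H" and C: "C \<lhd> G" "closedin T C"
    and w\<^sub>0: "w\<^sub>0 \<in> carrier G" "C \<subseteq> monothetic w\<^sub>0"
    and HC: "\<And>x y. x \<in> H \<Longrightarrow> y \<in> H \<Longrightarrow> commutator G x y \<in> C"
    and A: "A \<lhd> G" "closedin T A" "A \<subseteq> H"
    and comm: "\<And>x y. x \<in> A \<Longrightarrow> y \<in> A \<Longrightarrow> x \<otimes> y = y \<otimes> x"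
  shows "\<exists>K. open_normal K \<and> (\<exists>w\<in>carrier G.
    (\<forall>g\<in>carrier G. \<forall>x\<in>A \<inter> K. commutator G g x \<in> monothetic w) \<and>
    (\<forall>x\<in>H \<inter> K. \<forall>y\<in>H \<inter> K. commutator G x y \<in> monothetic w))"
proof -
  have Hn: "H \<lhd> G" using H by (simp add: open_normal_def)
  note Hc = closedin_open_normal[OF H]
  interpret H: normal H G by fact
  interpret A: normal A G by fact
  have comm_one: "commutator G a x = \<one>" if "a \<in> A" "x \<in> A" for a x
    using that comm commutator_eq_one_iff by simp
  have comm_A: "commutator G (g \<otimes> a) x = commutator G g x" if "g \<in> carrier G" "a \<in> A" "x \<in> A" for g a x
    using that commutator_mult_left[of g a x] comm_one[of a x]
      comm_one[of "commutator G g x" a] commutator_normal(2)[OF A(1), of x g] by simp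
  obtain F where F: "finite F" "F \<subseteq> carrier G" "\<And>x. x \<in> carrier G \<Longrightarrow> \<exists>f\<in>F. \<exists>h\<in>H. x = f \<otimes> h"
    using open_normal_transversal[OF H] by blast
  have "\<forall>f\<in>F. \<exists>x\<^sub>0 K. \<exists>w\<in>carrier G. x\<^sub>0 \<in> H \<and> open_normal K \<and>
    (\<forall>x\<in>H \<inter> K. commutator G (f \<otimes> x\<^sub>0) x \<in> monothetic w) \<and>
    (\<forall>x\<in>H \<inter> K. \<forall>y\<in>H \<inter> K. commutator G y x \<in> monothetic w)"
  proof
    fix f assume "f \<in> F"
    then have "f \<in> carrier G" using F by auto
    from commutators_with_open[OF this one_closed Hn Hc Hn Hc]
    show "\<exists>x\<^sub>0 K. \<exists>w\<in>carrier G. x\<^sub>0 \<in> H \<and> open_normal K \<and>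
      (\<forall>x\<in>H \<inter> K. commutator G (f \<otimes> x\<^sub>0) x \<in> monothetic w) \<and>
      (\<forall>x\<in>H \<inter> K. \<forall>y\<in>H \<inter> K. commutator G y x \<in> monothetic w)"
      by (metis order_refl)
  qed
  then obtain r K\<^sub>1 w\<^sub>1 where "\<forall>f\<in>F. w\<^sub>1 f \<in> carrier G \<and> r f \<in> H \<and> open_normal (K\<^sub>1 f) \<and>
    (\<forall>x\<in>H \<inter> K\<^sub>1 f. commutator G (f \<otimes> r f) x \<in> monothetic (w\<^sub>1 f)) \<and>
    (\<forall>x\<in>H \<inter> K\<^sub>1 f. \<forall>y\<in>H \<inter> K\<^sub>1 f. commutator G y x \<in> monothetic (w\<^sub>1 f))"
    unfolding Bex_def bchoice_iff by (elim exE) (rule that)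
  then have K\<^sub>1: "\<And>f. f \<in> F \<Longrightarrow> w\<^sub>1 f \<in> carrier G" "\<And>f. f \<in> F \<Longrightarrow> r f \<in> H"
    "\<And>f. f \<in> F \<Longrightarrow> open_normal (K\<^sub>1 f)"
    "\<And>f x. f \<in> F \<Longrightarrow> x \<in> H \<inter> K\<^sub>1 f \<Longrightarrow> commutator G (f \<otimes> r f) x \<in> monothetic (w\<^sub>1 f)"
    "\<And>f x y. f \<in> F \<Longrightarrow> x \<in> H \<inter> K\<^sub>1 f \<Longrightarrow> y \<in> H \<inter> K\<^sub>1 f \<Longrightarrow> commutator G y x \<in> monothetic (w\<^sub>1 f)"
    by auto
  \<comment> \<open>Shifts in \<open>H\<close> are not removed here but absorbed in the choice of
    representatives: the values of \<open>t\<close> replace \<open>F\<close> as representatives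
    modulo \<open>H\<close>.\<close>
  define t where "t f = f \<otimes> r f" for f
  have t: "t f \<in> carrier G" if "f \<in> F" for f
    using that F K\<^sub>1(2)[OF that] by (auto simp: t_def)
  have "\<forall>f\<in>F. \<exists>K. \<exists>w\<in>carrier G. open_normal K \<and>
    (\<forall>x\<in>A \<inter> K. commutator G (t f) x \<in> monothetic w) \<and>
    (\<forall>x\<in>A \<inter> K. \<forall>y\<in>H \<inter> K. commutator G y x \<in> monothetic w)"
  proof
    fix f assume f: "f \<in> F"
    obtain x\<^sub>0 K w where *: "x\<^sub>0 \<in> A" "open_normal K" "w \<in> carrier G"
      "\<And>x. x \<in> A \<inter> K \<Longrightarrow> commutator G (t f \<otimes> x\<^sub>0) x \<in> monothetic w"
      "\<And>x y. x \<in> A \<inter> K \<Longrightarrow> y \<in> H \<inter> K \<Longrightarrow> commutator G y x \<in> monothetic w"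
      using commutators_with_open[OF t[OF f] one_closed A(1,2) Hn Hc A(3)] by metis
    have "commutator G (t f) x \<in> monothetic w" if "x \<in> A \<inter> K" for x
      using *(4)[OF that] comm_A[OF t[OF f] *(1), of x] that by simp
    then show "\<exists>K. \<exists>w\<in>carrier G. open_normal K \<and>
      (\<forall>x\<in>A \<inter> K. commutator G (t f) x \<in> monothetic w) \<and>
      (\<forall>x\<in>A \<inter> K. \<forall>y\<in>H \<inter> K. commutator G y x \<in> monothetic w)"
      using *(2,3,5) by (intro exI[of _ K] bexI[of _ w]) auto
  qed
  then obtain K\<^sub>2 w\<^sub>2 where "\<forall>f\<in>F. w\<^sub>2 f \<in> carrier G \<and> open_normal (K\<^sub>2 f) \<and>
    (\<forall>x\<in>A \<inter> K\<^sub>2 f. commutator G (t f) x \<in> monothetic (w\<^sub>2 f)) \<and>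
    (\<forall>x\<in>A \<inter> K\<^sub>2 f. \<forall>y\<in>H \<inter> K\<^sub>2 f. commutator G y x \<in> monothetic (w\<^sub>2 f))"
    unfolding Bex_def bchoice_iff by (elim exE) (rule that)
  then have K\<^sub>2: "\<And>f. f \<in> F \<Longrightarrow> w\<^sub>2 f \<in> carrier G" "\<And>f. f \<in> F \<Longrightarrow> open_normal (K\<^sub>2 f)"
    "\<And>f x. f \<in> F \<Longrightarrow> x \<in> A \<inter> K\<^sub>2 f \<Longrightarrow> commutator G (t f) x \<in> monothetic (w\<^sub>2 f)"
    "\<And>f x y. f \<in> F \<Longrightarrow> x \<in> A \<inter> K\<^sub>2 f \<Longrightarrow> y \<in> H \<inter> K\<^sub>2 f \<Longrightarrow> commutator G y x \<in> monothetic (w\<^sub>2 f)"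
    by auto
  define L where "L = H \<inter> (carrier G \<inter> (\<Inter>f\<in>F. K\<^sub>2 f))"
  have L: "open_normal L" unfolding L_def
    using F(1) K\<^sub>2(2) by (intro open_normal_Int open_normal_INT H) auto
  obtain F' where F': "finite F'" "F' \<subseteq> carrier G" "\<And>x. x \<in> carrier G \<Longrightarrow> \<exists>f\<in>F'. \<exists>k\<in>L. x = f \<otimes> k"
    using open_normal_transversal[OF L] by blast
  \<comment> \<open>Representatives of \<open>G\<close> modulo \<open>H\<close> together with those
    of \<open>H\<close> modulo \<open>L\<close>; the latter are the elements of \<open>F'\<close> in
    \<open>H\<close>, because \<open>L\<close> is contained in \<open>H\<close>.\<close>
  define E where "E = t ` F \<union> (F' \<inter> H)"
  have E: "finite E" "E \<subseteq> carrier G" using F(1) F' t by (auto simp: E_def)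
  have "\<forall>p\<in>E \<times> E. \<exists>K. \<exists>w\<in>carrier G. open_normal K \<and> (\<forall>x\<in>A \<inter> K.
    commutator G (fst p) x \<in> monothetic w \<and> commutator G (snd p) x \<in> monothetic w)"
  proof
    fix p assume p: "p \<in> E \<times> E"
    then have e: "fst p \<in> carrier G" "snd p \<in> carrier G" using E(2) by auto
    obtain x\<^sub>0 y\<^sub>0 K w where *: "x\<^sub>0 \<in> A" "y\<^sub>0 \<in> A" "open_normal K" "w \<in> carrier G"
      "\<And>x. x \<in> A \<inter> K \<Longrightarrow> commutator G (fst p \<otimes> x\<^sub>0) x \<in> monothetic w"
      "\<And>x. x \<in> A \<inter> K \<Longrightarrow> commutator G (snd p \<otimes> y\<^sub>0) x \<in> monothetic w"
      using commutators_with_open[OF e A(1,2) A(1,2) order_refl] by metis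
    have "commutator G (fst p) x \<in> monothetic w" "commutator G (snd p) x \<in> monothetic w"
      if "x \<in> A \<inter> K" for x
      using *(5)[OF that] *(6)[OF that] comm_A[OF e(1) *(1), of x] comm_A[OF e(2) *(2), of x] that
      by auto
    then show "\<exists>K. \<exists>w\<in>carrier G. open_normal K \<and> (\<forall>x\<in>A \<inter> K.
      commutator G (fst p) x \<in> monothetic w \<and> commutator G (snd p) x \<in> monothetic w)"
      using *(3,4) by auto
  qed
  then obtain K\<^sub>3 w\<^sub>3 where "\<forall>p\<in>E \<times> E. w\<^sub>3 p \<in> carrier G \<and> open_normal (K\<^sub>3 p) \<and>
    (\<forall>x\<in>A \<inter> K\<^sub>3 p. commutator G (fst p) x \<in> monothetic (w\<^sub>3 p) \<and>
      commutator G (snd p) x \<in> monothetic (w\<^sub>3 p))"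
    unfolding Bex_def bchoice_iff by (elim exE) (rule that)
  then have K\<^sub>3: "\<And>p. p \<in> E \<times> E \<Longrightarrow> w\<^sub>3 p \<in> carrier G"
    "\<And>p. p \<in> E \<times> E \<Longrightarrow> open_normal (K\<^sub>3 p)"
    "\<And>p x. p \<in> E \<times> E \<Longrightarrow> x \<in> A \<inter> K\<^sub>3 p \<Longrightarrow> commutator G (fst p) x \<in> monothetic (w\<^sub>3 p)"
    "\<And>p x. p \<in> E \<times> E \<Longrightarrow> x \<in> A \<inter> K\<^sub>3 p \<Longrightarrow> commutator G (snd p) x \<in> monothetic (w\<^sub>3 p)"
    by blast+
  define K where "K = L \<inter> ((carrier G \<inter> (\<Inter>f\<in>F. K\<^sub>1 f)) \<inter> (carrier G \<inter> (\<Inter>p\<in>E \<times> E. K\<^sub>3 p)))"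
  have K: "open_normal K" unfolding K_def
    using F(1) E(1) K\<^sub>1(3) K\<^sub>3(2) by (intro open_normal_Int open_normal_INT L) auto
  have sub: "K \<subseteq> L" "L \<subseteq> H" "\<And>f. f \<in> F \<Longrightarrow> K \<subseteq> K\<^sub>1 f" "\<And>f. f \<in> F \<Longrightarrow> L \<subseteq> K\<^sub>2 f"
    "\<And>p. p \<in> E \<times> E \<Longrightarrow> K \<subseteq> K\<^sub>3 p"
    by (auto simp: K_def L_def)
  \<comment> \<open>Pairs of \<open>S\<^sub>1\<close> with \<open>S\<^sub>1\<close> and
    \<open>S\<^sub>2\<close> are provided by \<open>K\<^sub>3\<close>, pairs with
    \<open>S\<^sub>3\<close> by \<open>K\<^sub>2\<close> and pairs with \<open>S\<^sub>4\<close> by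
    \<open>K\<^sub>1\<close>; pairs inside the other three families are covered by
    \<open>w\<^sub>0\<close>.\<close>
  define S\<^sub>1 where "S\<^sub>1 = {commutator G (t f) x |f x. f \<in> F \<and> x \<in> A \<inter> K}"
  define S\<^sub>2 where "S\<^sub>2 = {commutator G e x |e x. e \<in> F' \<inter> H \<and> x \<in> A \<inter> K}"
  define S\<^sub>3 where "S\<^sub>3 = {commutator G y x |y x. y \<in> L \<and> x \<in> A \<inter> K}"
  define S\<^sub>4 where "S\<^sub>4 = {commutator G y x |y x. y \<in> K \<and> x \<in> K}"
  have KH: "K \<subseteq> H" using sub by auto
  have S\<^sub>C: "S\<^sub>2 \<union> S\<^sub>3 \<union> S\<^sub>4 \<subseteq> C"
    using HC subsetD[OF A(3)] subsetD[OF sub(2)] subsetD[OF KH]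
    by (auto simp: S\<^sub>2_def S\<^sub>3_def S\<^sub>4_def)
  have S: "S\<^sub>1 \<union> (S\<^sub>2 \<union> S\<^sub>3 \<union> S\<^sub>4) \<subseteq> carrier G"
    using S\<^sub>C closedin_subset_carrier[OF C(2)] t by (auto simp: S\<^sub>1_def)
  have pair1: "\<exists>w\<in>carrier G. s \<in> monothetic w \<and> u \<in> monothetic w"
    if s: "s \<in> S\<^sub>1" and u: "u \<in> S\<^sub>1 \<union> (S\<^sub>2 \<union> S\<^sub>3 \<union> S\<^sub>4)" for s u
  proof -
    obtain f x where f: "f \<in> F" "x \<in> A \<inter> K" "s = commutator G (t f) x"
      using s unfolding S\<^sub>1_def by auto
    have tE: "t f \<in> E" using f by (auto simp: E_def)
    consider "u \<in> S\<^sub>1 \<union> S\<^sub>2" | "u \<in> S\<^sub>3" | "u \<in> S\<^sub>4" using u by auto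
    then show ?thesis
    proof cases
      case 1
      then obtain e y where e: "e \<in> E" "y \<in> A \<inter> K" "u = commutator G e y"
        unfolding S\<^sub>1_def S\<^sub>2_def E_def by auto
      have p: "(t f, e) \<in> E \<times> E" using e tE by auto
      have "s \<in> monothetic (w\<^sub>3 (t f, e))" "u \<in> monothetic (w\<^sub>3 (t f, e))"
        using K\<^sub>3(3)[OF p, of x] K\<^sub>3(4)[OF p, of y] f e sub(5)[OF p] by auto
      then show ?thesis using K\<^sub>3(1)[OF p] by auto
    next
      case 2
      then obtain z y where z: "z \<in> L" "y \<in> A \<inter> K" "u = commutator G z y"
        unfolding S\<^sub>3_def by auto
      have "s \<in> monothetic (w\<^sub>2 f)" "u \<in> monothetic (w\<^sub>2 f)"
        using K\<^sub>2(3)[OF f(1), of x] K\<^sub>2(4)[OF f(1), of y z] f z sub(1,2) sub(4)[OF f(1)] by auto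
      then show ?thesis using K\<^sub>2(1)[OF f(1)] by auto
    next
      case 3
      then obtain z y where z: "z \<in> K" "y \<in> K" "u = commutator G z y"
        unfolding S\<^sub>4_def by auto
      have "s \<in> monothetic (w\<^sub>1 f)" "u \<in> monothetic (w\<^sub>1 f)"
        using K\<^sub>1(4)[OF f(1), of x] K\<^sub>1(5)[OF f(1), of y z] f z KH sub(3)[OF f(1)] A(3)
        by (auto simp: t_def)
      then show ?thesis using K\<^sub>1(1)[OF f(1)] by auto
    qed
  qed
  have "\<exists>w\<in>carrier G. S\<^sub>1 \<union> (S\<^sub>2 \<union> S\<^sub>3 \<union> S\<^sub>4) \<subseteq> monothetic w"
  proof (rule pairwise_monothetic[OF S subgroup_self])
    show "closedin T (carrier G)" using closedin_open_normal open_normal_carrier by blast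
    fix s u assume su: "s \<in> S\<^sub>1 \<union> (S\<^sub>2 \<union> S\<^sub>3 \<union> S\<^sub>4)" "u \<in> S\<^sub>1 \<union> (S\<^sub>2 \<union> S\<^sub>3 \<union> S\<^sub>4)"
    show "\<exists>w\<in>carrier G. s \<in> monothetic w \<and> u \<in> monothetic w"
    proof (cases "s \<in> S\<^sub>1 \<or> u \<in> S\<^sub>1")
      case True then show ?thesis using pair1[of s u] pair1[of u s] su by blast
    next
      case False
      then have "s \<in> C" "u \<in> C" using su S\<^sub>C by auto
      then show ?thesis using w\<^sub>0 by auto
    qed
  qed
  then obtain w where w: "w \<in> carrier G" "S\<^sub>1 \<union> (S\<^sub>2 \<union> S\<^sub>3 \<union> S\<^sub>4) \<subseteq> monothetic w" by auto
  define P where "P = monothetic w"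
  have P: "subgroup P G" unfolding P_def using w(1) by (rule monothetic_subgroup)
  have AK: "A \<inter> K \<lhd> G" using A K normal_subgroup_intersect by (simp add: open_normal_def)
  have inP: "f \<in> F \<Longrightarrow> x \<in> A \<inter> K \<Longrightarrow> commutator G (t f) x \<in> P"
    "e \<in> F' \<inter> H \<Longrightarrow> x \<in> A \<inter> K \<Longrightarrow> commutator G e x \<in> P"
    "y \<in> L \<Longrightarrow> x \<in> A \<inter> K \<Longrightarrow> commutator G y x \<in> P"
    "y \<in> K \<Longrightarrow> z \<in> K \<Longrightarrow> commutator G y z \<in> P" for e f x y z
    using w(2) unfolding P_def S\<^sub>1_def S\<^sub>2_def S\<^sub>3_def S\<^sub>4_def by blast+
  \<comment> \<open>From \<open>[F' \<inter> H, A \<inter> K]\<close> and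
    \<open>[L, A \<inter> K]\<close> to \<open>[H, A \<inter> K]\<close>; since
    \<open>A \<inter> K\<close> is normal, it also contains the inner commutators that
    occur.\<close>
  have inH: "commutator G h x \<in> P" if h: "h \<in> H" and x: "x \<in> A \<inter> K" for h x
  proof -
    obtain c k where ck: "c \<in> F'" "k \<in> L" "h = c \<otimes> k" using F'(3)[OF H.mem_carrier[OF h]] by blast
    have c: "c \<in> carrier G" and k: "k \<in> carrier G" "k \<in> H" using ck F' sub by auto
    have "c \<in> H" using subgroup_mult_cancel(1)[OF H.is_subgroup c k(2)] h ck by simp
    then have "commutator G c x \<in> P" using inP(2) ck x by auto
    then show ?thesis
      using commutator_coset[OF P c k(1), of x] inP(3)[OF ck(2)] x c commutator_normal(2)[OF AK x c]
        ck(3) by simp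
  qed
  have "commutator G g x \<in> P" if g: "g \<in> carrier G" and x: "x \<in> A \<inter> K" for g x
  proof -
    obtain f h where f: "f \<in> F" "h \<in> H" "g = f \<otimes> h" using F(3) g by blast
    define h' where "h' = inv (r f) \<otimes> h"
    have h': "h' \<in> H" using f K\<^sub>1(2) by (simp add: h'_def)
    have "g = t f \<otimes> h'"
      using f F(2) K\<^sub>1(2)[OF f(1)] by (auto simp: t_def h'_def m_assoc inv_mult_cancel subsetD)
    then show ?thesis
      using commutator_coset[OF P t[OF f(1)], of h' x] inH[OF h'] x t[OF f(1)] h'
        commutator_normal(2)[OF AK x] inP(1)[OF f(1) x] by simp
  qed
  moreover have "x \<in> K" if "x \<in> H \<inter> K" for x using that by simp
  ultimately show ?thesis using K w(1) inP(4) unfolding P_def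
    by (intro exI[of _ K] conjI bexI[of _ w] ballI) auto
qed

end

lemma (in group) commutators_conj_closed:
  assumes A: "A \<lhd> G" and B: "B \<lhd> G" and "h \<in> {commutator G x y |x y. x \<in> A \<and> y \<in> B}"
    and g: "g \<in> carrier G"
  shows "g \<otimes> h \<otimes> inv g \<in> {commutator G x y |x y. x \<in> A \<and> y \<in> B}"
proof -
  obtain x y where xy: "x \<in> A" "y \<in> B" "h = commutator G x y" using assms(3) by auto
  then have "x \<in> carrier G" "y \<in> carrier G"
    using A B by (auto dest: normal_imp_subgroup simp: subgroup.mem_carrier)
  then have "g \<otimes> h \<otimes> inv g = commutator G (g \<otimes> x \<otimes> inv g) (g \<otimes> y \<otimes> inv g)"
    using xy(3) g by (simp add: commutator_conj')
  then show ?thesis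
    using normal.inv_op_closed2[OF A g xy(1)] normal.inv_op_closed2[OF B g xy(2)] by auto
qed

text \<open>Modulo \<open>P\<close>, the map \<open>(h, k) \<mapsto> [h, k]\<^sup>n\<close> is multiplicative in each argument.\<close>

lemma (in group) commutator_pow_left_mod:
  assumes A: "A \<lhd> G" and comm: "\<And>x y. x \<in> A \<Longrightarrow> y \<in> A \<Longrightarrow> x \<otimes> y = y \<otimes> x"
    and P: "subgroup P G"
    and P_comm: "\<And>g a. g \<in> carrier G \<Longrightarrow> a \<in> A \<Longrightarrow> commutator G g (a [^] n) \<in> P"
    and h: "h \<in> carrier G" and k: "k \<in> carrier G"
    and hk: "\<And>i::nat. commutator G (h [^] i) k \<in> A"
  shows "\<exists>p\<in>P. commutator G (h [^] (i::nat)) k [^] (n::nat) = p \<otimes> commutator G h k [^] (n * i)"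
proof (induction i)
  case 0
  show ?case using subgroup.one_closed[OF P] k h
    by (intro bexI[of _ \<one>]) (simp_all add: commutator_def)
next
  case (Suc i)
  interpret A: normal A G by fact
  define c where "c = commutator G (h [^] i) k"
  define d where "d = commutator G h k"
  define e where "e = commutator G c h"
  have c: "c \<in> A" and d: "d \<in> A" using hk[of i] hk[of 1] h by (simp_all add: c_def d_def)
  have e: "e \<in> A" unfolding e_def using commutator_normal(1)[OF A c h] .
  \<comment> \<open>The error term \<open>e = [c, h]\<close> is the only obstruction to
    multiplicativity, and its \<open>n\<close>-th power is the inverse of
    \<open>[h, c [^] n]\<close>, which lies in \<open>P\<close>.\<close>
  have P1: "e [^] n \<in> P"
  proof -
    have "e = inv (commutator G h c)" unfolding e_def using c h by (intro commutator_inv) auto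
    then have "e [^] n = inv (commutator G h (c [^] n))"
      using c h by (simp add: nat_pow_inv commutator_pow_right[OF A comm h c])
    then show ?thesis using subgroup.m_inv_closed[OF P P_comm[OF h c]] by simp
  qed
  obtain p where p: "p \<in> P" "c [^] n = p \<otimes> d [^] (n * i)" using Suc by (auto simp: c_def d_def)
  have pG: "p \<in> carrier G" using p subgroup.mem_carrier[OF P] by blast
  have "commutator G (h [^] Suc i) k = c \<otimes> e \<otimes> d"
    using commutator_mult_left[of "h [^] i" h k] h k by (simp add: c_def d_def e_def)
  also have "\<dots> = e \<otimes> c \<otimes> d" using comm[OF c e] by simp
  also have "\<dots> [^] n = e [^] n \<otimes> c [^] n \<otimes> d [^] n"
    using c d e
    by (simp add: pow_mult_distrib[OF comm[OF A.m_closed[OF e c] d]] pow_mult_distrib[OF comm[OF e c]])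
  also have "\<dots> = (e [^] n \<otimes> p) \<otimes> d [^] (n * Suc i)"
    using c d e p pG by (simp add: m_assoc nat_pow_mult add.commute)
  finally show ?case using P1 p(1) subgroup.m_closed[OF P] unfolding d_def by blast
qed

lemma (in covered_profinite_group) open_normal_commutators_monothetic:
  "\<exists>M. open_normal M \<and> (\<exists>w\<in>carrier G. \<forall>g\<in>carrier G. \<forall>x\<in>M. commutator G g x \<in> monothetic w)"
proof -
  obtain H w\<^sub>0 where H: "open_normal H" and w\<^sub>0: "w\<^sub>0 \<in> carrier G"
    and Hw: "\<And>x y. x \<in> H \<Longrightarrow> y \<in> H \<Longrightarrow> commutator G x y \<in> monothetic w\<^sub>0"
    using open_commutators_monothetic by auto
  have Hn: "H \<lhd> G" using H by (simp add: open_normal_def)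
  note Hc = closedin_open_normal[OF H]
  interpret H: normal H G by fact
  define S\<^sub>C where "S\<^sub>C = {commutator G x y |x y. x \<in> H \<and> y \<in> H}"
  define C where "C = topologically_generated G T S\<^sub>C"
  have S\<^sub>C: "S\<^sub>C \<subseteq> carrier G" by (auto simp: S\<^sub>C_def)
  have C: "C \<lhd> G" unfolding C_def
    using S\<^sub>C commutators_conj_closed[OF Hn Hn]
    by (intro topologically_generated_normal) (auto simp only: S\<^sub>C_def)
  have Cc: "closedin T C" unfolding C_def by (rule closedin_topologically_generated)
  interpret C: normal C G by fact
  have HC: "commutator G x y \<in> C" if "x \<in> H" "y \<in> H" for x y
    using topologically_generated_incl[OF S\<^sub>C] that unfolding C_def S\<^sub>C_def by blast
  have Cw: "C \<subseteq> monothetic w\<^sub>0" unfolding C_def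
    using Hw monothetic_subgroup[OF w\<^sub>0] closedin_topologically_generated
    by (intro topologically_generated_minimal) (auto simp: S\<^sub>C_def)
  have CH: "C \<subseteq> H" unfolding C_def
    using commutator_normal(1)[OF Hn] Hc H.is_subgroup
    by (intro topologically_generated_minimal) (auto simp: S\<^sub>C_def)
  obtain M where M: "open_normal M" "M \<subseteq> H" and
    Mw: "\<And>g h x y. g \<in> carrier G \<Longrightarrow> h \<in> carrier G \<Longrightarrow> x \<in> M \<Longrightarrow> y \<in> M \<Longrightarrow>
      \<exists>w\<in>carrier G. commutator G g x \<in> monothetic_mod C w \<and> commutator G h y \<in> monothetic_mod C w"
    using commutators_monothetic_mod[OF H C Cc HC] by blast
  have Mn: "M \<lhd> G" using M by (simp add: open_normal_def)
  interpret M: normal M G by fact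
  have carrier_normal: "carrier G \<lhd> G" using open_normal_carrier by (simp add: open_normal_def)
  define S where "S = {commutator G g x |g x. g \<in> carrier G \<and> x \<in> M} \<union> C"
  have S: "S \<subseteq> carrier G" using C.subset by (auto simp: S_def)
  define A where "A = topologically_generated G T S"
  have A: "A \<lhd> G" unfolding A_def
  proof (rule topologically_generated_normal[OF S])
    fix h g assume "h \<in> S" and g: "g \<in> carrier G"
    then consider "h \<in> {commutator G g x |g x. g \<in> carrier G \<and> x \<in> M}" | "h \<in> C"
      unfolding S_def by blast
    then show "g \<otimes> h \<otimes> inv g \<in> S"
    proof cases
      case 1 show ?thesis
        unfolding S_def using commutators_conj_closed[OF carrier_normal Mn 1 g] by (rule UnI1)
    next
      case 2 then show ?thesis unfolding S_def using C.inv_op_closed2[OF g] by blast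
    qed
  qed
  have Ac: "closedin T A" unfolding A_def by (rule closedin_topologically_generated)
  interpret A: normal A G by fact
  have SA: "S \<subseteq> A" unfolding A_def using S by (rule topologically_generated_incl)
  have CA: "C \<subseteq> A" using SA by (auto simp: S_def)
  have MA: "commutator G g x \<in> A" if "g \<in> carrier G" "x \<in> M" for g x
    using SA that unfolding S_def by blast
  have A_min: "A \<subseteq> B" if "subgroup B G" "closedin T B" "C \<subseteq> B"
    "\<And>g x. g \<in> carrier G \<Longrightarrow> x \<in> M \<Longrightarrow> commutator G g x \<in> B" for B
    unfolding A_def using that by (intro topologically_generated_minimal) (auto simp: S_def)
  have "A \<subseteq> H"
    using commutator_normal(2)[OF Mn] M(2) CH Hc H.is_subgroup by (intro A_min) auto
  \<comment> \<open>It suffices to check the generators of \<open>A\<close>: commutators centralize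
    the procyclic normal subgroup \<open>C\<close>, and \<open>C\<close> itself is abelian.\<close>
  have A_C: "a \<otimes> c = c \<otimes> a" if a: "a \<in> A" and c: "c \<in> C" for a c
  proof (rule commute_closure_of[OF Hausdorff S, of c a])
    fix s assume "s \<in> S"
    then consider g x where "g \<in> carrier G" "x \<in> M" "s = commutator G g x" | "s \<in> C"
      unfolding S_def by blast
    then show "s \<otimes> c = c \<otimes> s"
    proof cases
      case 1
      then show ?thesis
        using commutator_centralizes_procyclic[OF C Cc w\<^sub>0 Cw _ _ c, of g x] by simp
    next
      case 2
      then show ?thesis using monothetic_abelian[OF w\<^sub>0, of s c] Cw c by auto
    qed
  qed (use a c in \<open>simp_all add: A_def\<close>)
  have "\<exists>a\<in>A. S \<subseteq> monothetic_mod C a"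
  proof (rule pairwise_monothetic_mod[OF SA A.is_subgroup Ac C.subset])
    fix s t assume "s \<in> S" "t \<in> S"
    \<comment> \<open>An element of \<open>C\<close> is accompanied by arbitrary \<open>g\<close>
      and \<open>x\<close>, because \<open>C\<close> lies in every
      \<open>monothetic_mod C w\<close>.\<close>
    have "\<exists>g x. g \<in> carrier G \<and> x \<in> M \<and> (s = commutator G g x \<or> s \<in> C)" if "s \<in> S" for s
      using that M.one_closed unfolding S_def by blast
    then obtain g x h y where *: "g \<in> carrier G" "x \<in> M" "s = commutator G g x \<or> s \<in> C"
      "h \<in> carrier G" "y \<in> M" "t = commutator G h y \<or> t \<in> C"
      using \<open>s \<in> S\<close> \<open>t \<in> S\<close> by metis
    obtain w where w: "w \<in> carrier G" "commutator G g x \<in> monothetic_mod C w"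
      "commutator G h y \<in> monothetic_mod C w"
      using Mw[OF *(1,4,2,5)] by blast
    have "C \<subseteq> monothetic_mod C w" using monothetic_mod_kernel[OF C.subset w(1)] .
    then show "\<exists>w\<in>carrier G. s \<in> monothetic_mod C w \<and> t \<in> monothetic_mod C w"
      using w * by (intro bexI[of _ w]) auto
  qed
  then obtain a\<^sub>0 where a\<^sub>0: "a\<^sub>0 \<in> A" "S \<subseteq> monothetic_mod C a\<^sub>0" by auto
  have a\<^sub>0G: "a\<^sub>0 \<in> carrier G" using a\<^sub>0 by simp
  have A_mod: "A \<subseteq> monothetic_mod C a\<^sub>0"
    unfolding A_def using a\<^sub>0(2) monothetic_mod_subgroup[OF a\<^sub>0G] closedin_monothetic_mod
    by (rule topologically_generated_minimal)
  have A_dec: "\<exists>c\<in>C. \<exists>j::int. K #> a = K #> (c \<otimes> a\<^sub>0 [^] j)" if "a \<in> A" "open_normal K" for a K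
    using monothetic_mod_decompose[OF C a\<^sub>0G _ that(2)] A_mod that(1) by blast
  \<comment> \<open>Modulo each \<open>K\<close> the elements of \<open>A\<close> have the form
    \<open>c \<otimes> a\<^sub>0 [^] i\<close> with \<open>c\<close> in \<open>C\<close>, and
    \<open>C\<close> is central in \<open>A\<close>.\<close>
  have comm: "x \<otimes> y = y \<otimes> x" if xy: "x \<in> A" "y \<in> A" for x y
  proof (subst eq_iff_open_normal)
    show "\<forall>K. open_normal K \<longrightarrow> K #> (x \<otimes> y) = K #> (y \<otimes> x)"
    proof (intro allI impI)
      fix K assume K: "open_normal K"
      interpret K: normal K G using K by (simp add: open_normal_def)
      obtain c i where c: "c \<in> C" "K #> x = K #> (c \<otimes> a\<^sub>0 [^] (i::int))"
        using A_dec[OF xy(1) K] by auto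
      obtain d j where d: "d \<in> C" "K #> y = K #> (d \<otimes> a\<^sub>0 [^] (j::int))"
        using A_dec[OF xy(2) K] by auto
      have pow: "a\<^sub>0 [^] (i::int) \<in> A" for i
        using a\<^sub>0 A.is_subgroup by (intro subgroup_int_pow_closed)
      have cd: "c \<in> carrier G" "d \<in> carrier G" using c d by auto
      have "(c \<otimes> a\<^sub>0 [^] i) \<otimes> (d \<otimes> a\<^sub>0 [^] j) = c \<otimes> (a\<^sub>0 [^] i \<otimes> d) \<otimes> a\<^sub>0 [^] j"
        using cd a\<^sub>0G by (simp add: m_assoc)
      also have "\<dots> = c \<otimes> (d \<otimes> a\<^sub>0 [^] i) \<otimes> a\<^sub>0 [^] j" using A_C[OF pow d(1)] by simp
      also have "\<dots> = (c \<otimes> d) \<otimes> (a\<^sub>0 [^] i \<otimes> a\<^sub>0 [^] j)" using cd a\<^sub>0G by (simp add: m_assoc)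
      also have "\<dots> = (d \<otimes> c) \<otimes> (a\<^sub>0 [^] j \<otimes> a\<^sub>0 [^] i)"
        using A_C[OF subsetD[OF CA c(1)] d(1)] a\<^sub>0G by (simp add: add.commute flip: int_pow_mult)
      also have "\<dots> = d \<otimes> (c \<otimes> a\<^sub>0 [^] j) \<otimes> a\<^sub>0 [^] i" using cd a\<^sub>0G by (simp add: m_assoc)
      also have "\<dots> = d \<otimes> (a\<^sub>0 [^] j \<otimes> c) \<otimes> a\<^sub>0 [^] i" using A_C[OF pow c(1)] by simp
      also have "\<dots> = (d \<otimes> a\<^sub>0 [^] j) \<otimes> (c \<otimes> a\<^sub>0 [^] i)" using cd a\<^sub>0G by (simp add: m_assoc)
      finally have eq: "(c \<otimes> a\<^sub>0 [^] i) \<otimes> (d \<otimes> a\<^sub>0 [^] j) = (d \<otimes> a\<^sub>0 [^] j) \<otimes> (c \<otimes> a\<^sub>0 [^] i)" .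
      have "K #> (x \<otimes> y) = K #> ((c \<otimes> a\<^sub>0 [^] i) \<otimes> (d \<otimes> a\<^sub>0 [^] j))"
        using c d xy cd a\<^sub>0G by (intro K.rcoset_mult_cong) simp_all
      also have "\<dots> = K #> (y \<otimes> x)"
        unfolding eq using c d xy cd a\<^sub>0G by (intro K.rcoset_mult_cong[symmetric]) simp_all
      finally show "K #> (x \<otimes> y) = K #> (y \<otimes> x)" .
    qed
  qed (use xy in auto)
  obtain K w where K: "open_normal K" and w: "w \<in> carrier G"
    and P1: "\<And>g x. g \<in> carrier G \<Longrightarrow> x \<in> A \<inter> K \<Longrightarrow> commutator G g x \<in> monothetic w"
    and P2: "\<And>x y. x \<in> H \<inter> K \<Longrightarrow> y \<in> H \<inter> K \<Longrightarrow> commutator G x y \<in> monothetic w"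
    using commutators_monothetic_abelian[OF H C Cc w\<^sub>0 Cw HC A Ac \<open>A \<subseteq> H\<close> comm] by blast
  define P where "P = monothetic w"
  have P: "subgroup P G" unfolding P_def using w by (rule monothetic_subgroup)
  have Pc: "closedin T P" unfolding P_def by (rule closedin_topologically_generated)
  interpret P: subgroup P G by fact
  \<comment> \<open>Two exponents: \<open>n\<close> moves arguments into \<open>K\<close>, where
    commutators are known to be in \<open>P\<close>, and \<open>r\<close> moves them into
    \<open>M\<close>, hence into \<open>H\<close>, where commutators are in
    \<open>C\<close>.\<close>
  obtain n where n: "0 < n" "\<And>x. x \<in> carrier G \<Longrightarrow> x [^] (n::nat) \<in> K"
    using open_normal_exponent[OF K] by blast
  obtain r where r: "0 < r" "\<And>x. x \<in> carrier G \<Longrightarrow> x [^] (r::nat) \<in> M"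
    using open_normal_exponent[OF M(1)] by blast
  have pow_A: "a [^] (k::nat) \<in> A" if "a \<in> A" for a k
    using that A.is_subgroup by (intro subgroup_nat_pow)
  have P3: "commutator G g (a [^] n) \<in> P" if "g \<in> carrier G" "a \<in> A" for g a
    unfolding P_def using that n(2) pow_A by (intro P1) auto

  \<comment> \<open>For \<open>s = [h, k]\<close> and \<open>h' = h [^] n\<close>, bilinearity
    modulo \<open>P\<close> relates \<open>[h', k] [^] n\<close> to \<open>s [^] (n * n)\<close> in
    the left argument. In the right one it relates the \<open>n\<close>-th power of
    \<open>[h', k [^] n]\<close>, which lies in \<open>P\<close> since both entries are in
    \<open>H \<inter> K\<close>, to \<open>[h', k] [^] (n * n)\<close>. Combining the two gives the
    exponent \<open>n * n * n\<close>.\<close>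
  have C_pow: "C \<subseteq> {a \<in> A. a [^] (n * n * n) \<in> P}" unfolding C_def
  proof (rule topologically_generated_minimal)
    show "subgroup {a \<in> A. a [^] (n * n * n) \<in> P} G"
      by (rule power_preimage_subgroup[OF A.is_subgroup comm P])
    show "closedin T {a \<in> A. a [^] (n * n * n) \<in> P}"
      by (rule closedin_power_preimage[OF Ac Pc])
    show "S\<^sub>C \<subseteq> {a \<in> A. a [^] (n * n * n) \<in> P}"
    proof
      fix s assume "s \<in> S\<^sub>C"
      then obtain h k where hk: "h \<in> H" "k \<in> H" "s = commutator G h k" unfolding S\<^sub>C_def by blast
      have hkG: "h \<in> carrier G" "k \<in> carrier G" using hk by auto
      have powH: "x [^] (i::nat) \<in> H" if "x \<in> H" for x i
        using that H.is_subgroup by (intro subgroup_nat_pow)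
      have inA: "commutator G (x [^] (i::nat)) y \<in> A" if "x \<in> H" "y \<in> H" for x y i
        using HC[OF powH[OF that(1)] that(2)] CA by blast
      define h' where "h' = h [^] n"
      have h': "h' \<in> H" "h' \<in> carrier G" using powH[OF hk(1)] hkG by (auto simp: h'_def)
      obtain p where p: "p \<in> P" "commutator G h' k [^] n = p \<otimes> s [^] (n * n)"
        using commutator_pow_left_mod[OF A comm P P3 hkG inA[OF hk(1,2)], of n] hk(3)
        unfolding h'_def by blast
      obtain q where q: "q \<in> P" "commutator G (k [^] n) h' [^] n = q \<otimes> commutator G k h' [^] (n * n)"
        using commutator_pow_left_mod[OF A comm P P3 hkG(2) h'(2) inA[OF hk(2) h'(1)], of n] by blast
      have "commutator G (k [^] n) h' \<in> P"
        unfolding P_def using powH hk n(2) hkG h'(1) by (intro P2) (auto simp: h'_def)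
      then have "q \<otimes> commutator G k h' [^] (n * n) \<in> P"
        using subgroup_nat_pow[OF P, of _ n] q(2) by metis
      then have "commutator G k h' [^] (n * n) \<in> P"
        using subgroup_mult_cancel(2)[OF P _ q(1)] hkG h' by simp
      then have "inv (commutator G k h' [^] (n * n)) \<in> P" by simp
      then have "commutator G h' k [^] (n * n) \<in> P"
        using commutator_inv[of k h'] hkG h' by (simp add: nat_pow_inv)
      then have "(p \<otimes> s [^] (n * n)) [^] n \<in> P"
        using p(2) hkG h' by (simp flip: p(2) add: nat_pow_pow)
      moreover have "s \<in> A" using inA[OF hk(1,2), of 1] hkG hk(3) by simp
      moreover have "p \<in> A"
      proof -
        have "p \<otimes> s [^] (n * n) \<in> A" 
          using pow_A[OF inA[OF hk(1,2), of n], of n] unfolding h'_def[symmetric] p(2) .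
        then show ?thesis
          using subgroup_mult_cancel(1)[OF A.is_subgroup _ pow_A[OF \<open>s \<in> A\<close>]] p(1) by simp
      qed
      ultimately have "p [^] n \<otimes> s [^] (n * n * n) \<in> P"
        by (simp add: pow_mult_distrib[OF comm[OF \<open>p \<in> A\<close> pow_A[OF \<open>s \<in> A\<close>]]] nat_pow_pow)
      then have "s [^] (n * n * n) \<in> P"
        using subgroup_mult_cancel(2)[OF P _ subgroup_nat_pow[OF P p(1)]] \<open>s \<in> A\<close> by simp
      then show "s \<in> {a \<in> A. a [^] (n * n * n) \<in> P}" using \<open>s \<in> A\<close> by simp
    qed
  qed

  \<comment> \<open>\<open>G\<close> acts trivially on \<open>A\<close> modulo \<open>D\<close>, so
    \<open>g \<mapsto> [g, x]\<close> becomes multiplicative modulo \<open>D\<close> for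
    \<open>x\<close> in \<open>M\<close>. The abstract group suffices, as \<open>D\<close> only
    serves for congruences.\<close>
  define S\<^sub>D where "S\<^sub>D = {commutator G g a |g a. g \<in> carrier G \<and> a \<in> A} \<union> C"
  define D where "D = generate G S\<^sub>D"
  have S\<^sub>D: "S\<^sub>D \<subseteq> carrier G" using C.subset by (auto simp: S\<^sub>D_def)
  have D: "D \<lhd> G" unfolding D_def
  proof (rule normal_generateI[OF S\<^sub>D])
    fix h g assume "h \<in> S\<^sub>D" and g: "g \<in> carrier G"
    then consider "h \<in> {commutator G g a |g a. g \<in> carrier G \<and> a \<in> A}" | "h \<in> C"
      unfolding S\<^sub>D_def by blast
    then show "g \<otimes> h \<otimes> inv g \<in> S\<^sub>D"
    proof cases
      case 1 show ?thesis
        unfolding S\<^sub>D_def using commutators_conj_closed[OF carrier_normal A 1 g] by (rule UnI1)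
    next
      case 2 then show ?thesis unfolding S\<^sub>D_def using C.inv_op_closed2[OF g] by blast
    qed
  qed
  interpret D: normal D G by fact
  have D_pow: "D \<subseteq> {a \<in> A. a [^] (n * n * n) \<in> P}" unfolding D_def
  proof (rule generate_subgroup_incl)
    show "subgroup {a \<in> A. a [^] (n * n * n) \<in> P} G"
      by (rule power_preimage_subgroup[OF A.is_subgroup comm P])
    have "commutator G g a [^] (n * n * n) \<in> P \<and> commutator G g a \<in> A"
      if "g \<in> carrier G" "a \<in> A" for g a
    proof -
      have c: "commutator G g a \<in> A" using commutator_normal(2)[OF A that(2,1)] .
      have "commutator G g a [^] n \<in> P"
        using P3[OF that] commutator_pow_right[OF A comm that, of n] by simp
      then have "(commutator G g a [^] n) [^] (n * n) \<in> P" by (rule subgroup_nat_pow[OF P])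
      then show ?thesis using c by (simp add: nat_pow_pow mult.assoc)
    qed
    then show "S\<^sub>D \<subseteq> {a \<in> A. a [^] (n * n * n) \<in> P}" using C_pow unfolding S\<^sub>D_def by blast
  qed
  have D_comm: "commutator G a g \<in> D" if "a \<in> A" "g \<in> carrier G" for a g
  proof -
    have "commutator G g a \<in> D" unfolding D_def
      using that by (intro generate.incl) (auto simp: S\<^sub>D_def)
    then show ?thesis using commutator_inv[of g a] that by simp
  qed
  have CD: "C \<subseteq> D" unfolding D_def S\<^sub>D_def by (auto intro: generate.incl)

  \<comment> \<open>The factor \<open>r\<close> carries \<open>[g, x]\<close> into \<open>D\<close>,
    since \<open>[g [^] r, x]\<close> is a commutator of two elements of \<open>H\<close>; the
    factor \<open>n * n * n\<close> then carries \<open>D\<close> into \<open>P\<close>.\<close>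
  define N where "N = r * (n * n * n)"
  have A_pow: "A \<subseteq> {a \<in> A. a [^] N \<in> P}"
  proof (rule A_min)
    show "subgroup {a \<in> A. a [^] N \<in> P} G"
      by (rule power_preimage_subgroup[OF A.is_subgroup comm P])
    show "closedin T {a \<in> A. a [^] N \<in> P}"
      by (rule closedin_power_preimage[OF Ac Pc])
    have N: "a [^] N \<in> P" if "a \<in> A" "a [^] r \<in> D" for a
    proof -
      have "(a [^] r) [^] (n * n * n) \<in> P" using that D_pow by blast
      then show ?thesis using that by (simp add: nat_pow_pow N_def)
    qed
    show "C \<subseteq> {a \<in> A. a [^] N \<in> P}"
    proof
      fix c assume c: "c \<in> C"
      then have "c [^] r \<in> D" using CD D.is_subgroup by (intro subgroup_nat_pow) auto
      then show "c \<in> {a \<in> A. a [^] N \<in> P}" using c CA N by auto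
    qed
    fix g x assume g: "g \<in> carrier G" and x: "x \<in> M"
    have xG: "x \<in> carrier G" using x by simp
    have "D #> commutator G (g [^] i) x = D #> commutator G g x [^] (i::nat)" for i
    proof (induction i)
      case 0
      show ?case using xG by (simp add: commutator_def)
    next
      case (Suc i)
      have c: "commutator G (g [^] i) x \<in> A" using g x by (intro MA) auto
      have "commutator G (g [^] Suc i) x = commutator G (g [^] i) x \<otimes>
          commutator G (commutator G (g [^] i) x) g \<otimes> commutator G g x"
        using commutator_mult_left[of "g [^] i" g x] g xG by simp
      also have "D #> \<dots> = D #> (commutator G g x [^] i \<otimes> \<one> \<otimes> commutator G g x)"
        using g xG D.rcoset_mem_iff[of "commutator G (commutator G (g [^] i) x) g"]
          D_comm[OF c g] Suc
        by (intro D.rcoset_mult_cong) simp_all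
      finally show ?case using g xG by simp
    qed
    moreover have "commutator G (g [^] r) x \<in> D"
      using HC[of "g [^] r" x] r(2)[OF g] M(2) x CD by blast
    ultimately have "D #> commutator G g x [^] r = D #> \<one>"
      using D.rcoset_mem_iff[of "commutator G (g [^] r) x"] g xG by simp
    then have "commutator G g x [^] r \<in> D"
      using D.rcoset_mem_iff[of "commutator G g x [^] r"] g xG by simp
    then show "commutator G g x \<in> {a \<in> A. a [^] N \<in> P}" using N MA[OF g x] by simp
  qed

  have N0: "0 < N" using n(1) r(1) by (simp add: N_def)
  obtain v where v: "v \<in> C" "C = monothetic v"
    using closed_subgroup_monothetic[OF C.is_subgroup Cc w\<^sub>0 Cw] by auto
  have vG: "v \<in> carrier G" using v by simp
  \<comment> \<open>\<open>Q p\<close> is the coset of the group of \<open>N\<close>-th powers of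
    \<open>A\<close> represented by the powers of \<open>v\<close> and \<open>a\<^sub>0\<close> with
    exponents \<open>p\<close>. Exponents may be reduced modulo \<open>N\<close>, so finitely many
    of these closed sets cover \<open>A\<close>.\<close>
  define Q where "Q p = (\<lambda>a. v [^] (fst p) \<otimes> a\<^sub>0 [^] (snd p) \<otimes> a [^] N) ` A" for p :: "int \<times> int"
  have Q_cont: "continuous_map T T (\<lambda>a. v [^] (fst p) \<otimes> a\<^sub>0 [^] (snd p) \<otimes> a [^] N)" for p :: "int \<times> int"
    using vG a\<^sub>0G by (intro continuous_group_intros) auto
  have Q_closed: "closedin T (Q p)" for p
    unfolding Q_def using Q_cont Ac by (rule closedin_image)
  define I where "I = {0..<int N} \<times> {0..<int N}"
  have I: "finite I" by (simp add: I_def)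
  have A_Q: "A \<subseteq> (\<Union>p\<in>I. Q p)"
  proof
    fix a assume a: "a \<in> A"
    have Uc: "closedin T (\<Union>p\<in>I. Q p)" using I Q_closed by (intro closedin_Union) auto
    have "\<exists>y\<in>(\<Union>p\<in>I. Q p). K #> a = K #> y" if K: "open_normal K" for K
    proof -
      interpret K: normal K G using K by (simp add: open_normal_def)
      obtain c j where c: "c \<in> C" "K #> a = K #> (c \<otimes> a\<^sub>0 [^] (j::int))"
        using A_dec[OF a K] by auto
      have cG: "c \<in> carrier G" using c by simp
      obtain i where i: "K #> c = K #> v [^] (i::int)"
        using monothetic_mem_iff[OF vG cG] c(1) v(2) K by blast
      define p where "p = (i mod int N, j mod int N)"
      define b where "b = v [^] (i div int N) \<otimes> a\<^sub>0 [^] (j div int N)"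
      have vA: "v [^] (i::int) \<in> A" for i
        using v(1) CA A.is_subgroup by (intro subgroup_int_pow_closed) auto
      have a0A: "a\<^sub>0 [^] (i::int) \<in> A" for i
        using a\<^sub>0(1) A.is_subgroup by (intro subgroup_int_pow_closed) auto
      have b: "b \<in> A" using vA a0A by (simp add: b_def)
      have bN: "b [^] N = v [^] (i div int N * int N) \<otimes> a\<^sub>0 [^] (j div int N * int N)"
        using vG a\<^sub>0G int_pow_mult_distrib[OF comm[OF vA a0A], of _ _ "int N"]
        by (simp add: b_def int_pow_pow flip: int_pow_int)
      have "v [^] i \<otimes> a\<^sub>0 [^] j = (v [^] (i mod int N) \<otimes> v [^] (i div int N * int N)) \<otimes>
          (a\<^sub>0 [^] (j mod int N) \<otimes> a\<^sub>0 [^] (j div int N * int N))"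
        using vG a\<^sub>0G by (simp flip: int_pow_mult)
      also have "\<dots> = v [^] (i mod int N) \<otimes> (v [^] (i div int N * int N) \<otimes> a\<^sub>0 [^] (j mod int N))
          \<otimes> a\<^sub>0 [^] (j div int N * int N)"
        using vG a\<^sub>0G by (simp add: m_assoc)
      also have "\<dots> = v [^] (i mod int N) \<otimes> (a\<^sub>0 [^] (j mod int N) \<otimes> v [^] (i div int N * int N))
          \<otimes> a\<^sub>0 [^] (j div int N * int N)"
        using comm[OF vA a0A] by simp
      also have "\<dots> = v [^] fst p \<otimes> a\<^sub>0 [^] snd p \<otimes> b [^] N"
        using vG a\<^sub>0G by (simp add: bN p_def m_assoc)
      finally have "v [^] i \<otimes> a\<^sub>0 [^] j \<in> Q p" using b unfolding Q_def by blast
      moreover have "p \<in> I" using N0 by (simp add: p_def I_def)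
      moreover have "K #> a = K #> (v [^] i \<otimes> a\<^sub>0 [^] j)"
        unfolding c(2) using i cG vG a\<^sub>0G by (intro K.rcoset_mult_cong) auto
      ultimately show ?thesis by blast
    qed
    then show "a \<in> (\<Union>p\<in>I. Q p)" using closedin_mem_iff[OF Uc, of a] a by simp
  qed
  \<comment> \<open>The cosets not contained in \<open>P\<close> form a closed set without
    \<open>\<one>\<close>, so some open normal \<open>L\<close> is disjoint from it, and then
    \<open>A \<inter> L\<close> is contained in \<open>P\<close>.\<close>
  define J where "J = {p \<in> I. v [^] (fst p) \<otimes> a\<^sub>0 [^] (snd p) \<notin> P}"
  have aN: "a [^] N \<in> P" if "a \<in> A" for a using that A_pow by blast
  have Q_P: "y \<in> P \<longleftrightarrow> p \<notin> J" if p: "p \<in> I" and y: "y \<in> Q p" for p y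
    using subgroup_mult_cancel(1)[OF P _ aN] p y vG a\<^sub>0G by (auto simp: Q_def J_def)
  have J_closed: "closedin T (\<Union>p\<in>J. Q p)" using I Q_closed by (intro closedin_Union) (auto simp: J_def)
  have J_one: "\<one> \<notin> (\<Union>p\<in>J. Q p)" using Q_P[of _ \<one>] by (auto simp: J_def)
  from open_normal_separates[OF J_closed one_closed J_one]
  obtain L where L: "open_normal L" "\<And>y. y \<in> (\<Union>p\<in>J. Q p) \<Longrightarrow> L #> y \<noteq> L #> \<one>"
    by blast
  interpret L: normal L G using L by (simp add: open_normal_def)
  have AL: "y \<in> P" if y: "y \<in> A" "y \<in> L" for y
  proof -
    obtain p where p: "p \<in> I" "y \<in> Q p" using A_Q y by blast
    have "L #> y = L #> \<one>" using y by (simp add: L.rcoset_mem_iff del: coset_mult_one)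
    then have "p \<notin> J" using L(2) p by blast
    then show ?thesis using Q_P[OF p] by simp
  qed
  have "commutator G g x \<in> monothetic w" if "g \<in> carrier G" "x \<in> M \<inter> L" for g x
    using AL[OF MA] commutator_normal(2)[OF L.normal_axioms] that unfolding P_def by auto
  then show ?thesis using open_normal_Int[OF M(1) L(1)] w by blast
qed

section \<open>Schur's theorem\<close>

definition (in group) list_prod :: "'a list \<Rightarrow> 'a" where
  "list_prod xs = foldr (\<otimes>) xs \<one>"

context group
begin

lemma list_prod_simps [simp]: "list_prod [] = \<one>" "list_prod (x # xs) = x \<otimes> list_prod xs"
  by (simp_all add: list_prod_def)

lemma list_prod_closed [simp]: "set xs \<subseteq> carrier G \<Longrightarrow> list_prod xs \<in> carrier G"
  by (induction xs) auto

lemma list_prod_append: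
  "set xs \<subseteq> carrier G \<Longrightarrow> set ys \<subseteq> carrier G \<Longrightarrow>
    list_prod (xs @ ys) = list_prod xs \<otimes> list_prod ys"
  by (induction xs) (auto simp: m_assoc)

lemma list_prod_replicate:
  assumes "x \<in> carrier G"
  shows "list_prod (replicate n x) = x [^] n"
proof (induction n)
  case (Suc n)
  then show ?case using assms by (simp flip: nat_pow_Suc2)
qed simp

text \<open>A letter \<open>a\<close> in front of \<open>x [^] k\<close> can be moved behind it at
  the price of being conjugated, which keeps it in \<open>S\<close>; the length of the word does not
  change.\<close>

lemma list_prod_collect:
  assumes S: "S \<subseteq> carrier G"
    and conj: "\<And>x y. x \<in> S \<Longrightarrow> y \<in> S \<Longrightarrow> inv y \<otimes> x \<otimes> y \<in> S" and x: "x \<in> S"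
  shows "set xs \<subseteq> S \<Longrightarrow> k \<le> count_list xs x \<Longrightarrow>
    \<exists>ys. set ys \<subseteq> S \<and> length ys + k = length xs \<and> list_prod xs = x [^] k \<otimes> list_prod ys"
proof (induction xs arbitrary: k)
  case Nil
  then show ?case by (intro exI[of _ "[]"]) auto
next
  case (Cons a xs)
  have xG: "x \<in> carrier G" and aS: "a \<in> S" and aG: "a \<in> carrier G" using Cons.prems x S by auto
  show ?case
  proof (cases "k = 0")
    case True
    have "set (a # xs) \<subseteq> carrier G" using Cons.prems S by auto
    then show ?thesis using True Cons.prems
      by (intro exI[of _ "a # xs"]) (auto simp: m_assoc simp del: list_prod_simps)
  next
    case k: False
    show ?thesis
    proof (cases "a = x")
      case True
      obtain k' where k': "k = Suc k'" using k by (cases k) auto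
      obtain ys where ys: "set ys \<subseteq> S" "length ys + k' = length xs"
        "list_prod xs = x [^] k' \<otimes> list_prod ys"
        using Cons.IH[of k'] Cons.prems True k' by auto
      have "x [^] Suc k' = x \<otimes> x [^] k'" using xG by (rule nat_pow_Suc2)
      then have "list_prod (a # xs) = x [^] k \<otimes> list_prod ys"
        using ys True xG S by (simp add: k' m_assoc del: nat_pow_Suc)
      then show ?thesis using ys k' by auto
    next
      case False
      obtain ys where ys: "set ys \<subseteq> S" "length ys + k = length xs"
        "list_prod xs = x [^] k \<otimes> list_prod ys"
        using Cons.IH[of k] Cons.prems False by auto
      have conj_pow: "inv (x [^] (i::nat)) \<otimes> a \<otimes> x [^] i \<in> S" for i
      proof (induction i)
        case 0 then show ?case using aS aG by simp
      next
        case (Suc i)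
        have "inv (x [^] Suc i) \<otimes> a \<otimes> x [^] Suc i = inv x \<otimes> (inv (x [^] i) \<otimes> a \<otimes> x [^] i) \<otimes> x"
          using xG aG by (simp add: group_word)
        then show ?case using conj[OF Suc x] by simp
      qed
      define b where "b = inv (x [^] k) \<otimes> a \<otimes> x [^] k"
      have b: "b \<in> S" "a \<otimes> x [^] k = x [^] k \<otimes> b"
        using conj_pow xG aG by (simp_all add: b_def group_word)
      have "list_prod (a # xs) = (a \<otimes> x [^] k) \<otimes> list_prod ys"
        using ys aG xG S by (simp add: m_assoc)
      also have "\<dots> = x [^] k \<otimes> list_prod (b # ys)"
        unfolding b(2) using ys b(1) xG S by (simp add: m_assoc subset_iff)
      finally show ?thesis using ys b by (intro exI[of _ "b # ys"]) auto
    qed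
  qed
qed

text \<open>A word longer than \<open>r * card S\<close> contains some letter more than
  \<open>r\<close> times. \<open>Suc r\<close> of these copies are collected in front and replaced
  by a word of at most \<open>r\<close> letters, which shortens the word. So words of bounded length
  suffice (an argument in the style of Dietzmann's lemma).\<close>

lemma finite_generate_of_short_powers:
  assumes fin: "finite S" and S: "S \<subseteq> carrier G"
    and conj: "\<And>x y. x \<in> S \<Longrightarrow> y \<in> S \<Longrightarrow> inv y \<otimes> x \<otimes> y \<in> S"
    and inverse: "\<And>x. x \<in> S \<Longrightarrow> inv x \<in> S"
    and short: "\<And>x. x \<in> S \<Longrightarrow>
      \<exists>xs. set xs \<subseteq> S \<and> length xs \<le> r \<and> list_prod xs = x [^] Suc r"
  shows "finite (generate G S)"
proof -
  have words: "\<exists>xs. set xs \<subseteq> S \<and> list_prod xs = x" if "x \<in> generate G S" for x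
    using that
  proof induction
    case one then show ?case by (intro exI[of _ "[]"]) auto
  next
    case (incl h) then show ?case using S by (intro exI[of _ "[h]"]) auto
  next
    case (inv h) then show ?case using S inverse by (intro exI[of _ "[inv h]"]) auto
  next
    case (eng h1 h2)
    then obtain xs ys where "set xs \<subseteq> S" "list_prod xs = h1" "set ys \<subseteq> S" "list_prod ys = h2"
      by auto
    then show ?case using S by (intro exI[of _ "xs @ ys"]) (auto simp: list_prod_append)
  qed
  have bounded: "\<exists>ys. set ys \<subseteq> S \<and> length ys \<le> r * card S \<and> list_prod ys = list_prod xs"
    if "set xs \<subseteq> S" for xs
    using that
  proof (induction "length xs" arbitrary: xs rule: less_induct)
    case less
    show ?case
    proof (cases "length xs \<le> r * card S")
      case True then show ?thesis using less.prems by blast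
    next
      case False
      have "\<exists>x\<in>set xs. r < count_list xs x"
      proof (rule ccontr)
        assume "\<not> ?thesis"
        then have "(\<Sum>x\<in>set xs. count_list xs x) \<le> (\<Sum>x\<in>set xs. r)"
          by (intro sum_mono) auto
        also have "\<dots> \<le> r * card S"
          using card_mono[OF fin less.prems] by (simp add: mult.commute)
        finally show False using False sum_count_set[of xs "set xs"] by simp
      qed
      then obtain x where x: "x \<in> S" "Suc r \<le> count_list xs x"
        using less.prems by auto
      obtain ys where ys: "set ys \<subseteq> S" "length ys + Suc r = length xs"
        "list_prod xs = x [^] Suc r \<otimes> list_prod ys"
        using list_prod_collect[OF S conj x(1) less.prems x(2)] by blast
      obtain zs where zs: "set zs \<subseteq> S" "length zs \<le> r" "list_prod zs = x [^] Suc r"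
        using short[OF x(1)] by blast
      have "length (zs @ ys) < length xs" "set (zs @ ys) \<subseteq> S" using ys zs by auto
      moreover have "list_prod (zs @ ys) = list_prod xs"
        using ys zs S by (subst list_prod_append) auto
      ultimately show ?thesis using less.hyps by metis
    qed
  qed
  have "generate G S \<subseteq> list_prod ` {xs. set xs \<subseteq> S \<and> length xs \<le> r * card S}"
  proof
    fix x assume "x \<in> generate G S"
    then obtain xs where xs: "set xs \<subseteq> S" "list_prod xs = x" using words by auto
    then obtain ys where "set ys \<subseteq> S" "length ys \<le> r * card S" "list_prod ys = x"
      using bounded[OF xs(1)] by auto
    then show "x \<in> list_prod ` {xs. set xs \<subseteq> S \<and> length xs \<le> r * card S}" by auto
  qed
  then show ?thesis using finite_lists_length_le[OF fin] finite_surj by blast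
qed

text \<open>Commutators depend only on the representatives in \<open>F\<close>, so there are
  finitely many. Their powers become short by the identity \<open>x [^] (r + 1) = [a, b\<^sup>2]
  (b\<^sup>-\<^sup>1 x b) [^] (r - 1)\<close> for \<open>x = [a, b]\<close>, obtained by moving the
  central element \<open>x [^] r\<close> past \<open>b\<close>.\<close>

lemma Schur:
  assumes Z: "Z \<subseteq> carrier G" and central: "\<And>z y. z \<in> Z \<Longrightarrow> y \<in> carrier G \<Longrightarrow> z \<otimes> y = y \<otimes> z"
    and F: "finite F" "F \<subseteq> carrier G" "\<And>x. x \<in> carrier G \<Longrightarrow> \<exists>f\<in>F. \<exists>z\<in>Z. x = f \<otimes> z"
    and r: "0 < r" "\<And>x. x \<in> carrier G \<Longrightarrow> x [^] (r::nat) \<in> Z"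
  shows "finite (generate G (commutators G))"
proof (rule finite_generate_of_short_powers[of _ r])
  have mem: "commutator G x y \<in> commutators G" if "x \<in> carrier G" "y \<in> carrier G" for x y
    using that by (auto simp: commutators_def)
  show S: "commutators G \<subseteq> carrier G" by (auto simp: commutators_def)
  have "commutator G (f \<otimes> z) (f' \<otimes> z') = commutator G f f'"
    if "f \<in> carrier G" "f' \<in> carrier G" "z \<in> Z" "z' \<in> Z" for f f' z z'
  proof -
    have zG: "z \<in> carrier G" "z' \<in> carrier G" using that Z by auto
    have one: "commutator G u y = \<one>" "commutator G y u = \<one>" if "u \<in> Z" "y \<in> carrier G" for u y
      using that Z central[of u y] commutator_eq_one_iff[of u y] commutator_eq_one_iff[of y u]
      by (simp_all add: subsetD)
    have "commutator G (f \<otimes> z) y = commutator G f y" if "y \<in> carrier G" for y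
      using commutator_mult_left[of f z y] one[of z] that \<open>f \<in> carrier G\<close> zG \<open>z \<in> Z\<close> by simp
    moreover have "commutator G f (f' \<otimes> z') = commutator G f f'"
    proof -
      have "inv z' \<otimes> commutator G f f' \<otimes> z' = inv z' \<otimes> (z' \<otimes> commutator G f f')"
        using central[of z' "commutator G f f'"] that zG by (simp add: m_assoc)
      then have "inv z' \<otimes> commutator G f f' \<otimes> z' = commutator G f f'"
        using that zG by (simp add: inv_mult_cancel)
      then show ?thesis
        using commutator_mult_right[of f f' z'] one[of z' f] that zG by simp
    qed
    ultimately show ?thesis using that zG by simp
  qed
  then have *: "commutator G (f \<otimes> z) (f' \<otimes> z') = commutator G f f'"
    if "f \<in> F" "f' \<in> F" "z \<in> Z" "z' \<in> Z" for f f' z z'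
    using that F(2) by blast
  have "commutators G \<subseteq> (\<lambda>(f, f'). commutator G f f') ` (F \<times> F)"
  proof
    fix c assume "c \<in> commutators G"
    then obtain x y where xy: "x \<in> carrier G" "y \<in> carrier G" "c = commutator G x y"
      unfolding commutators_def by blast
    obtain f z where f: "f \<in> F" "z \<in> Z" "x = f \<otimes> z" using F(3)[OF xy(1)] by blast
    obtain f' z' where f': "f' \<in> F" "z' \<in> Z" "y = f' \<otimes> z'" using F(3)[OF xy(2)] by blast
    have "c = commutator G f f'" using xy(3) f f' * by simp
    then show "c \<in> (\<lambda>(f, f'). commutator G f f') ` (F \<times> F)" using f f' by auto
  qed
  then show "finite (commutators G)" by (rule finite_subset) (simp add: F(1))
  show "inv y \<otimes> x \<otimes> y \<in> commutators G" if "x \<in> commutators G" "y \<in> commutators G" for x y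
  proof -
    have "y \<in> carrier G" using that S by auto
    then show ?thesis using that(1) mem by (auto simp: commutators_def commutator_conj)
  qed
  show "inv x \<in> commutators G" if "x \<in> commutators G" for x
    using that mem by (auto simp: commutators_def simp flip: commutator_inv)
  show "\<exists>xs. set xs \<subseteq> commutators G \<and> length xs \<le> r \<and> list_prod xs = x [^] Suc r"
    if x: "x \<in> commutators G" for x
  proof -
    obtain a b where ab: "a \<in> carrier G" "b \<in> carrier G" "x = commutator G a b"
      using x unfolding commutators_def by blast
    have xG: "x \<in> carrier G" using ab by simp
    obtain k where k: "r = Suc k" using r(1) by (cases r) auto
    define y where "y = inv b \<otimes> x \<otimes> b"
    have y: "y \<in> commutators G" "y \<in> carrier G"
      using ab by (auto simp: y_def commutator_conj intro!: mem)
    have yk: "y [^] k = inv b \<otimes> x [^] k \<otimes> b"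
      using conj_int_pow[OF xG ab(2), of "int k"] by (simp add: y_def int_pow_int)
    have "x [^] Suc r = x \<otimes> x [^] r" using xG by (rule nat_pow_Suc2)
    also have "\<dots> = inv a \<otimes> inv b \<otimes> a \<otimes> (b \<otimes> x [^] r)" using ab by (simp add: commutator_def m_assoc)
    also have "b \<otimes> x [^] r = x [^] r \<otimes> b" using central[OF r(2)[OF xG] ab(2)] by simp
    also have "x [^] r = x \<otimes> x [^] k" unfolding k using xG by (rule nat_pow_Suc2)
    also have "inv a \<otimes> inv b \<otimes> a \<otimes> (x \<otimes> x [^] k \<otimes> b) =
        inv a \<otimes> inv b \<otimes> a \<otimes> x \<otimes> b \<otimes> (inv b \<otimes> x [^] k \<otimes> b)"
      using ab xG by (simp add: group_word)
    also have "inv a \<otimes> inv b \<otimes> a \<otimes> x \<otimes> b = commutator G a (b \<otimes> b)"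
      using ab by (simp add: commutator_def group_word)
    also have "commutator G a (b \<otimes> b) \<otimes> (inv b \<otimes> x [^] k \<otimes> b) =
        list_prod (commutator G a (b \<otimes> b) # replicate k y)"
      using y(2) by (simp add: list_prod_replicate yk)
    finally have "x [^] Suc r = list_prod (commutator G a (b \<otimes> b) # replicate k y)" .
    moreover have "set (commutator G a (b \<otimes> b) # replicate k y) \<subseteq> commutators G"
      using y(1) mem ab by auto
    ultimately show ?thesis using k by (intro exI[of _ "commutator G a (b \<otimes> b) # replicate k y"]) simp
  qed
qed

end

section \<open>The commutator subgroup is finite-by-procyclic\<close>

context profinite_group
begin

lemma finite_separation:
  assumes "finite S" "S \<subseteq> carrier G"
  shows "\<exists>K. open_normal K \<and> inj_on (\<lambda>x. K #> x) S"
proof -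
  define D where "D = {p \<in> S \<times> S. fst p \<noteq> snd p}"
  have "finite D" using assms by (simp add: D_def)
  have "\<exists>K. open_normal K \<and> K #> fst p \<noteq> K #> snd p" if "p \<in> D" for p
  proof -
    have "fst p \<in> carrier G" "snd p \<in> carrier G" "fst p \<noteq> snd p"
      using that assms(2) by (auto simp: D_def)
    then show ?thesis using eq_iff_open_normal by metis
  qed
  then obtain K where K: "\<And>p. p \<in> D \<Longrightarrow> open_normal (K p)"
    "\<And>p. p \<in> D \<Longrightarrow> K p #> fst p \<noteq> K p #> snd p" by metis
  define L where "L = carrier G \<inter> (\<Inter>p\<in>D. K p)"
  have L: "open_normal L" unfolding L_def using \<open>finite D\<close> K(1) by (intro open_normal_INT)
  have "x = y" if "x \<in> S" "y \<in> S" "L #> x = L #> y" for x y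
  proof (rule ccontr)
    assume "x \<noteq> y"
    then have p: "(x, y) \<in> D" using that by (simp add: D_def)
    have "K (x, y) #> x = K (x, y) #> y"
      using L K(1)[OF p] p that assms(2)
      by (intro normal.rcoset_mono[of L G "K (x, y)"]) (auto simp: open_normal_def L_def)
    then show False using K(2)[OF p] by simp
  qed
  then show ?thesis using L by (auto simp: inj_on_def)
qed

text \<open>If there were \<open>r + 1\<close> roots, they would stay distinct in some finite
  quotient, where the image of \<open>monothetic w\<close> is cyclic and has at most
  \<open>r\<close> of them.\<close>

lemma finite_roots_monothetic:
  assumes w: "w \<in> carrier G" and r: "0 < (r::nat)"
  shows "finite {x \<in> monothetic w. x [^] r = \<one>}"
proof (rule ccontr)
  assume "infinite {x \<in> monothetic w. x [^] r = \<one>}"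
  then obtain S where S: "finite S" "card S = Suc r" "S \<subseteq> {x \<in> monothetic w. x [^] r = \<one>}"
    using infinite_arbitrarily_large by blast
  have SG: "S \<subseteq> carrier G" using S monothetic_carrier[OF w] by auto
  obtain K where K: "open_normal K" "inj_on (\<lambda>x. K #> x) S"
    using finite_separation[OF S(1) SG] by auto
  interpret normal K G using K by (simp add: open_normal_def)
  interpret Q: group "G Mod K" by (rule open_normal_Mod(1)[OF K(1)])
  have KwQ: "K #> w \<in> carrier (G Mod K)" using w by (simp add: carrier_FactGroup)
  have ord: "0 < Q.ord (K #> w)"
    using Q.ord_ge_1[OF open_normal_Mod(2)[OF K(1)] KwQ] by simp
  have "(\<lambda>x. K #> x) ` S \<subseteq> {u \<in> generate (G Mod K) {K #> w}. u [^]\<^bsub>G Mod K\<^esub> r = \<one>\<^bsub>G Mod K\<^esub>}"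
  proof
    fix u assume "u \<in> (\<lambda>x. K #> x) ` S"
    then obtain x where x: "x \<in> S" "u = K #> x" by auto
    then have xG: "x \<in> carrier G" and "x \<in> monothetic w" "x [^] r = \<one>" using S SG by auto
    then obtain j :: int where "K #> x = K #> w [^] j"
      using monothetic_mem_iff[OF w xG] K(1) by auto
    then have "u = (K #> w) [^]\<^bsub>G Mod K\<^esub> j" using x(2) w by (simp add: FactGroup_int_pow)
    then have "u \<in> generate (G Mod K) {K #> w}" unfolding Q.generate_pow[OF KwQ] by blast
    moreover have "u [^]\<^bsub>G Mod K\<^esub> r = \<one>\<^bsub>G Mod K\<^esub>"
      unfolding x(2) FactGroup_pow[OF xG] \<open>x [^] r = \<one>\<close> by (simp add: subset)
    ultimately show "u \<in> {u \<in> generate (G Mod K) {K #> w}. u [^]\<^bsub>G Mod K\<^esub> r = \<one>\<^bsub>G Mod K\<^esub>}"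
      by blast
  qed
  then have "card ((\<lambda>x. K #> x) ` S) \<le> r"
    using Q.card_roots_cyclic[OF KwQ ord r] card_mono order_trans by meson
  then show False using card_image[OF K(2)] S(2) by simp
qed

lemma closedin_rcoset:
  assumes "closedin T S" "x \<in> carrier G"
  shows "closedin T (S #> x)"
proof -
  have "closedin T ((\<lambda>s. s \<otimes> x) ` S)"
    using assms by (intro closedin_image continuous_group_intros) auto
  moreover have "(\<lambda>s. s \<otimes> x) ` S = S #> x" by (auto simp: r_coset_def)
  ultimately show ?thesis by simp
qed

text \<open>The procyclic quotient is expressed by \<open>monothetic x\<close>, so that no quotient
  topology enters. In the proof, \<open>x\<close> is a preimage of a generator of the image of the
  power map, and \<open>N\<close> is the kernel of that map.\<close>

lemma finite_by_procyclic_commutator_subgroup: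
  assumes M: "open_normal M" and w: "w \<in> carrier G"
    and Mw: "\<And>g x. g \<in> carrier G \<Longrightarrow> x \<in> M \<Longrightarrow> commutator G g x \<in> monothetic w"
  defines "K \<equiv> commutator_subgroup G T"
  shows "\<exists>N. N \<lhd> G\<lparr>carrier := K\<rparr> \<and> finite N \<and>
    (\<exists>x\<in>K. \<forall>k\<in>K. \<exists>y\<in>N. \<exists>z\<in>monothetic x. k = y \<otimes> z)"
proof -
  have Mn: "M \<lhd> G" using M by (simp add: open_normal_def)
  interpret M: normal M G by fact
  have carrier_normal: "carrier G \<lhd> G" using open_normal_carrier by (simp add: open_normal_def)
  have X: "commutators G \<subseteq> carrier G" by (auto simp: commutators_def)
  have K_def': "K = topologically_generated G T (commutators G)"
    by (simp add: K_def commutator_subgroup_def)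
  have K: "subgroup K G" unfolding K_def' using X by (rule topologically_generated_subgroup)
  have Kc: "closedin T K" unfolding K_def' by (rule closedin_topologically_generated)
  interpret K: subgroup K G by fact
  have XK: "commutators G \<subseteq> K" unfolding K_def' using X by (rule topologically_generated_incl)
  define S where "S = {commutator G g x |g x. g \<in> carrier G \<and> x \<in> M}"
  have S: "S \<subseteq> carrier G" by (auto simp: S_def)
  define E where "E = topologically_generated G T S"
  have E: "E \<lhd> G" unfolding E_def
    using S commutators_conj_closed[OF carrier_normal Mn]
    by (intro topologically_generated_normal) (auto simp only: S_def)
  have Ec: "closedin T E" unfolding E_def by (rule closedin_topologically_generated)
  interpret E: normal E G by fact
  have SE: "commutator G g x \<in> E" if "g \<in> carrier G" "x \<in> M" for g x
    using topologically_generated_incl[OF S] that unfolding E_def S_def by blast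
  have Ew: "E \<subseteq> monothetic w" unfolding E_def
    using Mw monothetic_subgroup[OF w] closedin_topologically_generated
    by (intro topologically_generated_minimal) (auto simp: S_def)
  have EK: "E \<subseteq> K" unfolding E_def
  proof (rule topologically_generated_minimal[OF _ K Kc])
    have "S \<subseteq> commutators G" unfolding S_def commutators_def using M.mem_carrier by blast
    then show "S \<subseteq> K" using XK by (rule order_trans)
  qed
  have E_central: "e \<otimes> k = k \<otimes> e" if e: "e \<in> E" and k: "k \<in> K" for e k
  proof -
    have "k \<otimes> e = e \<otimes> k"
    proof (rule commute_closure_of[OF Hausdorff X])
      show "s \<otimes> e = e \<otimes> s" if "s \<in> commutators G" for s
        using that commutator_centralizes_procyclic[OF E Ec w Ew _ _ e]
        by (auto simp: commutators_def)
    qed (use e k in \<open>simp_all add: K_def'\<close>)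
    then show ?thesis by simp
  qed

  interpret Q: group "G Mod E" by (rule E.factorgroup_is_group)
  interpret \<pi>: group_hom G "G Mod E" "\<lambda>x. E #> x"
    by unfold_locales (rule E.r_coset_hom_Mod)
  obtain F where F: "finite F" "F \<subseteq> carrier G" "\<And>x. x \<in> carrier G \<Longrightarrow> \<exists>f\<in>F. \<exists>m\<in>M. x = f \<otimes> m"
    using open_normal_transversal[OF M] by blast
  obtain r where r: "0 < r" "\<And>x. x \<in> carrier G \<Longrightarrow> x [^] (r::nat) \<in> M"
    using open_normal_exponent[OF M] by blast
  have \<pi>_comm: "commutator (G Mod E) (E #> x) (E #> y) = E #> commutator G x y"
    if "x \<in> carrier G" "y \<in> carrier G" for x y
    unfolding commutator_def using that
    by (simp only: \<pi>.hom_mult \<pi>.hom_inv inv_closed m_closed flip: \<pi>.hom_inv)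
  \<comment> \<open>Schur's theorem in \<open>G Mod E\<close>: the image of \<open>M\<close> is
    central there because \<open>[G, M]\<close> lies in \<open>E\<close>. The group generated by the
    commutators is here the abstract one.\<close>
  have "finite (generate (G Mod E) (commutators (G Mod E)))"
  proof (rule Q.Schur[of "(\<lambda>x. E #> x) ` M" "(\<lambda>x. E #> x) ` F" r])
    show "(\<lambda>x. E #> x) ` M \<subseteq> carrier (G Mod E)" "(\<lambda>x. E #> x) ` F \<subseteq> carrier (G Mod E)"
      using F(2) by (auto simp: carrier_FactGroup)
  next
    fix z y assume "z \<in> (\<lambda>x. E #> x) ` M" "y \<in> carrier (G Mod E)"
    then obtain m g where m: "m \<in> M" "g \<in> carrier G" "z = E #> m" "y = E #> g"
      by (auto simp: carrier_FactGroup)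
    have "commutator (G Mod E) y z = E #> commutator G g m"
      using m \<pi>_comm[of g m] by simp
    also have "\<dots> = \<one>\<^bsub>G Mod E\<^esub>"
      using E.rcoset_mem_iff[of "commutator G g m"] SE[OF m(2,1)] m by (simp add: E.subset)
    finally have "commutator (G Mod E) y z = \<one>\<^bsub>G Mod E\<^esub>" .
    moreover have "y \<in> carrier (G Mod E)" "z \<in> carrier (G Mod E)"
      using m by (auto simp: carrier_FactGroup)
    ultimately show "z \<otimes>\<^bsub>G Mod E\<^esub> y = y \<otimes>\<^bsub>G Mod E\<^esub> z"
      using Q.commutator_eq_one_iff[of y z] by simp
  next
    show "finite ((\<lambda>x. E #> x) ` F)" using F(1) by simp
  next
    fix x assume "x \<in> carrier (G Mod E)"
    then obtain g where g: "g \<in> carrier G" "x = E #> g" by (auto simp: carrier_FactGroup)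
    then obtain f m where fm: "f \<in> F" "m \<in> M" "g = f \<otimes> m" using F(3) by blast
    then have fG: "f \<in> carrier G" "m \<in> carrier G" using F(2) by auto
    have "x = (E #> f) \<otimes>\<^bsub>G Mod E\<^esub> (E #> m)"
      unfolding g(2) fm(3) mult_FactGroup E.rcos_sum[OF fG] ..
    then show "\<exists>f\<in>(\<lambda>x. E #> x) ` F. \<exists>z\<in>(\<lambda>x. E #> x) ` M. x = f \<otimes>\<^bsub>G Mod E\<^esub> z"
      using fm by blast
  next
    fix x assume "x \<in> carrier (G Mod E)"
    then obtain g where g: "g \<in> carrier G" "x = E #> g" by (auto simp: carrier_FactGroup)
    then show "x [^]\<^bsub>G Mod E\<^esub> r \<in> (\<lambda>x. E #> x) ` M" using r(2) by (simp add: E.FactGroup_pow)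
  qed (use r in auto)
  moreover have "(\<lambda>x. E #> x) ` commutators G \<subseteq> commutators (G Mod E)"
  proof
    fix u assume "u \<in> (\<lambda>x. E #> x) ` commutators G"
    then obtain x y where "x \<in> carrier G" "y \<in> carrier G" "u = E #> commutator G x y"
      unfolding commutators_def by blast
    then show "u \<in> commutators (G Mod E)"
      using \<pi>_comm[of x y] \<pi>.hom_closed unfolding commutators_def by force
  qed
  ultimately have "finite ((\<lambda>x. E #> x) ` generate G (commutators G))"
    using Q.mono_generate \<pi>.generate_img[OF X] by (metis finite_subset)
  then obtain F\<^sub>1 where F\<^sub>1: "finite F\<^sub>1" "F\<^sub>1 \<subseteq> generate G (commutators G)"
    "(\<lambda>x. E #> x) ` generate G (commutators G) = (\<lambda>x. E #> x) ` F\<^sub>1"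
    by (metis finite_subset_image order_refl)
  have gK: "generate G (commutators G) \<subseteq> K" using XK K by (rule generate_subgroup_incl)
  have F\<^sub>1K: "F\<^sub>1 \<subseteq> K" using F\<^sub>1(2) gK by auto
  have F\<^sub>1G: "F\<^sub>1 \<subseteq> carrier G" using F\<^sub>1K K.subset by auto
  \<comment> \<open>The right side is a finite union of closed cosets and contains the abstract
    commutator subgroup, hence also its closure \<open>K\<close>.\<close>
  have K_cover: "K \<subseteq> (\<Union>f\<in>F\<^sub>1. E #> f)" unfolding K_def' topologically_generated_def
  proof (rule closure_of_minimal)
    show "closedin T (\<Union>f\<in>F\<^sub>1. E #> f)"
      using F\<^sub>1(1) F\<^sub>1G Ec by (intro closedin_Union) (auto intro!: closedin_rcoset)
    show "generate G (commutators G) \<subseteq> (\<Union>f\<in>F\<^sub>1. E #> f)"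
    proof
      fix x assume x: "x \<in> generate G (commutators G)"
      then obtain f where f: "f \<in> F\<^sub>1" "E #> x = E #> f" using F\<^sub>1(3) by blast
      have "x \<in> E #> x" using x gK K.subset by (intro rcos_self E.is_subgroup) auto
      then show "x \<in> (\<Union>f\<in>F\<^sub>1. E #> f)" using f by auto
    qed
  qed
  \<comment> \<open>The finitely many cosets other than \<open>E\<close> form a closed set without
    \<open>\<one>\<close>, so \<open>E\<close> is open in \<open>K\<close>: some open normal
    \<open>L\<close> has \<open>L \<inter> K\<close> inside \<open>E\<close>.\<close>
  have U_closed: "closedin T (\<Union>f\<in>F\<^sub>1 - E. E #> f)"
    using F\<^sub>1(1) F\<^sub>1G Ec by (intro closedin_Union) (auto intro!: closedin_rcoset)
  have U_one: "\<one> \<notin> (\<Union>f\<in>F\<^sub>1 - E. E #> f)"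
  proof
    assume "\<one> \<in> (\<Union>f\<in>F\<^sub>1 - E. E #> f)"
    then obtain f e where f: "f \<in> F\<^sub>1" "f \<notin> E" "e \<in> E" "\<one> = e \<otimes> f" by (auto simp: r_coset_def)
    then have "e \<otimes> f \<in> E" using E.one_closed by simp
    then show False
      using subgroup_mult_cancel(2)[OF E.is_subgroup, of f e] f F\<^sub>1G by auto
  qed
  from open_normal_separates[OF U_closed one_closed U_one]
  obtain L where L: "open_normal L"
    "\<And>y. y \<in> (\<Union>f\<in>F\<^sub>1 - E. E #> f) \<Longrightarrow> L #> y \<noteq> L #> \<one>"
    by blast
  have LK: "x \<in> E" if x: "x \<in> L" "x \<in> K" for x
  proof -
    obtain f where f: "f \<in> F\<^sub>1" "x \<in> E #> f" using K_cover x by auto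
    have "L #> x = L #> \<one>"
      using L(1) x normal.rcoset_mem_iff[of L G x] unfolding open_normal_def by auto
    then have "f \<in> E" using L(2)[of x] f by auto
    then show ?thesis using f(2) by (auto simp: r_coset_def)
  qed
  obtain n where n: "0 < n" "\<And>x. x \<in> carrier G \<Longrightarrow> x [^] (n::nat) \<in> L"
    using open_normal_exponent[OF L(1)] by blast
  have pow_K: "x [^] (k::nat) \<in> K" if "x \<in> K" for x k
    using that K by (intro subgroup_nat_pow)
  have n_E: "x [^] n \<in> E" if "x \<in> K" for x
    using that n(2) pow_K by (intro LK) auto

  define H where "H = G\<lparr>carrier := K\<rparr>"
  interpret H: group H unfolding H_def using K by (rule subgroup_imp_group)
  have H_simps: "carrier H = K" "x \<otimes>\<^bsub>H\<^esub> y = x \<otimes> y" "\<one>\<^bsub>H\<^esub> = \<one>" "x [^]\<^bsub>H\<^esub> (k::nat) = x [^] k" for x y k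
    unfolding H_def by (simp_all flip: nat_pow_consistent)
  have H_comm: "commutator H x y = commutator G x y" if "x \<in> K" "y \<in> K" for x y
    using that K by (simp add: commutator_def H_def)
  define \<Delta> where "\<Delta> = generate H (commutators H)"
  \<comment> \<open>Schur's theorem a second time, now in \<open>K\<close>, where \<open>E\<close>
    is central and \<open>F\<^sub>1\<close> represents its cosets.\<close>
  have "finite \<Delta>" unfolding \<Delta>_def
  proof (rule H.Schur[of E F\<^sub>1 n])
    fix x assume x: "x \<in> carrier H"
    then obtain f e where f: "f \<in> F\<^sub>1" "e \<in> E" "x = e \<otimes> f"
      using K_cover by (auto simp: H_simps r_coset_def)
    then show "\<exists>f\<in>F\<^sub>1. \<exists>z\<in>E. x = f \<otimes>\<^bsub>H\<^esub> z"
      using E_central[of e f] F\<^sub>1K by (auto simp: H_simps)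
  qed (use EK E_central F\<^sub>1 F\<^sub>1K n n_E in \<open>auto simp: H_simps\<close>)
  have XH: "commutators H \<subseteq> carrier H" by (auto simp: commutators_def)
  have \<Delta>: "\<Delta> \<lhd> H" unfolding \<Delta>_def
  proof (rule H.normal_generateI[OF XH])
    fix h g assume "h \<in> commutators H" and g: "g \<in> carrier H"
    then obtain x y where "x \<in> carrier H" "y \<in> carrier H" "h = commutator H x y"
      unfolding commutators_def by blast
    then show "g \<otimes>\<^bsub>H\<^esub> h \<otimes>\<^bsub>H\<^esub> inv\<^bsub>H\<^esub> g \<in> commutators H"
      using g H.commutator_conj'[of x y g] unfolding commutators_def
      by (simp only: H.m_closed H.inv_closed) blast
  qed
  interpret \<Delta>: normal \<Delta> H by fact
  interpret R: group "H Mod \<Delta>" by (rule \<Delta>.factorgroup_is_group)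
  define s where "s = card \<Delta>"
  have s0: "0 < s" unfolding s_def using \<open>finite \<Delta>\<close> \<Delta>.one_closed card_gt_0_iff by blast
  have s: "d [^] s = \<one>" if d: "d \<in> \<Delta>" for d
  proof -
    interpret D: group "H\<lparr>carrier := \<Delta>\<rparr>" by (rule H.subgroup_imp_group[OF \<Delta>.is_subgroup])
    have "d [^]\<^bsub>H\<lparr>carrier := \<Delta>\<rparr>\<^esub> order (H\<lparr>carrier := \<Delta>\<rparr>) = \<one>\<^bsub>H\<lparr>carrier := \<Delta>\<rparr>\<^esub>"
      using d by (intro D.pow_order_eq_1) auto
    then show ?thesis
      using H.nat_pow_consistent[of d s \<Delta>] by (simp add: order_def s_def H_simps)
  qed
  have hom_mod: "\<exists>d\<in>\<Delta>. (x \<otimes> y) [^] n = d \<otimes> (x [^] n \<otimes> y [^] n)" if xy: "x \<in> K" "y \<in> K" for x y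
  proof -
    have xyH: "x \<in> carrier H" "y \<in> carrier H" using xy by (simp_all add: H_simps)
    have X: "\<Delta> #>\<^bsub>H\<^esub> x \<in> carrier (H Mod \<Delta>)" "\<Delta> #>\<^bsub>H\<^esub> y \<in> carrier (H Mod \<Delta>)"
      using xyH by (auto simp: carrier_FactGroup)
    have "commutator H x y \<in> \<Delta>" unfolding \<Delta>_def
      using xyH by (intro generate.incl) (auto simp: commutators_def)
    moreover have "x \<otimes>\<^bsub>H\<^esub> y = y \<otimes>\<^bsub>H\<^esub> x \<otimes>\<^bsub>H\<^esub> commutator H x y"
      using xyH by (simp add: commutator_def H.group_word)
    ultimately have "\<Delta> #>\<^bsub>H\<^esub> (x \<otimes>\<^bsub>H\<^esub> y) = \<Delta> #>\<^bsub>H\<^esub> (y \<otimes>\<^bsub>H\<^esub> x \<otimes>\<^bsub>H\<^esub> \<one>\<^bsub>H\<^esub>)"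
      using xyH \<Delta>.rcoset_mem_iff[of "commutator H x y"]
      by (simp only:) (intro \<Delta>.rcoset_mult_cong, simp_all)
    then have c: "(\<Delta> #>\<^bsub>H\<^esub> x) \<otimes>\<^bsub>H Mod \<Delta>\<^esub> (\<Delta> #>\<^bsub>H\<^esub> y) = (\<Delta> #>\<^bsub>H\<^esub> y) \<otimes>\<^bsub>H Mod \<Delta>\<^esub> (\<Delta> #>\<^bsub>H\<^esub> x)"
      using xyH by (simp add: \<Delta>.rcos_sum)
    have "\<Delta> #>\<^bsub>H\<^esub> ((x \<otimes>\<^bsub>H\<^esub> y) [^]\<^bsub>H\<^esub> n) = \<Delta> #>\<^bsub>H\<^esub> (x [^]\<^bsub>H\<^esub> n \<otimes>\<^bsub>H\<^esub> y [^]\<^bsub>H\<^esub> n)"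
      using R.pow_mult_distrib[OF c X, of n] xyH
      by (simp add: \<Delta>.rcos_sum \<Delta>.FactGroup_pow)
    then have "(x \<otimes>\<^bsub>H\<^esub> y) [^]\<^bsub>H\<^esub> n \<otimes>\<^bsub>H\<^esub> inv\<^bsub>H\<^esub> (x [^]\<^bsub>H\<^esub> n \<otimes>\<^bsub>H\<^esub> y [^]\<^bsub>H\<^esub> n) \<in> \<Delta>"
      using xyH by (subst (asm) \<Delta>.rcoset_eq_iff) simp_all
    moreover have "(x \<otimes>\<^bsub>H\<^esub> y) [^]\<^bsub>H\<^esub> n =
      ((x \<otimes>\<^bsub>H\<^esub> y) [^]\<^bsub>H\<^esub> n \<otimes>\<^bsub>H\<^esub> inv\<^bsub>H\<^esub> (x [^]\<^bsub>H\<^esub> n \<otimes>\<^bsub>H\<^esub> y [^]\<^bsub>H\<^esub> n)) \<otimes>\<^bsub>H\<^esub> (x [^]\<^bsub>H\<^esub> n \<otimes>\<^bsub>H\<^esub> y [^]\<^bsub>H\<^esub> n)"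
      using xyH by (simp add: H.m_assoc)
    ultimately show ?thesis unfolding H_simps(2-4) by blast
  qed
  \<comment> \<open>The \<open>n\<close>-th power is multiplicative up to some \<open>d\<close> in
    \<open>\<Delta>\<close> and takes values in the central \<open>E\<close>, so \<open>d\<close>
    commutes with these values; the further exponent \<open>s = card \<Delta>\<close> kills
    \<open>d\<close>.\<close>
  define q where "q = n * s"
  have q0: "0 < q" using n(1) s0 by (simp add: q_def)
  have q_mult: "(x \<otimes> y) [^] q = x [^] q \<otimes> y [^] q" if xy: "x \<in> K" "y \<in> K" for x y
  proof -
    obtain d where d: "d \<in> \<Delta>" "(x \<otimes> y) [^] n = d \<otimes> (x [^] n \<otimes> y [^] n)"
      using hom_mod[OF xy] by blast
    have xyE: "x [^] n \<in> E" "y [^] n \<in> E" using n_E xy by auto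
    have dK: "d \<in> K" using d(1) \<Delta>.subset by (auto simp: H_simps)
    have "((x \<otimes> y) [^] n) [^] s = d [^] s \<otimes> (x [^] n \<otimes> y [^] n) [^] s"
      unfolding d(2) using E_central[of "x [^] n \<otimes> y [^] n" d] xyE dK
      by (intro pow_mult_distrib) auto
    also have "\<dots> = (x [^] n) [^] s \<otimes> (y [^] n) [^] s"
      using s[OF d(1)] xy
      by (simp add: pow_mult_distrib[OF E_central[OF xyE(1) subsetD[OF EK xyE(2)]]])
    finally show ?thesis using xy by (simp add: q_def nat_pow_pow)
  qed
  define N where "N = {x \<in> K. x [^] q = \<one>}"
  have N_H: "N \<lhd> H"
  proof (rule H.normal_invI)
    show "subgroup N H"
    proof
      show "N \<subseteq> carrier H" "\<one>\<^bsub>H\<^esub> \<in> N" by (auto simp: N_def H_simps)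
      show "x \<otimes>\<^bsub>H\<^esub> y \<in> N" if "x \<in> N" "y \<in> N" for x y
        using that q_mult by (auto simp: N_def H_simps)
      show "inv\<^bsub>H\<^esub> x \<in> N" if "x \<in> N" for x
        using that K by (auto simp: N_def H_def nat_pow_inv)
    qed
    show "x \<otimes>\<^bsub>H\<^esub> h \<otimes>\<^bsub>H\<^esub> inv\<^bsub>H\<^esub> x \<in> N" if "x \<in> carrier H" "h \<in> N" for x h
    proof -
      have xh: "x \<in> K" "h \<in> K" "h [^] q = \<one>" using that by (auto simp: N_def H_simps)
      have "(x \<otimes> h \<otimes> inv x) [^] q = x \<otimes> h [^] q \<otimes> inv x"
        using conj_int_pow[of h "inv x" "int q"] xh by (simp add: int_pow_int)
      then show ?thesis using xh K by (simp add: N_def H_def)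
    qed
  qed
  have "finite N"
  proof -
    have fE: "finite {x \<in> E. x [^] q = \<one>}"
      by (rule finite_subset[OF _ finite_roots_monothetic[OF w q0]]) (use Ew in auto)
    \<comment> \<open>Two elements of \<open>N\<close> in the same coset of \<open>E\<close> differ
      by a \<open>q\<close>-th root of \<open>\<one>\<close> in \<open>E\<close>, and a procyclic
      group contains only finitely many of these.\<close>
    have "finite (N \<inter> (E #> f))" if "f \<in> F\<^sub>1" for f
    proof (cases "N \<inter> (E #> f) = {}")
      case False
      then obtain x where x: "x \<in> N" "x \<in> E #> f" by auto
      have fK: "f \<in> K" using that F\<^sub>1K by auto
      have "N \<inter> (E #> f) \<subseteq> (\<lambda>e. e \<otimes> x) ` {x \<in> E. x [^] q = \<one>}"
      proof
        fix y assume y: "y \<in> N \<inter> (E #> f)"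
        have xy: "x \<in> K" "y \<in> K" "x [^] q = \<one>" "y [^] q = \<one>" using x y by (auto simp: N_def)
        have "E #> x = E #> f" "E #> y = E #> f"
          using x y fK E.is_subgroup repr_independence[of _ E f] by auto
        then have "y \<otimes> inv x \<in> E" using E.rcoset_eq_iff[of y x] xy by simp
        moreover have "(y \<otimes> inv x) [^] q = \<one>"
          using q_mult[of y "inv x"] xy by (simp add: nat_pow_inv)
        moreover have "y = (y \<otimes> inv x) \<otimes> x" using xy by (simp add: m_assoc)
        ultimately show "y \<in> (\<lambda>e. e \<otimes> x) ` {x \<in> E. x [^] q = \<one>}" by blast
      qed
      then show ?thesis by (rule finite_subset) (simp add: fE)
    qed auto
    then have "finite (\<Union>f\<in>F\<^sub>1. N \<inter> (E #> f))" using F\<^sub>1(1) by (intro finite_UN_I)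
    moreover have "N \<subseteq> (\<Union>f\<in>F\<^sub>1. N \<inter> (E #> f))" using K_cover by (auto simp: N_def)
    ultimately show ?thesis by (rule rev_finite_subset)
  qed
  define \<phi> where "\<phi> x = x [^] q" for x
  have \<phi>_cont: "continuous_map T T \<phi>"
    unfolding \<phi>_def by (intro continuous_group_intros)
  have \<phi>_sub: "subgroup (\<phi> ` B) G" if B: "subgroup B G" "B \<subseteq> K" for B
  proof -
    interpret B: subgroup B G by fact
    show ?thesis
    proof
      show "\<phi> ` B \<subseteq> carrier G" by (auto simp: \<phi>_def)
      show "\<one> \<in> \<phi> ` B" 
        by (rule image_eqI[of _ _ \<one>]) (simp_all add: \<phi>_def)
    next
      fix u v assume "u \<in> \<phi> ` B" "v \<in> \<phi> ` B"
      then obtain x y where xy: "x \<in> B" "y \<in> B" "u = \<phi> x" "v = \<phi> y" by auto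
      have "u \<otimes> v = \<phi> (x \<otimes> y)"
        unfolding xy(3,4) \<phi>_def using q_mult[OF subsetD[OF B(2) xy(1)] subsetD[OF B(2) xy(2)]]
        by (rule sym)
      then show "u \<otimes> v \<in> \<phi> ` B" using xy(1,2) by auto
    next
      fix u assume "u \<in> \<phi> ` B"
      then obtain x where x: "x \<in> B" "u = \<phi> x" by auto
      have "inv u = \<phi> (inv x)" unfolding x(2) \<phi>_def using nat_pow_inv[of x q] x(1) by simp
      then show "inv u \<in> \<phi> ` B" using x(1) by auto
    qed
  qed
  have "\<phi> ` K \<subseteq> monothetic w"
  proof
    fix u assume "u \<in> \<phi> ` K"
    then obtain x where x: "x \<in> K" "u = (x [^] n) [^] s" by (auto simp: \<phi>_def q_def nat_pow_pow)
    then have "u \<in> E" using subgroup_nat_pow[OF E.is_subgroup n_E] by simp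
    then show "u \<in> monothetic w" using Ew by auto
  qed
  then obtain f where f: "f \<in> \<phi> ` K" "\<phi> ` K = monothetic f"
    using closed_subgroup_monothetic[OF \<phi>_sub[OF K order_refl] closedin_image[OF \<phi>_cont Kc] w] by blast
  then obtain x where x: "x \<in> K" "f = \<phi> x" by auto
  have xK: "monothetic x \<subseteq> K" using x(1) K Kc by (rule monothetic_minimal)
  \<comment> \<open>\<open>\<phi>\<close> maps \<open>monothetic x\<close> onto a closed subgroup
    containing \<open>f\<close>, hence onto the whole image of \<open>K\<close>. So every element of
    \<open>K\<close> agrees with one of \<open>monothetic x\<close> up to the kernel
    \<open>N\<close>.\<close>
  have "monothetic f \<subseteq> \<phi> ` monothetic x"
  proof (rule monothetic_minimal)
    show "f \<in> \<phi> ` monothetic x" using monothetic_self[of x] x by auto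
    show "subgroup (\<phi> ` monothetic x) G"
      using x monothetic_subgroup[of x] xK by (intro \<phi>_sub) auto
    show "closedin T (\<phi> ` monothetic x)"
      using \<phi>_cont closedin_topologically_generated by (rule closedin_image)
  qed
  then have "\<exists>y\<in>N. \<exists>z\<in>monothetic x. k = y \<otimes> z" if k: "k \<in> K" for k
  proof -
    have "\<phi> k \<in> \<phi> ` monothetic x" using that f(2) \<open>monothetic f \<subseteq> \<phi> ` monothetic x\<close> by blast
    then obtain z where z: "z \<in> monothetic x" "\<phi> k = \<phi> z" by auto
    have zK: "z \<in> K" using z xK by auto
    have "(k \<otimes> inv z) [^] q = \<one>"
      using q_mult[of k "inv z"] z(2) zK k by (simp add: \<phi>_def nat_pow_inv)
    then have "k \<otimes> inv z \<in> N" using k zK by (simp add: N_def)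
    moreover have "k = (k \<otimes> inv z) \<otimes> z" using k zK by (simp add: m_assoc)
    ultimately show ?thesis using z(1) by blast
  qed
  then show ?thesis using N_H \<open>finite N\<close> x(1) unfolding H_def by blast
qed

end

section \<open>Countable coverings of virtually procyclic groups\<close>

lemma (in normal) rcoset_int_pow_add:
  assumes "x \<in> carrier G" "x [^] (a::int) \<in> H"
  shows "H #> x [^] (i + a * b) = H #> x [^] i"
proof -
  have "(x [^] a) [^] b \<in> H" using is_subgroup assms(2) by (rule subgroup_int_pow_closed)
  then have "H #> x [^] (a * b) = H #> \<one>"
    using assms(1) rcoset_mem_iff[of "x [^] (a * b)"] by (simp add: int_pow_pow)
  then have "H #> (x [^] i \<otimes> x [^] (a * b)) = H #> (x [^] i \<otimes> \<one>)"
    using assms(1) by (intro rcoset_mult_cong) auto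
  then show ?thesis using assms(1) by (simp add: int_pow_mult)
qed

lemma (in normal) int_pow_mem_gcd:
  assumes "x \<in> carrier G" "x [^] (a::int) \<in> H" "x [^] (b::int) \<in> H"
  shows "x [^] gcd a b \<in> H"
proof -
  obtain u v where uv: "u * a + v * b = gcd a b" using bezout_int by blast
  have "(x [^] a) [^] u \<otimes> (x [^] b) [^] v \<in> H"
    using subgroup_int_pow_closed[OF is_subgroup] assms(2,3) by simp
  then show ?thesis
    using assms(1) uv by (simp add: int_pow_pow mult.commute flip: int_pow_mult)
qed

text \<open>An exponent that is \<open>1\<close> modulo \<open>a\<close> and \<open>0\<close> modulo
  \<open>b\<close>, read off from a Bezout identity, extracts \<open>u\<close> from
  \<open>u \<otimes> v\<close>.\<close>

lemma (in normal) coprime_power_of_mult: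
  assumes u: "u \<in> carrier G" and v: "v \<in> carrier G" and uv: "u \<otimes> v = v \<otimes> u"
    and ab: "coprime a b" and ua: "u [^] (a::int) \<in> H" and vb: "v [^] (b::int) \<in> H"
  shows "\<exists>j::int. H #> u = H #> (u \<otimes> v) [^] j"
proof -
  obtain \<alpha> \<beta> where "\<alpha> * a + \<beta> * b = 1" using ab by (metis bezout_int coprime_iff_gcd_eq_1)
  then have e: "0 + b * \<beta> = 1 + a * (- \<alpha>)" by (simp add: algebra_simps)
  have "H #> (u \<otimes> v) [^] (0 + b * \<beta>) = H #> (u [^] (1 + a * (- \<alpha>)) \<otimes> v [^] (0 + b * \<beta>))"
    by (simp only: int_pow_mult_distrib[OF uv u v] e)
  also have "\<dots> = H #> (u [^] (1::int) \<otimes> v [^] (0::int))"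
    by (intro rcoset_mult_cong rcoset_int_pow_add ua vb u v int_pow_closed)
  finally show ?thesis using u by (intro exI[of _ "0 + b * \<beta>"]) simp
qed

text \<open>Modulo \<open>H\<close>, taking \<open>a\<close>-th powers kills \<open>y\<close> and
  \<open>u\<close>, so \<open>v [^] (j * a)\<close> is in \<open>H\<close>, as is
  \<open>v [^] (j * b)\<close>; by coprimality \<open>v [^] j\<close> is in
  \<open>H\<close>.\<close>

lemma (in normal) coprime_part_of_mult:
  assumes u: "u \<in> carrier G" and v: "v \<in> carrier G" and uv: "u \<otimes> v = v \<otimes> u"
    and ab: "coprime a b" and ua: "u [^] (a::int) \<in> H" and vb: "v [^] (b::int) \<in> H"
    and y: "y \<in> carrier G" and yj: "H #> y = H #> (u \<otimes> v) [^] (j::int)" and ya: "y [^] a \<in> H"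
  shows "H #> y = H #> u [^] j"
proof -
  have uvj: "(u \<otimes> v) [^] j = u [^] j \<otimes> v [^] j" by (rule int_pow_mult_distrib[OF uv u v])
  have "H #> (u [^] j \<otimes> v [^] j) [^] a = H #> y [^] a"
    using yj u v y uvj by (intro rcoset_int_pow_cong) simp_all
  then have "(u [^] j \<otimes> v [^] j) [^] a \<in> H"
    using ya rcoset_mem_iff[of "y [^] a"] y u v rcoset_mem_iff[of "(u [^] j \<otimes> v [^] j) [^] a"] by simp
  moreover have "(u [^] j \<otimes> v [^] j) [^] a = (u [^] a) [^] j \<otimes> v [^] (j * a)"
    using u v int_pow_mult_distrib[OF uv u v, of "j * a"]
    by (simp add: int_pow_pow mult.commute[of a] flip: uvj)
  ultimately have "v [^] (j * a) \<in> H"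
    using subgroup_mult_cancel(2)[OF is_subgroup, of "v [^] (j * a)"] v
      subgroup_int_pow_closed[OF is_subgroup ua, of j] by simp
  moreover have "v [^] (j * b) \<in> H"
    using subgroup_int_pow_closed[OF is_subgroup vb, of j] v by (simp add: int_pow_pow mult.commute)
  ultimately have "v [^] gcd (j * a) (j * b) \<in> H" by (intro int_pow_mem_gcd v)
  moreover have "gcd (j * a) (j * b) = \<bar>j\<bar>"
    using ab by (simp add: gcd_mult_distrib_int[symmetric])
  ultimately have "v [^] \<bar>j\<bar> \<in> H" by simp
  then have "v [^] j \<in> H"
    using v subgroup.m_inv_closed[OF is_subgroup, of "v [^] (- j)"]
    by (auto simp: abs_if int_pow_neg split: if_splits)
  then have "H #> v [^] j = H #> \<one>" using v rcoset_mem_iff[of "v [^] j"] by simp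
  then have "H #> (u [^] j \<otimes> v [^] j) = H #> (u [^] j \<otimes> \<one>)"
    using u v by (intro rcoset_mult_cong) auto
  then show ?thesis using yj u uvj by simp
qed

section \<open>Splitting into p-part and prime-to-p part\<close>

context profinite_group
begin

text \<open>Elements that topologically generate a pro-\<open>p\<close> group, respectively a group all of whose
  finite quotients have order prime to \<open>p\<close>.\<close>

definition p_element :: "nat \<Rightarrow> 'a \<Rightarrow> bool" where
  "p_element p g \<longleftrightarrow> (\<forall>K. open_normal K \<longrightarrow> (\<exists>n. g [^] (int p ^ n) \<in> K))"

definition p'_element :: "nat \<Rightarrow> 'a \<Rightarrow> bool" where
  "p'_element p g \<longleftrightarrow> (\<forall>K. open_normal K \<longrightarrow> (\<exists>k::int. coprime k (int p) \<and> g [^] k \<in> K))"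

lemma p_element_common:
  assumes p: "Factorial_Ring.prime p" and K: "open_normal K"
    and x: "p_element p x" "x \<in> carrier G" and y: "p_element p y" "y \<in> carrier G"
  shows "\<exists>n. x [^] (int p ^ n) \<in> K \<and> y [^] (int p ^ n) \<in> K"
proof -
  obtain m n where mn: "x [^] (int p ^ m) \<in> K" "y [^] (int p ^ n) \<in> K"
    using x y K unfolding p_element_def by blast
  have K': "subgroup K G" using K by (simp add: open_normal_def normal_imp_subgroup)
  have "(x [^] (int p ^ m)) [^] (int p ^ n) \<in> K" "(y [^] (int p ^ n)) [^] (int p ^ m) \<in> K"
    using subgroup_int_pow_closed[OF K'] mn by blast+
  then have "x [^] (int p ^ (m + n)) \<in> K \<and> y [^] (int p ^ (m + n)) \<in> K"
    using x y by (simp add: int_pow_pow power_add mult.commute)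
  then show ?thesis by blast
qed

lemma p'_element_common:
  assumes K: "open_normal K"
    and x: "p'_element p x" "x \<in> carrier G" and y: "p'_element p y" "y \<in> carrier G"
  shows "\<exists>k::int. coprime k (int p) \<and> x [^] k \<in> K \<and> y [^] k \<in> K"
proof -
  obtain m n where mn: "x [^] m \<in> K" "y [^] n \<in> K" "coprime m (int p)" "coprime n (int p)"
    using x y K unfolding p'_element_def by blast
  have K': "subgroup K G" using K by (simp add: open_normal_def normal_imp_subgroup)
  have "(x [^] m) [^] n \<in> K" "(y [^] n) [^] m \<in> K"
    using subgroup_int_pow_closed[OF K'] mn by blast+
  then have "x [^] (m * n) \<in> K" "y [^] (m * n) \<in> K"
    using x y by (simp_all add: int_pow_pow mult.commute)
  then show ?thesis using mn(3,4) by (intro exI[of _ "m * n"]) simp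
qed

lemma p_element_mult:
  assumes p: "Factorial_Ring.prime p" and x: "p_element p x" "x \<in> carrier G"
    and y: "p_element p y" "y \<in> carrier G" and xy: "x \<otimes> y = y \<otimes> x"
  shows "p_element p (x \<otimes> y)"
  unfolding p_element_def
proof (intro allI impI)
  fix K assume K: "open_normal K"
  then have K': "subgroup K G" by (simp add: open_normal_def normal_imp_subgroup)
  obtain n where "x [^] (int p ^ n) \<in> K" "y [^] (int p ^ n) \<in> K"
    using p_element_common[OF p K x y] by auto
  then have "(x \<otimes> y) [^] (int p ^ n) \<in> K"
    using subgroup.m_closed[OF K'] int_pow_mult_distrib[OF xy x(2) y(2)] by simp
  then show "\<exists>n. (x \<otimes> y) [^] (int p ^ n) \<in> K" by blast
qed

lemma p'_element_mult:
  assumes x: "p'_element p x" "x \<in> carrier G"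
    and y: "p'_element p y" "y \<in> carrier G" and xy: "x \<otimes> y = y \<otimes> x"
  shows "p'_element p (x \<otimes> y)"
  unfolding p'_element_def
proof (intro allI impI)
  fix K assume K: "open_normal K"
  then have K': "subgroup K G" by (simp add: open_normal_def normal_imp_subgroup)
  obtain k :: int where k: "coprime k (int p)" "x [^] k \<in> K" "y [^] k \<in> K"
    using p'_element_common[OF K x y] by auto
  then have "(x \<otimes> y) [^] k \<in> K"
    using subgroup.m_closed[OF K'] int_pow_mult_distrib[OF xy x(2) y(2)] by simp
  then show "\<exists>k::int. coprime k (int p) \<and> (x \<otimes> y) [^] k \<in> K" using k(1) by blast
qed

lemma int_pow_mem_of_coset:
  assumes K: "open_normal K" and g: "g \<in> carrier G" "g [^] (k::int) \<in> K"
    and y: "y \<in> carrier G" "K #> y = K #> g [^] (j::int)"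
  shows "y [^] k \<in> K"
proof -
  interpret normal K G using K by (simp add: open_normal_def)
  have "K #> y [^] k = K #> (g [^] j) [^] k"
    using g y by (intro rcoset_int_pow_cong) auto
  also have "(g [^] j) [^] k = (g [^] k) [^] j" using g by (simp add: int_pow_pow mult.commute)
  also have "K #> \<dots> = K #> \<one>"
    using g rcoset_mem_iff[of "(g [^] k) [^] j"] subgroup_int_pow_closed[OF is_subgroup g(2)] by simp
  finally show ?thesis using y rcoset_mem_iff[of "y [^] k"] by simp
qed

lemma p_element_monothetic:
  assumes g: "g \<in> carrier G" "p_element p g" and y: "y \<in> monothetic g"
  shows "p_element p y"
  unfolding p_element_def
proof (intro allI impI)
  fix K assume K: "open_normal K"
  have yG: "y \<in> carrier G" using monothetic_carrier[OF g(1) y] .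
  obtain n where n: "g [^] (int p ^ n) \<in> K" using g K unfolding p_element_def by blast
  obtain j :: int where "K #> y = K #> g [^] j" using monothetic_mem_iff[OF g(1) yG] y K by blast
  then show "\<exists>n. y [^] (int p ^ n) \<in> K" using int_pow_mem_of_coset[OF K g(1) n yG] by blast
qed

lemma p'_element_monothetic:
  assumes g: "g \<in> carrier G" "p'_element p g" and y: "y \<in> monothetic g"
  shows "p'_element p y"
  unfolding p'_element_def
proof (intro allI impI)
  fix K assume K: "open_normal K"
  have yG: "y \<in> carrier G" using monothetic_carrier[OF g(1) y] .
  obtain k where k: "coprime k (int p)" "g [^] k \<in> K" using g K unfolding p'_element_def by blast
  obtain j :: int where "K #> y = K #> g [^] j" using monothetic_mem_iff[OF g(1) yG] y K by blast
  then show "\<exists>k::int. coprime k (int p) \<and> y [^] k \<in> K"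
    using int_pow_mem_of_coset[OF K g(1) k(2) yG] k(1) by blast
qed

text \<open>Modulo \<open>K\<close> the order of \<open>g\<close> divides some
  \<open>p ^ a * k\<close> with \<open>k\<close> prime to \<open>p\<close>; Bezout coefficients
  split \<open>g\<close> into powers with exponents \<open>\<alpha> * k\<close> and
  \<open>\<beta> * p ^ a\<close>. The splittings modulo \<open>K\<close> form a closed set
  \<open>Y K\<close> in the single variable \<open>u\<close>, the second factor being
  \<open>inv u \<otimes> g\<close>, and compactness picks one for all \<open>K\<close>.\<close>

lemma p_element_split:
  assumes p: "Factorial_Ring.prime p" and g: "g \<in> carrier G"
  obtains u v where "u \<in> monothetic g" "v \<in> monothetic g" "g = u \<otimes> v"
    "p_element p u" "p'_element p v"
proof -
  define Y where "Y K = {u \<in> monothetic g. (\<exists>n. u [^] (int p ^ n) \<in> K) \<and>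
    (\<exists>k::int. coprime k (int p) \<and> (inv u \<otimes> g) [^] k \<in> K)}" for K
  have "\<exists>u\<in>carrier G. \<forall>K. open_normal K \<longrightarrow> {} \<subseteq> K \<longrightarrow> u \<in> Y K"
  proof (rule compact_open_normal)
    fix K assume K: "open_normal K"
    interpret normal K G using K by (simp add: open_normal_def)
    have "Y K = monothetic g \<inter> {u \<in> carrier G. (\<exists>n. u [^] (int p ^ n) \<in> K) \<and>
        (\<exists>k::int. coprime k (int p) \<and> (inv u \<otimes> g) [^] k \<in> K)}"
      using monothetic_carrier[OF g] by (auto simp: Y_def)
    moreover have "closedin T {u \<in> carrier G. (\<exists>n. u [^] (int p ^ n) \<in> K) \<and>
        (\<exists>k::int. coprime k (int p) \<and> (inv u \<otimes> g) [^] k \<in> K)}"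
    proof (rule closedin_saturated[OF K])
      fix x y assume x: "x \<in> carrier G" and y: "y \<in> carrier G" and xy: "K #> x = K #> y"
      have 1: "K #> x [^] i = K #> y [^] i" for i :: int
        using rcoset_int_pow_cong[OF xy x y] .
      have "K #> (inv x \<otimes> g) = K #> (inv y \<otimes> g)"
        using x y g rcoset_inv_cong[OF xy x y] by (intro rcoset_mult_cong) auto
      then have 2: "K #> (inv x \<otimes> g) [^] i = K #> (inv y \<otimes> g) [^] i" for i :: int
        using x y g by (intro rcoset_int_pow_cong) auto
      have "x [^] i \<in> K \<longleftrightarrow> y [^] i \<in> K" "(inv x \<otimes> g) [^] i \<in> K \<longleftrightarrow> (inv y \<otimes> g) [^] i \<in> K" for i :: int
        using 1[of i] 2[of i] x y g rcoset_mem_iff[of "x [^] i"] rcoset_mem_iff[of "y [^] i"]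
          rcoset_mem_iff[of "(inv x \<otimes> g) [^] i"] rcoset_mem_iff[of "(inv y \<otimes> g) [^] i"] by auto
      then show "(\<exists>n. y [^] (int p ^ n) \<in> K) \<and> (\<exists>k::int. coprime k (int p) \<and> (inv y \<otimes> g) [^] k \<in> K)"
        if "(\<exists>n. x [^] (int p ^ n) \<in> K) \<and> (\<exists>k::int. coprime k (int p) \<and> (inv x \<otimes> g) [^] k \<in> K)"
        using that by simp
    qed
    ultimately show "closedin T (Y K)" using closedin_topologically_generated by auto
    obtain o' where o': "0 < o'" "g [^] (o'::nat) \<in> K" using open_normal_exponent[OF K] g by metis
    obtain a k where ak: "o' = p ^ a * k" "\<not> p dvd k"
      using o'(1) p by (metis multiplicity_decompose' not_prime_unit neq0_conv)
    have cop: "coprime (int k) (int p)"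
      using ak(2) p by (metis coprime_commute prime_imp_coprime coprime_int_iff)
    then have "coprime (int k) (int p ^ a)" by simp
    then obtain \<alpha> \<beta> where ab: "\<alpha> * int k + \<beta> * int p ^ a = 1"
      by (metis bezout_int coprime_iff_gcd_eq_1)
    define u where "u = g [^] (\<alpha> * int k)"
    have "u \<in> monothetic g"
      unfolding u_def using monothetic_subgroup[OF g] monothetic_self[OF g] by (rule subgroup_int_pow_closed)
    moreover have "u [^] (int p ^ a) = (g [^] o') [^] \<alpha>"
      using g by (simp add: u_def int_pow_pow ak(1) mult_ac flip: int_pow_int)
    then have "u [^] (int p ^ a) \<in> K" using subgroup_int_pow_closed[OF is_subgroup o'(2)] by simp
    moreover have "inv u \<otimes> g = g [^] (\<beta> * int p ^ a)"
    proof -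
      have "inv u \<otimes> g = g [^] (- (\<alpha> * int k)) \<otimes> g [^] (1::int)" using g by (simp add: u_def int_pow_neg)
      also have "\<dots> = g [^] (- (\<alpha> * int k) + 1)" using g by (simp only: int_pow_mult)
      also have "- (\<alpha> * int k) + 1 = \<beta> * int p ^ a" using ab by simp
      finally show ?thesis .
    qed
    then have "(inv u \<otimes> g) [^] int k = (g [^] o') [^] \<beta>"
      using g by (simp add: int_pow_pow ak(1) mult_ac flip: int_pow_int)
    then have "(inv u \<otimes> g) [^] int k \<in> K" using subgroup_int_pow_closed[OF is_subgroup o'(2)] by simp
    ultimately have "u \<in> Y K" unfolding Y_def using cop by blast
    then show "Y K \<noteq> {}" by blast
  next
    fix K L :: "'a set" assume "K \<subseteq> L"
    then show "Y K \<subseteq> Y L" unfolding Y_def by blast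
  qed auto
  then obtain u where u: "u \<in> carrier G" "\<And>K. open_normal K \<Longrightarrow> u \<in> Y K" by auto
  have ug: "u \<in> monothetic g" using u(2)[OF open_normal_carrier] by (simp add: Y_def)
  show ?thesis
  proof
    show "u \<in> monothetic g" by (rule ug)
    show "inv u \<otimes> g \<in> monothetic g"
      using ug monothetic_self[OF g] monothetic_subgroup[OF g]
      by (simp add: subgroup.m_closed subgroup.m_inv_closed)
    show "g = u \<otimes> (inv u \<otimes> g)" using u g by (simp add: inv_mult_cancel)
    show "p_element p u" "p'_element p (inv u \<otimes> g)"
      using u(2) unfolding p_element_def p'_element_def Y_def by blast+
  qed
qed

text \<open>This lets two covers, one for \<open>p\<close>-elements and one for
  \<open>p'\<close>-elements, be combined by multiplying their generators.\<close>

lemma coprime_parts_mem: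
  assumes u: "u \<in> carrier G" "p_element p u"
    and v: "v \<in> carrier G" "p'_element p v" and uv: "u \<otimes> v = v \<otimes> u"
  shows "u \<in> monothetic (u \<otimes> v)" "v \<in> monothetic (u \<otimes> v)"
proof -
  have uvG: "u \<otimes> v \<in> carrier G" using u v by simp
  have "(\<exists>j::int. K #> u = K #> (u \<otimes> v) [^] j) \<and> (\<exists>j::int. K #> v = K #> (u \<otimes> v) [^] j)"
    if K: "open_normal K" for K
  proof -
    interpret normal K G using K by (simp add: open_normal_def)
    obtain n where n: "u [^] (int p ^ n) \<in> K" using u(2) K unfolding p_element_def by blast
    obtain k where k: "coprime k (int p)" "v [^] k \<in> K" using v(2) K unfolding p'_element_def by blast
    have "coprime (int p ^ n) k" "coprime k (int p ^ n)" using k(1) by (simp_all add: coprime_commute)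
    then show ?thesis
      using coprime_power_of_mult[OF u(1) v(1) uv _ n k(2)]
        coprime_power_of_mult[OF v(1) u(1) uv[symmetric] _ k(2) n] uv by simp
  qed
  then show "u \<in> monothetic (u \<otimes> v)" "v \<in> monothetic (u \<otimes> v)"
    using monothetic_mem_iff[OF uvG] u(1) v(1) by blast+
qed

text \<open>Modulo each \<open>K\<close>, if \<open>(u \<otimes> v) [^] j\<close> has
  \<open>p\<close>-power order then \<open>v [^] j\<close> is trivial by
  \<open>coprime_part_of_mult\<close>, for which one power of \<open>p\<close> is chosen to kill
  both \<open>u\<close> and \<open>y\<close>. The other case is symmetric.\<close>

lemma part_monothetic:
  assumes p: "Factorial_Ring.prime p" and u: "u \<in> carrier G" "p_element p u"
    and v: "v \<in> carrier G" "p'_element p v" and uv: "u \<otimes> v = v \<otimes> u"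
    and y: "y \<in> monothetic (u \<otimes> v)"
  shows "p_element p y \<Longrightarrow> y \<in> monothetic u" "p'_element p y \<Longrightarrow> y \<in> monothetic v"
proof -
  have uvG: "u \<otimes> v \<in> carrier G" using u v by simp
  have yG: "y \<in> carrier G" using monothetic_carrier[OF uvG y] .
  have j: "\<exists>j::int. K #> y = K #> (u \<otimes> v) [^] j" if "open_normal K" for K
    using monothetic_mem_iff[OF uvG yG] y that by blast
  show "y \<in> monothetic u" if yp: "p_element p y"
  proof (subst monothetic_mem_iff[OF u(1) yG], intro allI impI)
    fix K assume K: "open_normal K"
    interpret normal K G using K by (simp add: open_normal_def)
    obtain n where n: "u [^] (int p ^ n) \<in> K" "y [^] (int p ^ n) \<in> K"
      using p_element_common[OF p K u(2,1) yp yG] by blast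
    obtain k where k: "coprime k (int p)" "v [^] k \<in> K" using v(2) K unfolding p'_element_def by blast
    have "coprime (int p ^ n) k" using k(1) by (simp add: coprime_commute)
    then show "\<exists>j::int. K #> y = K #> u [^] j"
      using coprime_part_of_mult[OF u(1) v(1) uv _ n(1) k(2) yG _ n(2)] j[OF K] by blast
  qed
  show "y \<in> monothetic v" if yp: "p'_element p y"
  proof (subst monothetic_mem_iff[OF v(1) yG], intro allI impI)
    fix K assume K: "open_normal K"
    interpret normal K G using K by (simp add: open_normal_def)
    obtain n where n: "u [^] (int p ^ n) \<in> K" using u(2) K unfolding p_element_def by blast
    obtain k where k: "coprime k (int p)" "v [^] k \<in> K" "y [^] k \<in> K"
      using p'_element_common[OF K v(2,1) yp yG] by blast
    have "coprime k (int p ^ n)" using k(1) by simp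
    then show "\<exists>j::int. K #> y = K #> v [^] j"
      using coprime_part_of_mult[OF v(1) u(1) uv[symmetric] _ k(2) n yG _ k(3)] j[OF K] uv by auto
  qed
qed

text \<open>Modulo every \<open>K\<close> the order of \<open>g\<close> divides a number prime to
  \<open>p\<close>, so raising to the power \<open>p ^ e\<close> is invertible.\<close>

lemma p'_element_root:
  assumes g: "g \<in> carrier G" "p'_element p g"
  shows "g \<in> monothetic (g [^] (p ^ e))"
proof -
  have geG: "g [^] (p ^ e) \<in> carrier G" using g by simp
  show ?thesis
  proof (subst monothetic_mem_iff[OF geG g(1)], intro allI impI)
    fix K assume K: "open_normal K"
    interpret normal K G using K by (simp add: open_normal_def)
    obtain k where k: "coprime k (int p)" "g [^] k \<in> K" using g(2) K unfolding p'_element_def by blast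
    have "coprime k (int p ^ e)" using k(1) by simp
    then obtain \<alpha> \<beta> where ab: "\<alpha> * k + \<beta> * int p ^ e = 1"
      by (metis bezout_int coprime_iff_gcd_eq_1)
    have "(g [^] (p ^ e)) [^] \<beta> = g [^] (1 + k * (- \<alpha>))"
    proof -
      have "(g [^] (p ^ e)) [^] \<beta> = g [^] (int p ^ e * \<beta>)"
        using g by (simp add: int_pow_pow flip: int_pow_int)
      also have "int p ^ e * \<beta> = 1 + k * (- \<alpha>)" using ab by (simp add: algebra_simps)
      finally show ?thesis .
    qed
    then have "K #> g = K #> (g [^] (p ^ e)) [^] \<beta>"
      using rcoset_int_pow_add[OF g(1) k(2), of 1 "- \<alpha>"] g by simp
    then show "\<exists>j::int. K #> g = K #> (g [^] (p ^ e)) [^] j" by blast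
  qed
qed

text \<open>If \<open>K\<close> shows that \<open>y\<close> is nontrivial and
  \<open>u [^] (p ^ m)\<close> is in \<open>K\<close>, then modulo any smaller
  \<open>K \<inter> L\<close> the element \<open>y\<close> is \<open>u [^] i\<close> with
  \<open>i\<close> not divisible by \<open>p ^ m\<close>, so \<open>u [^] (p ^ m)\<close> is a power
  of \<open>y\<close>. As \<open>m\<close> does not depend on \<open>L\<close>, this is the openness
  of nontrivial closed subgroups in procyclic pro-\<open>p\<close> groups.\<close>

lemma p_element_power_mem:
  assumes p: "Factorial_Ring.prime p" and u: "u \<in> carrier G" "p_element p u"
    and y: "y \<in> monothetic u" "y \<noteq> \<one>"
  shows "\<exists>n. u [^] (p ^ n) \<in> monothetic y"
proof -
  have yG: "y \<in> carrier G" using monothetic_carrier[OF u(1) y(1)] .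
  obtain K where K: "open_normal K" "K #> y \<noteq> K #> \<one>"
    using eq_iff_open_normal[OF yG one_closed] y(2) by auto
  obtain m where m: "u [^] (int p ^ m) \<in> K" using u(2) K(1) unfolding p_element_def by blast
  have "u [^] (p ^ m) \<in> monothetic y"
  proof (subst monothetic_mem_iff[OF yG], simp add: u, intro allI impI)
    fix L assume L: "open_normal L"
    have KL: "open_normal (K \<inter> L)" using K(1) L by (rule open_normal_Int)
    interpret K: normal K G using K by (simp add: open_normal_def)
    interpret KL: normal "K \<inter> L" G using KL by (simp add: open_normal_def)
    obtain i :: int where i: "(K \<inter> L) #> y = (K \<inter> L) #> u [^] i"
      using monothetic_mem_iff[OF u(1) yG] y(1) KL by blast
    obtain t where t: "u [^] (int p ^ t) \<in> K \<inter> L" using u(2) KL unfolding p_element_def by blast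
    have "K #> y = K #> u [^] i"
      using i yG u K.normal_axioms by (intro KL.rcoset_mono[of K]) auto
    then have "u [^] i \<notin> K" using K(2) K.rcoset_mem_iff[of "u [^] i"] u by auto
    then have ndvd: "\<not> int p ^ m dvd i"
      using subgroup_int_pow_closed[OF K.is_subgroup m] u(1) by (auto simp: int_pow_pow elim!: dvdE)
    have "gcd i (int p ^ t) dvd int p ^ t" by simp
    then obtain v where v: "gcd i (int p ^ t) = int p ^ v"
      using p divides_primepow[of "int p" "gcd i (int p ^ t)" t] by auto
    have "int p ^ v dvd i" using gcd_dvd1[of i "int p ^ t"] by (simp only: v)
    have "v < m"
    proof (rule ccontr)
      assume "\<not> v < m"
      then have "int p ^ m dvd int p ^ v" by (intro le_imp_power_dvd) simp
      then show False using ndvd \<open>int p ^ v dvd i\<close> dvd_trans by blast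
    qed
    obtain \<alpha> \<beta> where ab: "\<alpha> * i + \<beta> * int p ^ t = int p ^ v"
      using bezout_int[of i "int p ^ t"] v by auto
    have e: "int p ^ m = i * (\<alpha> * int p ^ (m - v)) + int p ^ t * (\<beta> * int p ^ (m - v))"
    proof -
      have "int p ^ m = int p ^ v * int p ^ (m - v)" using \<open>v < m\<close> by (simp flip: power_add)
      also have "\<dots> = (\<alpha> * i + \<beta> * int p ^ t) * int p ^ (m - v)" by (simp only: ab)
      finally show ?thesis by (simp add: algebra_simps)
    qed
    have "(K \<inter> L) #> u [^] (int p ^ m) = (K \<inter> L) #> (u [^] i) [^] (\<alpha> * int p ^ (m - v))"
      unfolding e KL.rcoset_int_pow_add[OF u(1) t] using u by (simp add: int_pow_pow)
    also have "\<dots> = (K \<inter> L) #> y [^] (\<alpha> * int p ^ (m - v))"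
      using i u yG by (intro KL.rcoset_int_pow_cong) auto
    finally have "L #> u [^] (int p ^ m) = L #> y [^] (\<alpha> * int p ^ (m - v))"
      using u yG L by (intro KL.rcoset_mono[of L]) (auto simp: open_normal_def)
    then show "\<exists>j::int. L #> u [^] (p ^ m) = L #> y [^] j"
      by (auto simp flip: int_pow_int)
  qed
  then show ?thesis by blast
qed

text \<open>A finite union of cosets of a closed subgroup is closed, and this one contains all
  integer powers of \<open>u\<close>.\<close>

lemma monothetic_power_cosets:
  assumes u: "u \<in> carrier G" and n: "0 < (n::nat)"
  shows "monothetic u \<subseteq> (\<Union>i<n. (\<lambda>s. s \<otimes> u [^] i) ` monothetic (u [^] n))"
  unfolding topologically_generated_def[of G T "{u}"]
proof (rule closure_of_minimal)
  show "closedin T (\<Union>i<n. (\<lambda>s. s \<otimes> u [^] i) ` monothetic (u [^] n))"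
    using u closedin_topologically_generated
    by (intro closedin_Union) (auto intro!: closedin_image continuous_group_intros)
  show "generate G {u} \<subseteq> (\<Union>i<n. (\<lambda>s. s \<otimes> u [^] i) ` monothetic (u [^] n))"
  proof
    fix x assume "x \<in> generate G {u}"
    then obtain j :: int where j: "x = u [^] j" using generate_pow[OF u] by auto
    define i where "i = nat (j mod int n)"
    have i: "i < n" using n by (simp add: i_def nat_less_iff)
    have "j = int n * (j div int n) + int i" using n by (simp add: i_def)
    then have "x = u [^] (int n * (j div int n) + int i)" using j by simp
    also have "\<dots> = (u [^] n) [^] (j div int n) \<otimes> u [^] i"
      using u by (simp add: int_pow_mult int_pow_pow flip: int_pow_int)
    finally have "x = (u [^] n) [^] (j div int n) \<otimes> u [^] i" .
    moreover have "(u [^] n) [^] (j div int n) \<in> monothetic (u [^] n)"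
      using u by (intro subgroup_int_pow_closed monothetic_subgroup monothetic_self) auto
    ultimately show "x \<in> (\<Union>i<n. (\<lambda>s. s \<otimes> u [^] i) ` monothetic (u [^] n))" using i by blast
  qed
qed

text \<open>The elements of the coset whose \<open>r\<close>-th power is trivial are finitely many
  and cover themselves. For any other \<open>g\<close> the group \<open>monothetic g\<close>
  contains some \<open>u [^] (p ^ n)\<close>, and one \<open>w\<close> with the same
  \<open>n\<close> in the same coset modulo \<open>monothetic (u [^] (p ^ n))\<close> already has
  \<open>g\<close> in \<open>monothetic w\<close>; there are countably many such data. Taking
  \<open>W\<close> inside the coset makes its members \<open>p\<close>-elements whenever
  \<open>c\<close> is one.\<close>

lemma countable_cover_p_coset:
  assumes p: "Factorial_Ring.prime p" and u: "u \<in> carrier G" "p_element p u"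
    and c: "c \<in> carrier G" "c \<otimes> u = u \<otimes> c" and r: "0 < (r::nat)" "c [^] r \<in> monothetic u"
  shows "\<exists>W. countable W \<and> W \<subseteq> (\<lambda>t. c \<otimes> t) ` monothetic u \<and>
    (\<forall>t\<in>monothetic u. \<exists>w\<in>W. c \<otimes> t \<in> monothetic w)"
proof -
  define S where "S = (\<lambda>t. c \<otimes> t) ` monothetic u"
  note tG = monothetic_carrier[OF u(1)]
  have ct: "c \<otimes> t = t \<otimes> c" if "t \<in> monothetic u" for t
    using monothetic_commute[OF u(1) that c(1)] c(2) by simp
  have SG: "S \<subseteq> carrier G" using c tG by (auto simp: S_def)
  define S\<^sub>1 where "S\<^sub>1 = {g \<in> S. g [^] r = \<one>}"
  define S\<^sub>2 where "S\<^sub>2 = (\<lambda>(n, i). {g \<in> S. u [^] (p ^ n) \<in> monothetic g \<and>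
    (\<exists>s\<in>monothetic (u [^] (p ^ n)). g = c \<otimes> (s \<otimes> u [^] (i::nat)))})"
  have "finite S\<^sub>1"
  proof (cases "S\<^sub>1 = {}")
    case False
    then obtain t\<^sub>0 where t0: "t\<^sub>0 \<in> monothetic u" "(c \<otimes> t\<^sub>0) [^] r = \<one>" by (auto simp: S\<^sub>1_def S_def)
    have "S\<^sub>1 \<subseteq> (\<lambda>y. c \<otimes> t\<^sub>0 \<otimes> y) ` {y \<in> monothetic u. y [^] r = \<one>}"
    proof
      fix g assume "g \<in> S\<^sub>1"
      then obtain t where t: "t \<in> monothetic u" "(c \<otimes> t) [^] r = \<one>" "g = c \<otimes> t"
        by (auto simp: S\<^sub>1_def S_def)
      define y where "y = inv t\<^sub>0 \<otimes> t"
      have yu: "y \<in> monothetic u" unfolding y_def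
        using t t0 monothetic_subgroup[OF u(1)] by (simp add: subgroup.m_closed subgroup.m_inv_closed)
      have g: "g = c \<otimes> t\<^sub>0 \<otimes> y" using t t0 tG c by (simp add: y_def m_assoc inv_mult_cancel)
      have "c \<otimes> t\<^sub>0 \<otimes> y = y \<otimes> (c \<otimes> t\<^sub>0)"
        using ct[OF yu] monothetic_abelian[OF u(1) t0(1) yu] c tG[OF t0(1)] tG[OF yu]
        by (metis m_assoc)
      then have "(c \<otimes> t\<^sub>0 \<otimes> y) [^] r = (c \<otimes> t\<^sub>0) [^] r \<otimes> y [^] r"
        using c tG[OF t0(1)] tG[OF yu] by (intro pow_mult_distrib) auto
      then have "y [^] r = \<one>" using t(2,3) g t0(2) tG[OF yu] by simp
      then show "g \<in> (\<lambda>y. c \<otimes> t\<^sub>0 \<otimes> y) ` {y \<in> monothetic u. y [^] r = \<one>}" using g yu by blast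
    qed
    then show ?thesis
      by (rule finite_subset) (simp add: finite_roots_monothetic[OF u(1) r(1)])
  qed simp
  define W where "W = S\<^sub>1 \<union> (\<lambda>q. SOME g. g \<in> S\<^sub>2 q) ` {q. S\<^sub>2 q \<noteq> {}}"
  have some: "(SOME g. g \<in> S\<^sub>2 q) \<in> S\<^sub>2 q" if "S\<^sub>2 q \<noteq> {}" for q
    using that some_in_eq by blast
  have "countable {q :: nat \<times> nat. S\<^sub>2 q \<noteq> {}}" by (rule countableI_type)
  then have "countable W"
    unfolding W_def using \<open>finite S\<^sub>1\<close> by (simp add: countable_finite)
  moreover have "W \<subseteq> S"
  proof -
    have "S\<^sub>2 q \<subseteq> S" for q by (auto simp: S\<^sub>2_def split: prod.splits)
    then show ?thesis using some unfolding W_def S\<^sub>1_def by blast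
  qed
  moreover have "\<exists>w\<in>W. c \<otimes> t \<in> monothetic w" if t: "t \<in> monothetic u" for t
  proof -
    define g where "g = c \<otimes> t"
    have g: "g \<in> S" "g \<in> carrier G" using t SG by (auto simp: g_def S_def)
    show ?thesis
    proof (cases "g [^] r = \<one>")
      case True
      then have "g \<in> W" using g by (simp add: W_def S\<^sub>1_def)
      then show ?thesis using monothetic_self[OF g(2)] unfolding g_def by blast
    next
      case False
      have "g [^] r = c [^] r \<otimes> t [^] r"
        unfolding g_def using ct[OF t] c tG[OF t] by (intro pow_mult_distrib) auto
      then have "g [^] r \<in> monothetic u"
        using r(2) subgroup_nat_pow[OF monothetic_subgroup[OF u(1)] t]
          subgroup.m_closed[OF monothetic_subgroup[OF u(1)]] by simp
      then obtain n where n: "u [^] (p ^ n) \<in> monothetic (g [^] r)"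
        using p_element_power_mem[OF p u _ False] by blast
      have "g [^] r \<in> monothetic g"
        using monothetic_subgroup[OF g(2)] monothetic_self[OF g(2)] by (rule subgroup_nat_pow)
      then have n': "u [^] (p ^ n) \<in> monothetic g" using n monothetic_mono[OF g(2)] by blast
      have "0 < p ^ n" using p prime_gt_0_nat by simp
      then obtain i s where st: "i < p ^ n" "s \<in> monothetic (u [^] (p ^ n))" "t = s \<otimes> u [^] i"
        using monothetic_power_cosets[OF u(1), of "p ^ n"] t by blast
      then have gS: "g \<in> S\<^sub>2 (n, i)" using g n' by (auto simp: S\<^sub>2_def g_def)
      define w where "w = (SOME g. g \<in> S\<^sub>2 (n, i))"
      have wS: "w \<in> S\<^sub>2 (n, i)" unfolding w_def using some gS by blast
      then obtain s' where w: "w \<in> S" "u [^] (p ^ n) \<in> monothetic w"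
        "s' \<in> monothetic (u [^] (p ^ n))" "w = c \<otimes> (s' \<otimes> u [^] i)" by (auto simp: S\<^sub>2_def)
      have wG: "w \<in> carrier G" using w SG by auto
      have "u [^] (p ^ n) \<in> carrier G" using u by simp
      note ssG = monothetic_carrier[OF this st(2)] monothetic_carrier[OF this w(3)]
      have ss: "s \<in> monothetic w" "s' \<in> monothetic w"
        using st(2) w(3) monothetic_mono[OF wG w(2)] by auto
      have su: "s \<in> monothetic u" "s' \<in> monothetic u" "u [^] i \<in> monothetic u"
        using st(2) w(3) monothetic_mono[OF u(1) subgroup_nat_pow[OF monothetic_subgroup monothetic_self], OF u(1) u(1)]
          subgroup_nat_pow[OF monothetic_subgroup[OF u(1)] monothetic_self[OF u(1)]] by auto
      have "g = (s \<otimes> inv s') \<otimes> w"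
      proof -
        have "(s \<otimes> inv s') \<otimes> w = (s \<otimes> inv s') \<otimes> ((s' \<otimes> u [^] i) \<otimes> c)"
          using ct[of "s' \<otimes> u [^] i"] su subgroup.m_closed[OF monothetic_subgroup[OF u(1)]] w(4) by simp
        also have "\<dots> = (s \<otimes> u [^] i) \<otimes> c" using ssG u c by (simp add: m_assoc inv_mult_cancel)
        also have "\<dots> = g" using ct[OF t] st(3) by (simp add: g_def)
        finally show ?thesis ..
      qed
      then have "g \<in> monothetic w"
        using ss monothetic_self[OF wG] monothetic_subgroup[OF wG]
        by (simp add: subgroup.m_closed subgroup.m_inv_closed)
      moreover have "w \<in> W" using gS unfolding W_def w_def by blast
      ultimately show ?thesis unfolding g_def by blast
    qed
  qed
  ultimately show ?thesis unfolding S_def by blast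
qed

lemma monothetic_nat_pow:
  assumes g: "g \<in> carrier G" and y: "y \<in> monothetic g"
  shows "y [^] (n::nat) \<in> monothetic (g [^] n)"
proof -
  have yG: "y \<in> carrier G" using monothetic_carrier[OF g y] .
  have gn: "g [^] n \<in> carrier G" "y [^] n \<in> carrier G" using g yG by auto
  show ?thesis
  proof (subst monothetic_mem_iff[OF gn], intro allI impI)
    fix K assume K: "open_normal K"
    interpret normal K G using K by (simp add: open_normal_def)
    obtain j :: int where "K #> y = K #> g [^] j" using monothetic_mem_iff[OF g yG] y K by blast
    then have "K #> y [^] n = K #> (g [^] j) [^] n"
      using g yG by (intro rcoset_nat_pow_cong) auto
    also have "(g [^] j) [^] n = (g [^] n) [^] j"
      using g by (simp add: int_pow_pow mult.commute flip: int_pow_int)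
    finally show "\<exists>j::int. K #> y [^] n = K #> (g [^] n) [^] j" by blast
  qed
qed

text \<open>Induction on \<open>r = p ^ e * r\<^sub>0\<close>, removing one prime \<open>p\<close>
  at a time. The \<open>p\<close>-parts of \<open>c\<close> and \<open>z\<close> fall under the
  pro-\<open>p\<close> case. On the other parts \<open>p ^ e\<close>-th roots exist, so already
  \<open>c\<^sub>2 [^] r\<^sub>0\<close> is in \<open>monothetic z\<^sub>2\<close>, and the
  induction hypothesis applies with \<open>r\<^sub>0 < r\<close>. When \<open>r = 1\<close> the
  coset is \<open>monothetic z\<close> itself.\<close>

lemma countable_cover_coset:
  assumes B: "subgroup B G" "closedin T B" and comm: "\<And>x y. x \<in> B \<Longrightarrow> y \<in> B \<Longrightarrow> x \<otimes> y = y \<otimes> x"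
  shows "0 < r \<Longrightarrow> c \<in> B \<Longrightarrow> z \<in> B \<Longrightarrow> c [^] (r::nat) \<in> monothetic z \<Longrightarrow>
    \<exists>W. countable W \<and> W \<subseteq> B \<and> (\<forall>t\<in>monothetic z. \<exists>w\<in>W. c \<otimes> t \<in> monothetic w)"
proof (induction r arbitrary: c z rule: less_induct)
  case (less r)
  note BG = subgroup.mem_carrier[OF B(1)]
  have mB: "monothetic b \<subseteq> B" if "b \<in> B" for b using monothetic_minimal[OF that B] .
  have cG: "c \<in> carrier G" and zG: "z \<in> carrier G" using less.prems BG by auto
  show ?case
  proof (cases "r = 1")
    case True
    then have "c \<in> monothetic z" using less.prems(4) cG by simp
    then have "\<forall>t\<in>monothetic z. \<exists>w\<in>{z}. c \<otimes> t \<in> monothetic w"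
      using subgroup.m_closed[OF monothetic_subgroup[OF zG]] by auto
    moreover have "countable {z}" "{z} \<subseteq> B" using less.prems by auto
    ultimately show ?thesis by blast
  next
    case False
    then obtain p where p: "Factorial_Ring.prime p" "p dvd r" using prime_factor_nat by blast
    obtain e r\<^sub>0 where r: "r = p ^ e * r\<^sub>0" "\<not> p dvd r\<^sub>0"
      using less.prems(1) p(1) by (metis multiplicity_decompose' not_prime_unit neq0_conv)
    have "e \<noteq> 0" using p(2) r by (cases e) auto
    then have "1 < p ^ e" using prime_gt_1_nat[OF p(1)] one_less_power by blast
    moreover have r0: "0 < r\<^sub>0" using less.prems(1) r(1) by (cases r\<^sub>0) auto
    ultimately have lt: "r\<^sub>0 < r" unfolding r(1) by simp
    obtain c\<^sub>1 c\<^sub>2 where c: "c\<^sub>1 \<in> monothetic c" "c\<^sub>2 \<in> monothetic c" "c = c\<^sub>1 \<otimes> c\<^sub>2"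
      "p_element p c\<^sub>1" "p'_element p c\<^sub>2" using p_element_split[OF p(1) cG] by blast
    obtain z\<^sub>1 z\<^sub>2 where z: "z\<^sub>1 \<in> monothetic z" "z\<^sub>2 \<in> monothetic z" "z = z\<^sub>1 \<otimes> z\<^sub>2"
      "p_element p z\<^sub>1" "p'_element p z\<^sub>2" using p_element_split[OF p(1) zG] by blast
    have inB: "c\<^sub>1 \<in> B" "c\<^sub>2 \<in> B" "z\<^sub>1 \<in> B" "z\<^sub>2 \<in> B"
      using c z mB less.prems by auto
    note inG = inB[THEN BG]
    have cr: "y [^] r \<in> monothetic z" if "y \<in> monothetic c" for y
      using monothetic_nat_pow[OF cG that, of r] monothetic_mono[OF zG less.prems(4)] by auto
    note part = part_monothetic[OF p(1) inG(3) z(4) inG(4) z(5) comm[OF inB(3,4)], folded z(3)]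
    have "c\<^sub>1 [^] r \<in> monothetic z\<^sub>1"
      using p_element_monothetic[OF inG(1) c(4)] subgroup_nat_pow[OF monothetic_subgroup monothetic_self] inG(1)
      by (intro part(1) cr c) auto
    then obtain W\<^sub>1 where W1: "countable W\<^sub>1" "W\<^sub>1 \<subseteq> (\<lambda>t. c\<^sub>1 \<otimes> t) ` monothetic z\<^sub>1"
      "\<forall>t\<in>monothetic z\<^sub>1. \<exists>w\<in>W\<^sub>1. c\<^sub>1 \<otimes> t \<in> monothetic w"
      using countable_cover_p_coset[OF p(1) inG(3) z(4) inG(1) comm[OF inB(1,3)] less.prems(1)] by blast
    have W1B: "w \<in> B" "p_element p w" if w: "w \<in> W\<^sub>1" for w
    proof -
      obtain t where t: "t \<in> monothetic z\<^sub>1" "w = c\<^sub>1 \<otimes> t" using w W1(2) by auto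
      have tB: "t \<in> B" using t mB inB by auto
      show "w \<in> B" unfolding t(2) using inB(1) tB by (rule subgroup.m_closed[OF B(1)])
      show "p_element p w" unfolding t(2)
        using p_element_mult[OF p(1) c(4) inG(1) p_element_monothetic[OF inG(3) z(4) t(1)] BG[OF tB]]
          comm[OF inB(1) tB] .
    qed
    have "c\<^sub>2 [^] r\<^sub>0 \<in> monothetic z\<^sub>2"
    proof -
      have "c\<^sub>2 [^] r\<^sub>0 \<in> monothetic c\<^sub>2"
        using subgroup_nat_pow[OF monothetic_subgroup monothetic_self] inG(2) by auto
      then have "p'_element p (c\<^sub>2 [^] r\<^sub>0)" using p'_element_monothetic[OF inG(2) c(5)] by blast
      then have "c\<^sub>2 [^] r\<^sub>0 \<in> monothetic ((c\<^sub>2 [^] r\<^sub>0) [^] (p ^ e))"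
        using inG(2) by (intro p'_element_root) auto
      then have 1: "c\<^sub>2 [^] r\<^sub>0 \<in> monothetic (c\<^sub>2 [^] r)"
        using inG(2) by (simp add: nat_pow_pow r(1) mult.commute)
      have "c\<^sub>2 [^] r \<in> monothetic c\<^sub>2"
        using subgroup_nat_pow[OF monothetic_subgroup monothetic_self] inG(2) by auto
      then have "p'_element p (c\<^sub>2 [^] r)" using p'_element_monothetic[OF inG(2) c(5)] by blast
      then have "c\<^sub>2 [^] r \<in> monothetic z\<^sub>2" by (intro part(2) cr c)
      then show ?thesis using 1 monothetic_mono[OF inG(4)] by blast
    qed
    then obtain W\<^sub>2 where W2: "countable W\<^sub>2" "W\<^sub>2 \<subseteq> B"
      "\<forall>t\<in>monothetic z\<^sub>2. \<exists>w\<in>W\<^sub>2. c\<^sub>2 \<otimes> t \<in> monothetic w"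
      using less.IH[OF lt r0 inB(2,4)] by blast
    \<comment> \<open>Elements of \<open>W\<^sub>2\<close> may have a nontrivial
      \<open>p\<close>-part. It is split off, leaving the part \<open>f w\<close>, in order that the
      two covers have coprime generators.\<close>
    have "\<exists>b\<in>B. p'_element p b \<and> (\<forall>y\<in>monothetic w. p'_element p y \<longrightarrow> y \<in> monothetic b)"
      if w: "w \<in> W\<^sub>2" for w
    proof -
      have wB: "w \<in> B" using w W2 by auto
      obtain a b where ab: "a \<in> monothetic w" "b \<in> monothetic w" "w = a \<otimes> b"
        "p_element p a" "p'_element p b" using p_element_split[OF p(1) BG[OF wB]] by blast
      have abB: "a \<in> B" "b \<in> B" using ab mB[OF wB] by auto
      have "y \<in> monothetic b" if "y \<in> monothetic w" "p'_element p y" for y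
        using part_monothetic(2)[OF p(1) BG[OF abB(1)] ab(4) BG[OF abB(2)] ab(5) comm[OF abB]]
          that ab(3) by simp
      then show ?thesis using abB ab(5) by blast
    qed
    then obtain f where f: "\<And>w. w \<in> W\<^sub>2 \<Longrightarrow> f w \<in> B" "\<And>w. w \<in> W\<^sub>2 \<Longrightarrow> p'_element p (f w)"
      "\<And>w y. w \<in> W\<^sub>2 \<Longrightarrow> y \<in> monothetic w \<Longrightarrow> p'_element p y \<Longrightarrow> y \<in> monothetic (f w)"
      by metis
    \<comment> \<open>By coprimality the closed subgroup generated by \<open>a \<otimes> f b\<close>
      contains both factors, hence all products of elements of \<open>monothetic a\<close> and
      \<open>monothetic (f b)\<close>.\<close>
    define W where "W = (\<lambda>(a, b). a \<otimes> f b) ` (W\<^sub>1 \<times> W\<^sub>2)"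
    have "countable W" unfolding W_def using W1(1) W2(1) by (intro countable_image countable_SIGMA)
    moreover have "W \<subseteq> B"
      unfolding W_def using W1B(1) f(1) subgroup.m_closed[OF B(1)] by auto
    moreover have "\<exists>w\<in>W. c \<otimes> t \<in> monothetic w" if t: "t \<in> monothetic z" for t
    proof -
      have tG: "t \<in> carrier G" using monothetic_carrier[OF zG t] .
      obtain t\<^sub>1 t\<^sub>2 where tt: "t\<^sub>1 \<in> monothetic t" "t\<^sub>2 \<in> monothetic t" "t = t\<^sub>1 \<otimes> t\<^sub>2"
        "p_element p t\<^sub>1" "p'_element p t\<^sub>2" using p_element_split[OF p(1) tG] by blast
      have tz: "t\<^sub>1 \<in> monothetic z" "t\<^sub>2 \<in> monothetic z" using tt monothetic_mono[OF zG t] by auto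
      have t1: "t\<^sub>1 \<in> monothetic z\<^sub>1" using part(1)[OF tz(1) tt(4)] .
      have t2: "t\<^sub>2 \<in> monothetic z\<^sub>2" using part(2)[OF tz(2) tt(5)] .
      have tB: "t\<^sub>1 \<in> B" "t\<^sub>2 \<in> B" using tz mB less.prems by auto
      obtain a where a: "a \<in> W\<^sub>1" "c\<^sub>1 \<otimes> t\<^sub>1 \<in> monothetic a" using W1(3) t1 by blast
      obtain b where b: "b \<in> W\<^sub>2" "c\<^sub>2 \<otimes> t\<^sub>2 \<in> monothetic b" using W2(3) t2 by blast
      have "p'_element p (c\<^sub>2 \<otimes> t\<^sub>2)"
        using p'_element_mult[OF c(5) inG(2) tt(5) BG[OF tB(2)] comm[OF inB(2) tB(2)]] .
      then have b': "c\<^sub>2 \<otimes> t\<^sub>2 \<in> monothetic (f b)" using f(3)[OF b] by simp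
      have aB: "a \<in> B" and fB: "f b \<in> B" using W1B(1) f(1) a b by auto
      define w where "w = a \<otimes> f b"
      have wG: "w \<in> carrier G" using aB fB BG by (simp add: w_def)
      have "a \<in> monothetic w" "f b \<in> monothetic w"
        unfolding w_def
        using coprime_parts_mem[OF BG[OF aB] W1B(2)[OF a(1)] BG[OF fB] f(2)[OF b(1)] comm[OF aB fB]]
        by auto
      then have "c\<^sub>1 \<otimes> t\<^sub>1 \<in> monothetic w" "c\<^sub>2 \<otimes> t\<^sub>2 \<in> monothetic w"
        using a(2) b' monothetic_mono[OF wG] by auto
      then have "(c\<^sub>1 \<otimes> t\<^sub>1) \<otimes> (c\<^sub>2 \<otimes> t\<^sub>2) \<in> monothetic w"
        by (rule subgroup.m_closed[OF monothetic_subgroup[OF wG]])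
      also have "(c\<^sub>1 \<otimes> t\<^sub>1) \<otimes> (c\<^sub>2 \<otimes> t\<^sub>2) = c\<^sub>1 \<otimes> (t\<^sub>1 \<otimes> c\<^sub>2) \<otimes> t\<^sub>2"
        using inG BG tB by (simp add: m_assoc)
      also have "\<dots> = c\<^sub>1 \<otimes> (c\<^sub>2 \<otimes> t\<^sub>1) \<otimes> t\<^sub>2" using comm[OF tB(1) inB(2)] by simp
      also have "\<dots> = c \<otimes> t" using inG BG tB c(3) tt(3) by (simp add: m_assoc)
      finally have "c \<otimes> t \<in> monothetic w" .
      moreover have "w \<in> W" 
        unfolding W_def w_def using a(1) b(1) by (intro image_eqI[of _ _ "(a, b)"]) auto
      ultimately show ?thesis by blast
    qed
    ultimately show ?thesis by blast
  qed
qed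

lemma topologically_generated_abelian:
  assumes S: "S \<subseteq> carrier G" and comm: "\<And>s t. s \<in> S \<Longrightarrow> t \<in> S \<Longrightarrow> s \<otimes> t = t \<otimes> s"
    and x: "x \<in> topologically_generated G T S" and y: "y \<in> topologically_generated G T S"
  shows "x \<otimes> y = y \<otimes> x"
proof -
  have xG: "x \<in> carrier G" and yG: "y \<in> carrier G"
    using x y subgroup.mem_carrier[OF topologically_generated_subgroup[OF S]] by auto
  have "s \<otimes> y = y \<otimes> s" if s: "s \<in> S" for s
    using commute_closure_of[OF Hausdorff S _ comm[OF _ s] y] s S by auto
  then show ?thesis using commute_closure_of[OF Hausdorff S yG _ x] by blast
qed

text \<open>Conjugation by powers of \<open>x\<close> permutes the finite \<open>N\<close>, so some
  power \<open>z\<close> of \<open>x\<close> centralizes \<open>N\<close>. Then \<open>K\<close> is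
  a finite union of cosets \<open>c \<otimes> monothetic z\<close> with \<open>c\<close> commuting
  with \<open>z\<close>, and two powers of \<open>c\<close> lie in the same coset, whence a positive
  power of \<open>c\<close> is in \<open>monothetic z\<close>. Each coset is covered inside the
  abelian closed subgroup generated by \<open>c\<close> and \<open>z\<close>.\<close>

lemma countable_cover_finite_by_monothetic:
  assumes K: "subgroup K G" and N: "N \<lhd> G\<lparr>carrier := K\<rparr>" "finite N" and x: "x \<in> K"
    and KN: "\<And>k. k \<in> K \<Longrightarrow> \<exists>y\<in>N. \<exists>t\<in>monothetic x. k = y \<otimes> t"
  shows "\<exists>W. countable W \<and> W \<subseteq> carrier G \<and> (\<forall>k\<in>K. \<exists>w\<in>W. k \<in> monothetic w)"
proof -
  interpret K: subgroup K G by fact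
  have xG: "x \<in> carrier G" using x by simp
  have NK: "N \<subseteq> K" using subgroup.subset[OF normal_imp_subgroup[OF N(1)]] by simp
  have N_conj: "g \<otimes> y \<otimes> inv g \<in> N" if "g \<in> K" "y \<in> N" for g y
    using normal.inv_op_closed2[OF N(1), of g y] that K by simp
  have "\<exists>m>0. x [^] (m::nat) \<otimes> y = y \<otimes> x [^] m" if y: "y \<in> N" for y
  proof -
    define h where "h i = x [^] (i::nat) \<otimes> y \<otimes> inv (x [^] i)" for i
    have yG: "y \<in> carrier G" using y NK by auto
    have "range h \<subseteq> N" unfolding h_def using N_conj[OF _ y] subgroup_nat_pow[OF K x] by auto
    then have "\<not> inj h" using N(2) finite_imageD finite_subset infinite_UNIV_nat by blast
    then obtain i j where "h i = h j" "i \<noteq> j" unfolding inj_on_def by blast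
    then obtain i j where ij: "h i = h j" "i < j" by (metis linorder_neqE_nat)
    define m where "m = j - i"
    have "x [^] j = x [^] i \<otimes> x [^] m" using ij(2) xG by (simp add: m_def nat_pow_mult)
    then have "x [^] i \<otimes> (x [^] m \<otimes> y \<otimes> inv (x [^] m)) \<otimes> inv (x [^] i) = x [^] i \<otimes> y \<otimes> inv (x [^] i)"
      using ij(1) xG yG by (simp add: h_def group_word)
    then have "x [^] m \<otimes> y \<otimes> inv (x [^] m) = y" using xG yG by simp
    then have "x [^] m \<otimes> y \<otimes> inv (x [^] m) \<otimes> x [^] m = y \<otimes> x [^] m" by simp
    then have "x [^] m \<otimes> y = y \<otimes> x [^] m" using xG yG by (simp add: m_assoc)
    moreover have "0 < m" using ij(2) by (simp add: m_def)
    ultimately show ?thesis by blast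
  qed
  then obtain e where e: "\<And>y. y \<in> N \<Longrightarrow> 0 < e y" "\<And>y. y \<in> N \<Longrightarrow> x [^] (e y :: nat) \<otimes> y = y \<otimes> x [^] e y"
    by metis
  \<comment> \<open>A common multiple of the periods \<open>e y\<close>; it also bounds the
    exponents of \<open>x\<close> in the representatives \<open>F\<close>.\<close>
  define m where "m = (\<Prod>y\<in>N. e y)"
  have m: "0 < m" unfolding m_def using e(1) by (intro prod_pos) auto
  define z where "z = x [^] m"
  have zG: "z \<in> carrier G" using xG by (simp add: z_def)
  have z_N: "z \<otimes> y = y \<otimes> z" if y: "y \<in> N" for y
  proof -
    obtain k where "m = e y * k" using dvd_prodI[OF N(2) y, of e] unfolding m_def by (elim dvdE)
    then have "z = (x [^] e y) [^] k" using xG by (simp add: z_def nat_pow_pow)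
    then show ?thesis using group_commutes_pow[OF e(2)[OF y]] y NK xG by auto
  qed
  have z_x: "z \<otimes> x [^] (i::nat) = x [^] i \<otimes> z" for i
    using xG by (simp add: z_def nat_pow_mult add.commute)
  define F where "F = (\<lambda>(y, i). y \<otimes> x [^] i) ` (N \<times> {..<m})"
  have F: "finite F" using N(2) by (simp add: F_def)
  have FK: "c \<in> K" if "c \<in> F" for c
    using that NK subgroup_nat_pow[OF K x] by (auto simp: F_def)
  have F_z: "c \<otimes> z = z \<otimes> c" if "c \<in> F" for c
  proof -
    obtain y i where yi: "y \<in> N" "c = y \<otimes> x [^] (i::nat)" using \<open>c \<in> F\<close> by (auto simp: F_def)
    have yG: "y \<in> carrier G" using yi NK by auto
    have "c \<otimes> z = y \<otimes> (z \<otimes> x [^] i)" using yi yG xG zG z_x by (simp add: m_assoc)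
    also have "\<dots> = z \<otimes> c" using yi yG xG zG z_N[OF yi(1)] by (simp flip: m_assoc)
    finally show ?thesis .
  qed
  have K_F: "\<exists>c\<in>F. \<exists>s\<in>monothetic z. k = c \<otimes> s" if k: "k \<in> K" for k
  proof -
    obtain y t where yt: "y \<in> N" "t \<in> monothetic x" "k = y \<otimes> t" using KN[OF k] by blast
    obtain i s where st: "i < m" "s \<in> monothetic z" "t = s \<otimes> x [^] i"
      using monothetic_power_cosets[OF xG m] yt(2) unfolding z_def by blast
    have sG: "s \<in> carrier G" and yG: "y \<in> carrier G"
      using monothetic_carrier[OF zG st(2)] yt NK by auto
    have "s \<otimes> x [^] i = x [^] i \<otimes> s"
      using monothetic_commute[OF zG st(2) _ z_x] xG by simp
    then have "k = (y \<otimes> x [^] i) \<otimes> s" using yt st sG yG xG by (simp add: m_assoc)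
    moreover have "y \<otimes> x [^] i \<in> F" unfolding F_def
      using yt(1) st(1) by (intro image_eqI[of _ _ "(y, i)"]) auto
    ultimately show ?thesis using st(2) by blast
  qed
  have "\<exists>W. countable W \<and> W \<subseteq> carrier G \<and> (\<forall>t\<in>monothetic z. \<exists>w\<in>W. c \<otimes> t \<in> monothetic w)"
    if c: "c \<in> F" for c
  proof -
    have cK: "c \<in> K" and cG: "c \<in> carrier G" using FK[OF c] by auto
    have "\<forall>i::nat. \<exists>c'. c' \<in> F \<and> (\<exists>s\<in>monothetic z. c [^] i = c' \<otimes> s)"
      using K_F subgroup_nat_pow[OF K cK] by blast
    then obtain h where h: "\<And>i. h i \<in> F" "\<And>i::nat. \<exists>s\<in>monothetic z. c [^] i = h i \<otimes> s" by metis
    have "\<not> inj h" using F h(1) finite_imageD finite_subset infinite_UNIV_nat by (metis image_subsetI)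
    then obtain i j where "h i = h j" "i \<noteq> j" unfolding inj_on_def by blast
    then obtain i j where ij: "h i = h j" "i < j" by (metis linorder_neqE_nat)
    obtain s t where st: "s \<in> monothetic z" "c [^] i = h i \<otimes> s" "t \<in> monothetic z" "c [^] j = h i \<otimes> t"
      using h(2)[of i] h(2)[of j] ij(1) by auto
    define r where "r = j - i"
    have r: "0 < r" using ij by (simp add: r_def)
    have stG: "s \<in> carrier G" "t \<in> carrier G" "h i \<in> carrier G"
      using monothetic_carrier[OF zG] st FK[OF h(1)] by auto
    have "c [^] i \<otimes> c [^] r = c [^] j" using ij cG by (simp add: r_def nat_pow_mult)
    then have "h i \<otimes> (s \<otimes> c [^] r) = h i \<otimes> t" using st stG cG by (simp add: m_assoc)
    then have "s \<otimes> c [^] r = t" using stG cG by simp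
    then have cr: "c [^] r \<in> monothetic z"
      using subgroup_mult_cancel(2)[OF monothetic_subgroup[OF zG] _ st(1), of "c [^] r"] st(3) cG by simp
    have S: "{c, z} \<subseteq> carrier G" using cG zG by simp
    have S_comm: "s \<otimes> t = t \<otimes> s" if "s \<in> {c, z}" "t \<in> {c, z}" for s t
      using that F_z[OF c] by auto
    have "c \<in> topologically_generated G T {c, z}" "z \<in> topologically_generated G T {c, z}"
      using topologically_generated_incl[OF S] by auto
    from countable_cover_coset[OF topologically_generated_subgroup[OF S]
        closedin_topologically_generated topologically_generated_abelian[OF S S_comm] r this cr]
    obtain W where W: "countable W" "W \<subseteq> topologically_generated G T {c, z}"
      "\<forall>t\<in>monothetic z. \<exists>w\<in>W. c \<otimes> t \<in> monothetic w" by blast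
    then show ?thesis
      using subgroup.subset[OF topologically_generated_subgroup[OF S]] by blast
  qed
  then obtain V where V: "\<And>c. c \<in> F \<Longrightarrow> countable (V c)" "\<And>c. c \<in> F \<Longrightarrow> V c \<subseteq> carrier G"
    "\<And>c t. c \<in> F \<Longrightarrow> t \<in> monothetic z \<Longrightarrow> \<exists>w\<in>V c. c \<otimes> t \<in> monothetic w" by metis
  have "countable (\<Union>c\<in>F. V c)" using countable_finite[OF F] V(1) by (rule countable_UN)
  moreover have "(\<Union>c\<in>F. V c) \<subseteq> carrier G" using V(2) by auto
  moreover have "\<exists>w\<in>(\<Union>c\<in>F. V c). k \<in> monothetic w" if "k \<in> K" for k
    using K_F[OF that] V(3) by blast
  ultimately show ?thesis by (intro exI[of _ "\<Union>c\<in>F. V c"] conjI ballI)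
qed

end

section \<open>Closed subgroups and quotients\<close>

text \<open>Products of quotient maps need not be quotient maps, but products of open maps are open;
  this gives the continuity of the multiplication on a quotient group.\<close>

lemma open_map_prod:
  assumes f: "open_map A A' f" and g: "open_map B B' g"
  shows "open_map (prod_topology A B) (prod_topology A' B') (\<lambda>(x, y). (f x, g y))"
  unfolding open_map_def
proof (intro allI impI)
  fix U assume U: "openin (prod_topology A B) U"
  show "openin (prod_topology A' B') ((\<lambda>(x, y). (f x, g y)) ` U)"
    unfolding openin_prod_topology_alt
  proof (intro allI impI)
    fix a b assume "(a, b) \<in> (\<lambda>(x, y). (f x, g y)) ` U"
    then obtain x y where xy: "(x, y) \<in> U" "a = f x" "b = g y" by auto
    then obtain V W where VW: "openin A V" "openin B W" "x \<in> V" "y \<in> W" "V \<times> W \<subseteq> U"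
      using U unfolding openin_prod_topology_alt by meson
    have "openin A' (f ` V)" "openin B' (g ` W)" using f g VW unfolding open_map_def by auto
    moreover have "f ` V \<times> g ` W \<subseteq> (\<lambda>(x, y). (f x, g y)) ` U"
    proof
      fix q assume "q \<in> f ` V \<times> g ` W"
      then obtain v w where "v \<in> V" "w \<in> W" "q = (f v, g w)" by auto
      then show "q \<in> (\<lambda>(x, y). (f x, g y)) ` U"
        using VW(5) by (intro image_eqI[of _ _ "(v, w)"]) auto
    qed
    ultimately show "\<exists>V W. openin A' V \<and> openin B' W \<and> a \<in> V \<and> b \<in> W \<and>
        V \<times> W \<subseteq> (\<lambda>(x, y). (f x, g y)) ` U"
      using VW xy by (intro exI[of _ "f ` V"] exI[of _ "g ` W"]) auto
  qed
qed

context profinite_group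
begin

lemma profinite_closed_subgroup:
  assumes P: "subgroup P G" "closedin T P"
  shows "profinite_group (G\<lparr>carrier := P\<rparr>) (subtopology T P)"
proof -
  interpret P: subgroup P G by fact
  interpret H: group "G\<lparr>carrier := P\<rparr>" using P(1) by (rule subgroup_imp_group)
  have id: "continuous_map (subtopology T P) T (\<lambda>x. x)"
    using continuous_map_from_subtopology[OF continuous_map_self] .
  show ?thesis
  proof
    show top: "topspace (subtopology T P) = carrier (G\<lparr>carrier := P\<rparr>)"
      using P.subset by (auto simp: topspace_eq_carrier)
    have "continuous_map (prod_topology (subtopology T P) (subtopology T P)) T (\<lambda>p. fst p \<otimes> snd p)"
      using continuous_map_compose[OF continuous_map_fst id] continuous_map_compose[OF continuous_map_snd id]
      by (intro continuous_map_mult) (simp_all add: o_def)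
    then show "continuous_map (prod_topology (subtopology T P) (subtopology T P)) (subtopology T P)
        (\<lambda>(x, y). x \<otimes>\<^bsub>G\<lparr>carrier := P\<rparr>\<^esub> y)"
      using P.m_closed by (auto simp: continuous_map_in_subtopology case_prod_unfold)
    have "continuous_map (subtopology T P) T (\<lambda>x. inv x)"
      using id by (rule continuous_map_inv)
    then have "continuous_map (subtopology T P) T (\<lambda>x. inv\<^bsub>G\<lparr>carrier := P\<rparr>\<^esub> x)"
      by (rule continuous_map_eq) (use P(1) in simp)
    then show "continuous_map (subtopology T P) (subtopology T P) (\<lambda>x. inv\<^bsub>G\<lparr>carrier := P\<rparr>\<^esub> x)"
      using P(1) by (auto simp: continuous_map_in_subtopology)
    show "compact_space (subtopology T P)"
      using closedin_compact_space[OF compact P(2)] by (rule compact_space_subtopology)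
    show "Hausdorff_space (subtopology T P)" using Hausdorff by (rule Hausdorff_space_subtopology)
    show "\<exists>x. S \<subseteq> {x}" if "connectedin (subtopology T P) S" for S
      using that totally_disconnected by (auto simp: connectedin_subtopology)
  qed
qed

lemma topologically_generated_closed_subgroup:
  assumes P: "subgroup P G" "closedin T P" and S: "S \<subseteq> P"
  shows "topologically_generated (G\<lparr>carrier := P\<rparr>) (subtopology T P) S = topologically_generated G T S"
proof -
  have g: "generate (G\<lparr>carrier := P\<rparr>) S = generate G S" using S P(1) by (rule generate_consistent)
  have "generate G S \<subseteq> P" using S P(1) by (rule generate_subgroup_incl)
  moreover have "topologically_generated G T S \<subseteq> P"
    using S P by (rule topologically_generated_minimal)
  ultimately show ?thesis
    by (auto simp: topologically_generated_def g closure_of_subtopology Int_absorb1)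
qed

lemma procyclic_subgroup_iff:
  "procyclic_subgroup P G T \<longleftrightarrow> (\<exists>w\<in>carrier G. P = monothetic w)"
proof
  assume "procyclic_subgroup P G T"
  then have P: "subgroup P G" "closedin T P" and "procyclic (G\<lparr>carrier := P\<rparr>) (subtopology T P)"
    by (auto simp: procyclic_subgroup_def)
  then obtain a where "a \<in> P" "topologically_generated (G\<lparr>carrier := P\<rparr>) (subtopology T P) {a} = P"
    by (auto simp: procyclic_def)
  then show "\<exists>w\<in>carrier G. P = monothetic w"
    using topologically_generated_closed_subgroup[OF P, of "{a}"] subgroup.mem_carrier[OF P(1)] by auto
next
  assume "\<exists>w\<in>carrier G. P = monothetic w"
  then obtain w where w: "w \<in> carrier G" "P = monothetic w" by auto
  have P: "subgroup P G" "closedin T P" and wP: "w \<in> P"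
    using monothetic_subgroup[OF w(1)] closedin_topologically_generated monothetic_self[OF w(1)]
    by (simp_all add: w(2))
  then have "procyclic (G\<lparr>carrier := P\<rparr>) (subtopology T P)"
    using profinite_closed_subgroup[OF P] topologically_generated_closed_subgroup[OF P, of "{w}"] w(2)
    by (auto simp: procyclic_def)
  then show "procyclic_subgroup P G T" using P by (simp add: procyclic_subgroup_def)
qed

text \<open>The preimage of the image of \<open>U\<close> is a union of translates of
  \<open>U\<close> by elements of \<open>N\<close>.\<close>

lemma open_map_quotient:
  assumes N: "N \<lhd> G"
  shows "open_map T (quotient_topology T (\<lambda>x. N #> x)) (\<lambda>x. N #> x)"
  unfolding open_map_def openin_quotient_topology
proof (intro allI impI conjI)
  interpret normal N G by fact
  fix U assume U: "openin T U"
  have UG: "U \<subseteq> carrier G" using U by (rule openin_subset_carrier)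
  then show "(\<lambda>x. N #> x) ` U \<subseteq> (\<lambda>x. N #> x) ` topspace T" by (auto simp: topspace_eq_carrier)
  have "{x \<in> topspace T. N #> x \<in> (\<lambda>x. N #> x) ` U} = (\<Union>n\<in>N. {x \<in> carrier G. n \<otimes> x \<in> U})"
  proof (intro equalityI subsetI)
    fix x assume "x \<in> {x \<in> topspace T. N #> x \<in> (\<lambda>x. N #> x) ` U}"
    then obtain u where u: "x \<in> carrier G" "u \<in> U" "N #> u = N #> x" by (auto simp: topspace_eq_carrier)
    then have "u \<otimes> inv x \<in> N" using rcoset_eq_iff UG by blast
    moreover have "(u \<otimes> inv x) \<otimes> x = u" using u UG by (simp add: m_assoc subsetD)
    ultimately show "x \<in> (\<Union>n\<in>N. {x \<in> carrier G. n \<otimes> x \<in> U})" 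
      using u by (auto intro!: bexI[of _ "u \<otimes> inv x"])
  next
    fix x assume "x \<in> (\<Union>n\<in>N. {x \<in> carrier G. n \<otimes> x \<in> U})"
    then obtain n where n: "n \<in> N" "x \<in> carrier G" "n \<otimes> x \<in> U" by auto
    then have "N #> (n \<otimes> x) = N #> x" using rcoset_eq_iff[of "n \<otimes> x" x] by (simp add: m_assoc)
    then show "x \<in> {x \<in> topspace T. N #> x \<in> (\<lambda>x. N #> x) ` U}"
      using n by (auto simp: topspace_eq_carrier intro!: image_eqI[of _ _ "n \<otimes> x"])
  qed
  moreover have "openin T {x \<in> carrier G. n \<otimes> x \<in> U}" if "n \<in> N" for n
    using that U by (intro openin_preimage continuous_group_intros) auto
  ultimately show "openin T {x \<in> topspace T. N #> x \<in> (\<lambda>x. N #> x) ` U}" by auto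
qed

text \<open>Distinct cosets are separated by clopen sets: if \<open>K\<close> keeps \<open>y\<close>
  away from \<open>N #> x\<close>, then \<open>K N x\<close> is clopen and a union of cosets of
  \<open>N\<close>, so its image and that of its complement are open and disjoint. This yields the
  Hausdorff property and total disconnectedness at once.\<close>

lemma profinite_quotient:
  assumes N: "N \<lhd> G" "closedin T N"
  shows "profinite_group (G Mod N) (quotient_topology T (\<lambda>x. N #> x))"
proof -
  interpret normal N G by fact
  define Q where "Q = quotient_topology T (\<lambda>x. N #> x)"
  interpret Q: group "G Mod N" by (rule factorgroup_is_group)
  have top: "topspace Q = carrier (G Mod N)"
    by (simp add: Q_def topspace_quotient_topology topspace_eq_carrier carrier_FactGroup)
  have q: "quotient_map T Q (\<lambda>x. N #> x)" unfolding Q_def by (rule quotient_map_quotient_topology)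
  have cont: "continuous_map T Q (\<lambda>x. N #> x)" using q by (rule quotient_imp_continuous_map)
  have open_q: "open_map T Q (\<lambda>x. N #> x)" unfolding Q_def using N(1) by (rule open_map_quotient)
  have sep: "\<exists>V. openin Q V \<and> closedin Q V \<and> u \<in> V \<and> v \<notin> V"
    if uv: "u \<in> topspace Q" "v \<in> topspace Q" "u \<noteq> v" for u v
  proof -
    obtain x y where xy: "x \<in> carrier G" "y \<in> carrier G" "u = N #> x" "v = N #> y"
      using uv by (auto simp: top carrier_FactGroup)
    have "y \<notin> N #> x" using uv(3) xy repr_independence[OF _ xy(1) is_subgroup, of y] by auto
    then obtain K where K: "open_normal K" "\<forall>f\<in>N #> x. K #> f \<noteq> K #> y"
      using open_normal_separates[OF closedin_rcoset[OF N(2) xy(1)] xy(2)] by auto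
    interpret K: normal K G using K by (simp add: open_normal_def)
    have NxG: "N #> x \<subseteq> carrier G" using xy(1) by (rule r_coset_subset_G[OF subset])
    define P where "P g \<longleftrightarrow> (\<exists>f\<in>N #> x. K #> g = K #> f)" for g
    have P_N: "P g" if "P h" "N #> g = N #> h" "g \<in> carrier G" "h \<in> carrier G" for g h
    proof -
      obtain f where f: "f \<in> N #> x" "K #> h = K #> f" using \<open>P h\<close> by (auto simp: P_def)
      define n where "n = g \<otimes> inv h"
      have n: "n \<in> N" using that rcoset_eq_iff by (simp add: n_def)
      have "K #> (n \<otimes> h) = K #> (n \<otimes> f)"
        using f n that NxG by (intro K.rcoset_mult_cong) auto
      moreover have "n \<otimes> h = g" using that by (simp add: n_def m_assoc)
      moreover have "n \<otimes> f \<in> N #> x"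
      proof -
        obtain l where l: "l \<in> N" "f = l \<otimes> x" using f(1) by (auto simp: r_coset_def)
        then have "n \<otimes> f = (n \<otimes> l) \<otimes> x" using n xy by (simp add: m_assoc)
        then show ?thesis using n l unfolding r_coset_def by blast
      qed
      ultimately show ?thesis unfolding P_def by auto
    qed
    have 1: "openin T {g \<in> carrier G. P g}" by (rule openin_saturated[OF K(1)]) (auto simp: P_def)
    have 2: "openin T {g \<in> carrier G. \<not> P g}" by (rule openin_saturated[OF K(1)]) (auto simp: P_def)
    define V where "V = (\<lambda>x. N #> x) ` {g \<in> carrier G. P g}"
    have "openin Q V" using open_q 1 unfolding open_map_def V_def by blast
    moreover have "openin Q ((\<lambda>x. N #> x) ` {g \<in> carrier G. \<not> P g})"
      using open_q 2 unfolding open_map_def by blast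
    moreover have "(\<lambda>x. N #> x) ` {g \<in> carrier G. \<not> P g} = topspace Q - V"
    proof (intro equalityI subsetI)
      fix u assume "u \<in> (\<lambda>x. N #> x) ` {g \<in> carrier G. \<not> P g}"
      then obtain g where g: "g \<in> carrier G" "\<not> P g" "u = N #> g" by auto
      then have "u \<notin> V" using P_N[of _ g] unfolding V_def by auto
      then show "u \<in> topspace Q - V" using g by (auto simp: top carrier_FactGroup)
    next
      fix u assume "u \<in> topspace Q - V"
      then show "u \<in> (\<lambda>x. N #> x) ` {g \<in> carrier G. \<not> P g}"
        unfolding V_def top carrier_FactGroup by blast
    qed
    ultimately have "closedin Q V" unfolding closedin_def V_def
      by (auto simp: top carrier_FactGroup)
    moreover have "P x" unfolding P_def using rcos_self[OF xy(1) is_subgroup] by auto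
    then have "u \<in> V" using xy by (auto simp: V_def)
    moreover have "\<not> P y" using K(2) by (auto simp: P_def)
    then have "v \<notin> V" 
      using xy P_N[OF _ _ xy(2)] unfolding V_def by auto
    ultimately show ?thesis using \<open>openin Q V\<close> by blast
  qed
  show ?thesis unfolding Q_def[symmetric]
  proof
    show "topspace Q = carrier (G Mod N)" by (rule top)
    have "open_map (prod_topology T T) (prod_topology Q Q) (\<lambda>(x, y). (N #> x, N #> y))"
      using open_q open_q by (rule open_map_prod)
    moreover have "continuous_map (prod_topology T T) (prod_topology Q Q) (\<lambda>(x, y). (N #> x, N #> y))"
      using cont by (simp add: continuous_map_prod_top)
    moreover have "(\<lambda>(x, y). (N #> x, N #> y)) ` topspace (prod_topology T T) = topspace (prod_topology Q Q)"
      using quotient_imp_surjective_map[OF q] by (simp add: image_paired_Times)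
    ultimately have qq: "quotient_map (prod_topology T T) (prod_topology Q Q) (\<lambda>(x, y). (N #> x, N #> y))"
      by (intro continuous_open_imp_quotient_map)
    have "continuous_map (prod_topology T T) Q (\<lambda>p. N #> (case p of (x, y) \<Rightarrow> x \<otimes> y))"
      using continuous_map_compose[OF continuous_mult cont] by (simp add: o_def)
    then have "continuous_map (prod_topology T T) Q
        ((\<lambda>(u, v). u \<otimes>\<^bsub>G Mod N\<^esub> v) \<circ> (\<lambda>(x, y). (N #> x, N #> y)))"
      by (rule continuous_map_eq) (auto simp: topspace_eq_carrier rcos_sum)
    then show "continuous_map (prod_topology Q Q) Q (\<lambda>(u, v). u \<otimes>\<^bsub>G Mod N\<^esub> v)"
      using continuous_compose_quotient_map[OF qq] by blast
    have "continuous_map T Q (\<lambda>x. N #> inv x)"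
      using continuous_map_compose[OF continuous_inv cont] by (simp add: o_def)
    then have "continuous_map T Q ((\<lambda>u. inv\<^bsub>G Mod N\<^esub> u) \<circ> (\<lambda>x. N #> x))"
      by (rule continuous_map_eq)
        (auto simp: topspace_eq_carrier carrier_FactGroup inv_FactGroup rcos_inv)
    then show "continuous_map Q Q (\<lambda>u. inv\<^bsub>G Mod N\<^esub> u)"
      using continuous_compose_quotient_map[OF q] by blast
    have "compactin Q ((\<lambda>x. N #> x) ` topspace T)"
      using image_compactin[OF _ cont] compact by (simp add: compact_space_def)
    then show "compact_space Q"
      using quotient_imp_surjective_map[OF q] by (simp add: compact_space_def)
    show "Hausdorff_space Q" unfolding Hausdorff_space_def
    proof (intro allI impI)
      fix u v assume "u \<in> topspace Q \<and> v \<in> topspace Q \<and> u \<noteq> v"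
      then obtain V where V: "openin Q V" "closedin Q V" "u \<in> V" "v \<notin> V" "v \<in> topspace Q"
        using sep by blast
      then show "\<exists>U V. openin Q U \<and> openin Q V \<and> u \<in> U \<and> v \<in> V \<and> disjnt U V"
        by (intro exI[of _ V] exI[of _ "topspace Q - V"]) (auto simp: disjnt_def)
    qed
    show "\<exists>x. S \<subseteq> {x}" if S: "connectedin Q S" for S
    proof (cases "S = {}")
      case False
      then obtain u where u: "u \<in> S" by auto
      have SQ: "S \<subseteq> topspace Q" using S by (simp add: connectedin_def)
      have "v = u" if v: "v \<in> S" for v
      proof (rule ccontr)
        assume "v \<noteq> u"
        then obtain V where "openin Q V" "closedin Q V" "v \<in> V" "u \<notin> V"
          using sep[of v u] u v SQ by blast
        then show False using connectedin_clopen_cases[OF S] u v by (auto simp: disjnt_def)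
      qed
      then show ?thesis by blast
    qed auto
  qed
qed

text \<open>For finite \<open>N\<close> the product of \<open>N\<close> and
  \<open>monothetic x\<close> is closed and a union of cosets of \<open>N\<close>, so its image is
  closed and contains the closure of the powers of \<open>N #> x\<close>. Conversely, a continuous
  map sends a closure into the closure of the image.\<close>

lemma finite_by_procyclic_iff:
  "finite_by_procyclic G T \<longleftrightarrow> (\<exists>N. N \<lhd> G \<and> finite N \<and>
    (\<exists>x\<in>carrier G. \<forall>k\<in>carrier G. \<exists>y\<in>N. \<exists>z\<in>monothetic x. k = y \<otimes> z))"
proof -
  have "procyclic (G Mod N) (quotient_topology T (\<lambda>x. N #> x)) \<longleftrightarrow>
      (\<exists>x\<in>carrier G. \<forall>k\<in>carrier G. \<exists>y\<in>N. \<exists>z\<in>monothetic x. k = y \<otimes> z)"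
    if N: "N \<lhd> G" "finite N" for N
  proof -
    interpret normal N G by fact
    interpret Q: group "G Mod N" by (rule factorgroup_is_group)
    have Nc: "closedin T N"
      using N(2) Hausdorff subset by (simp add: closedin_Hausdorff_finite topspace_eq_carrier)
    define Q where "Q = quotient_topology T (\<lambda>x. N #> x)"
    have q: "quotient_map T Q (\<lambda>x. N #> x)" unfolding Q_def by (rule quotient_map_quotient_topology)
    have cont: "continuous_map T Q (\<lambda>x. N #> x)" using q by (rule quotient_imp_continuous_map)
    have gen: "generate (G Mod N) {N #> x} = (\<lambda>x. N #> x) ` generate G {x}" if x: "x \<in> carrier G" for x
      using Q.generate_pow[of "N #> x"] generate_pow[OF x] x
      by (auto simp: carrier_FactGroup FactGroup_int_pow)
    have "topologically_generated (G Mod N) Q {N #> x} = carrier (G Mod N) \<longleftrightarrow>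
        (\<forall>k\<in>carrier G. \<exists>y\<in>N. \<exists>z\<in>monothetic x. k = y \<otimes> z)" if x: "x \<in> carrier G" for x
    proof
      assume l: "topologically_generated (G Mod N) Q {N #> x} = carrier (G Mod N)"
      define V where "V = (\<Union>y\<in>N. (\<lambda>z. y \<otimes> z) ` monothetic x)"
      have Vc: "closedin T V" unfolding V_def
        using N(2) closedin_topologically_generated
        by (intro closedin_Union) (auto intro!: closedin_image continuous_group_intros)
      have VG: "V \<subseteq> carrier G" using Vc by (rule closedin_subset_carrier)
      have sat: "k \<in> V" if k: "k \<in> carrier G" and v: "v \<in> V" and kv: "N #> k = N #> v" for k v
      proof -
        have vG: "v \<in> carrier G" using v VG by auto
        have n: "k \<otimes> inv v \<in> N" using k vG kv rcoset_eq_iff by blast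
        obtain y z where yz: "y \<in> N" "z \<in> monothetic x" "v = y \<otimes> z" using v by (auto simp: V_def)
        have zG: "z \<in> carrier G" using monothetic_carrier[OF x yz(2)] .
        have "k = (k \<otimes> inv v) \<otimes> v" using k vG by (simp add: m_assoc)
        also have "\<dots> = (k \<otimes> inv v) \<otimes> (y \<otimes> z)" using yz(3) by simp
        also have "\<dots> = ((k \<otimes> inv v) \<otimes> y) \<otimes> z" using k vG zG subsetD[OF subset yz(1)] by (simp add: m_assoc)
        finally show ?thesis unfolding V_def using yz(1,2) m_closed[OF n yz(1)] by blast
      qed
      have eq: "{k \<in> topspace T. N #> k \<in> (\<lambda>x. N #> x) ` V} = V"
        using sat VG by (auto simp: topspace_eq_carrier)
      have VQ: "(\<lambda>x. N #> x) ` V \<subseteq> topspace Q"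
        using VG quotient_imp_surjective_map[OF q] by (auto simp: topspace_eq_carrier)
      have "closedin Q ((\<lambda>x. N #> x) ` V)"
        using q VQ Vc eq unfolding quotient_map_closedin by auto
      moreover have "generate (G Mod N) {N #> x} \<subseteq> (\<lambda>x. N #> x) ` V"
      proof -
        have "generate G {x} \<subseteq> V"
        proof
          fix g assume "g \<in> generate G {x}"
          then have g: "g \<in> monothetic x"
            using generate_subgroup_incl[OF _ monothetic_subgroup[OF x], of "{x}"] monothetic_self[OF x] by blast
          then have "g = \<one> \<otimes> g" using monothetic_carrier[OF x] by simp
          then show "g \<in> V" unfolding V_def using g one_closed by blast
        qed
        then show ?thesis unfolding gen[OF x] by blast
      qed
      ultimately have "topologically_generated (G Mod N) Q {N #> x} \<subseteq> (\<lambda>x. N #> x) ` V"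
        unfolding topologically_generated_def by (intro closure_of_minimal)
      then have "k \<in> V" if "k \<in> carrier G" for k
        using sat[OF that] that l by (auto simp: carrier_FactGroup)
      then show "\<forall>k\<in>carrier G. \<exists>y\<in>N. \<exists>z\<in>monothetic x. k = y \<otimes> z" unfolding V_def by blast
    next
      assume r: "\<forall>k\<in>carrier G. \<exists>y\<in>N. \<exists>z\<in>monothetic x. k = y \<otimes> z"
      have "(\<lambda>x. N #> x) ` monothetic x \<subseteq> topologically_generated (G Mod N) Q {N #> x}"
        unfolding topologically_generated_def gen[OF x]
        using cont by (rule continuous_map_image_closure_subset)
      moreover have "carrier (G Mod N) \<subseteq> (\<lambda>x. N #> x) ` monothetic x"
      proof
        fix u assume "u \<in> carrier (G Mod N)"
        then obtain k where k: "k \<in> carrier G" "u = N #> k" by (auto simp: carrier_FactGroup)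
        then obtain y z where yz: "y \<in> N" "z \<in> monothetic x" "k = y \<otimes> z" using r by blast
        have "z \<in> carrier G" using monothetic_carrier[OF x yz(2)] .
        then have "N #> k = N #> z" using yz k rcoset_eq_iff[of k z] by (simp add: m_assoc)
        then show "u \<in> (\<lambda>x. N #> x) ` monothetic x" using k yz(2) by auto
      qed
      moreover have "topologically_generated (G Mod N) Q {N #> x} \<subseteq> carrier (G Mod N)"
        unfolding topologically_generated_def
        using closure_of_subset_topspace[of Q] quotient_imp_surjective_map[OF q]
        by (simp add: topspace_eq_carrier carrier_FactGroup)
      ultimately show "topologically_generated (G Mod N) Q {N #> x} = carrier (G Mod N)" by auto
    qed
    then show ?thesis
      unfolding procyclic_def Q_def[symmetric]
      using profinite_quotient[OF N(1) Nc] by (auto simp: Q_def carrier_FactGroup)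
  qed
  then show ?thesis
    unfolding finite_by_procyclic_def by (simp add: profinite_group_axioms cong: conj_cong)
qed

end

theorem theorem1p1:
  fixes G :: "('a, 'b) monoid_scheme" and T :: "'a topology"
  assumes "profinite_group G T"
  shows "finite_by_procyclic (G\<lparr>carrier := commutator_subgroup G T\<rparr>)
           (subtopology T (commutator_subgroup G T)) \<longleftrightarrow>
         (\<exists>\<P>. countable \<P> \<and> (\<forall>P\<in>\<P>. procyclic_subgroup P G T) \<and> commutators G \<subseteq> \<Union>\<P>)"
proof -
  interpret profinite_group G T by fact
  define K where "K = commutator_subgroup G T"
  have S: "commutators G \<subseteq> carrier G" by (auto simp: commutators_def)
  have K: "subgroup K G" "closedin T K" and SK: "commutators G \<subseteq> K"
    unfolding K_def commutator_subgroup_def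
    using topologically_generated_subgroup[OF S] closedin_topologically_generated
      topologically_generated_incl[OF S] by auto
  interpret H: profinite_group "G\<lparr>carrier := K\<rparr>" "subtopology T K"
    using K by (rule profinite_closed_subgroup)
  have "finite_by_procyclic (G\<lparr>carrier := K\<rparr>) (subtopology T K) \<longleftrightarrow>
      (\<exists>N. N \<lhd> G\<lparr>carrier := K\<rparr> \<and> finite N \<and>
        (\<exists>x\<in>K. \<forall>k\<in>K. \<exists>y\<in>N. \<exists>z\<in>monothetic x. k = y \<otimes>\<^bsub>G\<^esub> z))"
    using H.finite_by_procyclic_iff topologically_generated_closed_subgroup[OF K] by simp
  also have "\<dots> \<longleftrightarrow> (\<exists>\<P>. countable \<P> \<and> (\<forall>P\<in>\<P>. procyclic_subgroup P G T) \<and> commutators G \<subseteq> \<Union>\<P>)"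
  proof
    assume "\<exists>N. N \<lhd> G\<lparr>carrier := K\<rparr> \<and> finite N \<and>
      (\<exists>x\<in>K. \<forall>k\<in>K. \<exists>y\<in>N. \<exists>z\<in>monothetic x. k = y \<otimes>\<^bsub>G\<^esub> z)"
    then obtain N x where N: "N \<lhd> G\<lparr>carrier := K\<rparr>" "finite N" "x \<in> K"
      and KN: "\<And>k. k \<in> K \<Longrightarrow> \<exists>y\<in>N. \<exists>z\<in>monothetic x. k = y \<otimes>\<^bsub>G\<^esub> z" by auto
    from countable_cover_finite_by_monothetic[OF K(1) N KN]
    obtain W where W: "countable W" "W \<subseteq> carrier G" "\<forall>k\<in>K. \<exists>w\<in>W. k \<in> monothetic w" by auto
    have "countable (monothetic ` W)" using W(1) by simp
    moreover have "\<forall>P\<in>monothetic ` W. procyclic_subgroup P G T"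
      using W(2) by (auto simp: procyclic_subgroup_iff)
    moreover have "commutators G \<subseteq> \<Union>(monothetic ` W)" using W(3) SK by blast
    ultimately show "\<exists>\<P>. countable \<P> \<and> (\<forall>P\<in>\<P>. procyclic_subgroup P G T) \<and> commutators G \<subseteq> \<Union>\<P>"
      by (intro exI[of _ "monothetic ` W"] conjI)
  next
    assume "\<exists>\<P>. countable \<P> \<and> (\<forall>P\<in>\<P>. procyclic_subgroup P G T) \<and> commutators G \<subseteq> \<Union>\<P>"
    then obtain \<P> where \<P>: "countable \<P>" "\<forall>P\<in>\<P>. \<exists>w\<in>carrier G. P = monothetic w" "commutators G \<subseteq> \<Union>\<P>"
      unfolding procyclic_subgroup_iff by blast
    \<comment> \<open>One generator is chosen for each member of \<open>\<P>\<close>; these form the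
      set \<open>W\<close> of \<open>covered_profinite_group\<close>.\<close>
    then obtain g where g: "\<And>P. P \<in> \<P> \<Longrightarrow> g P \<in> carrier G" "\<And>P. P \<in> \<P> \<Longrightarrow> P = monothetic (g P)"
      by metis
    interpret covered_profinite_group G T "g ` \<P>"
    proof
      show "countable (g ` \<P>)" using \<P>(1) by simp
      show "g ` \<P> \<subseteq> carrier G" using g(1) by auto
      fix x y assume "x \<in> carrier G" "y \<in> carrier G"
      then have "commutator G x y \<in> \<Union>\<P>" using \<P>(3) by (auto simp: commutators_def)
      then show "\<exists>w\<in>g ` \<P>. commutator G x y \<in> monothetic w" using g(2) by auto
    qed
    obtain M w where "open_normal M" "w \<in> carrier G"
      "\<And>g x. g \<in> carrier G \<Longrightarrow> x \<in> M \<Longrightarrow> commutator G g x \<in> monothetic w"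
      using open_normal_commutators_monothetic by blast
    then show "\<exists>N. N \<lhd> G\<lparr>carrier := K\<rparr> \<and> finite N \<and>
        (\<exists>x\<in>K. \<forall>k\<in>K. \<exists>y\<in>N. \<exists>z\<in>monothetic x. k = y \<otimes>\<^bsub>G\<^esub> z)"
      unfolding K_def by (rule finite_by_procyclic_commutator_subgroup)
  qed
  finally show ?thesis unfolding K_def .
qed

end
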